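(* Let $\beta>0$ and $\tau_1,\tau_2>0$ be fixed. For $i\in\{L,G,J\}$ let $X_n^{i,\beta}:=\log(\det W_n^{i,\beta})-\mu^i_{\beta,n}$. Then, as $n\to\infty$, for each $i\in\{L,G,J\}$ the sequence $(X_n^{i,\beta})_{n}$ converges mod-Gaussian on the strip $S_{\beta/2}=\{z\in\mathbb{C}:\mathrm{Re}(z)>-\beta/2\}$ with parameters $t_n^\beta=\frac2\beta\log n$ and limiting functions $$\psi^{L,\beta}(z)=\exp(\Upsilon(z)),\qquad \psi^{G,\beta}(z)=\exp\left(\Upsilon(z)-\frac{z^2}\beta\right),\qquad \psi^{J,\beta}(z)=\exp\left(\Upsilon(z)+\frac{z^2}{\beta}\log\left(\frac{\tau_1\tau_2}{\tau_1+\tau_2}\right)\right).$$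
   Context: Random determinants. (L) $\det W_n^{L,\beta}=\prod_{k=1}^n\lambda_k$, where $(\lambda_1,\dots,\lambda_n)$ has density on $(0,\infty)^n$ proportional to $\prod_{j<k}|\lambda_k-\lambda_j|^\beta\prod_{k=1}^n\lambda_k^{\beta/2-1}e^{-\lambda_k/2}$ ($\beta$-Laguerre ensemble). (G) $\det W_n^{G,\beta}$ is a random variable distributed as $\prod_{k=2}^n\rho_k$ with $\rho_k$ independent, $\rho_k\sim\mathrm{Beta}\left(\frac\beta2(n-k+1),\frac\beta2(k-1)\right)$ ($\beta$-Uniform Gram ensemble). (J) With $n_1=\lfloor n\tau_1\rfloor$, $n_2=\lfloor n\tau_2\rfloor$, $m=\min(n_1,n_2)$, $M=\max(n_1,n_2)$: $\det W_n^{J,\beta}=\prod_{k=1}^m\lambda_k$, where $(\lambda_1,\dots,\lambda_m)$ has density on $(0,1)^m$ proportional to $\prod_{j<k}|\lambda_k-\lambda_j|^\beta\prod_{k=1}^m\lambda_k^{\beta/2-1}(1-\lambda_k)^{\frac\beta2(M-m+1)-1}$ ($\beta$-Jacobi ensemble). Centerings: $\mu^L_{\beta,n}=(\frac12-\frac1\beta)\log n-n+n\log(\beta n)$; $\mu^G_{\beta,n}=(\frac12-\frac1\beta)\log n-n+\frac1\beta$; $\mu^J_{\beta,n}=(\frac12-\frac1\beta)\log n+(\frac12-\frac1\beta)\log\left(\frac{\tau_1\tau_2}{\tau_1+\tau_2}\right)-\varepsilon(\lfloor n\tau_1\rfloor,\lfloor n\tau_2\rfloor)-\varepsilon(\lfloor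 n\tau_2\rfloor,\lfloor n\tau_1\rfloor)$ with $\varepsilon(x,y)=x\log(1+\frac yx)$. The function $\Upsilon$ is defined for $\mathrm{Re}(z)>-\beta/2$ by $$\Upsilon(z)=\frac\beta2\log G\left(\frac{2z}\beta+1\right)-\left(z-\frac12\right)\log\Gamma\left(\frac{2z}\beta+1\right)+\int_0^\infty\frac{\varphi(s)(e^{-sz}-1)}{e^{s\beta/2}-1}ds+\frac{z^2}\beta+\frac z2,$$ $\varphi(s)=\left(\frac12-\frac1s+\frac1{e^s-1}\right)\frac1s$, where $G$ is the Barnes $G$-function (entire, $G(1)=1$, $G(z+1)=G(z)\Gamma(z)$, $G(1+z)=(2\pi)^{z/2}e^{-(z+1)z/2}\prod_{j\ge1}\{(1+\frac zj)^j(1+\frac1j)^{z^2/2}e^{-z}\}$); $\log G,\log\Gamma$ are the analytic branches on the right half-plane that are real on $(0,\infty)$. Mod-Gaussian convergence: real random variables $X_n$ with moment generating functions existing on a strip $S=\{c<\mathrm{Re}(z)<d\}$ ($-\infty\le c<0<d\le\infty$) converge mod-Gaussian on $S$ with parameters $t_n\to+\infty$ and limiting function $\psi:S\to\mathbb{C}$ if $\mathbb{E}[e^{zX_n}]e^{-t_nz^2/2}\to\psi(z)$ locally uniformly on $S$. *)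

theory Defs
  imports "HOL-Probability.Probability"
begin

section \<open>Mod-Gaussian convergence\<close>

definition strip :: "ereal \<Rightarrow> ereal \<Rightarrow> complex set" where
  "strip c d = {z. c < ereal (Re z) \<and> ereal (Re z) < d}"

(* Sequences start at n = 1. The random variables X n may live on different probability
   spaces M n. Locally uniform convergence is phrased as in the library's
   holomorphic_uniform_sequence. *)
definition mod_gaussian_convergent ::
  "(nat \<Rightarrow> 'a measure) \<Rightarrow> (nat \<Rightarrow> 'a \<Rightarrow> real) \<Rightarrow> ereal \<Rightarrow> ereal \<Rightarrow> (nat \<Rightarrow> real) \<Rightarrow>
   (complex \<Rightarrow> complex) \<Rightarrow> bool" where
  "mod_gaussian_convergent M X c d t \<psi> \<longleftrightarrow>
     c < 0 \<and> 0 < d \<and>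
     (\<forall>n\<ge>1. prob_space (M n) \<and> X n \<in> borel_measurable (M n) \<and>
        (\<forall>z \<in> strip c d. integrable (M n) (\<lambda>\<omega>. exp (z * complex_of_real (X n \<omega>))))) \<and>
     filterlim t at_top sequentially \<and>
     (\<forall>z \<in> strip c d. \<exists>r>0. cball z r \<subseteq> strip c d \<and>
        uniform_limit (cball z r)
          (\<lambda>n w. (LINT \<omega>|M n. exp (w * complex_of_real (X n \<omega>))) *
                 exp (- (complex_of_real (t n) * w\<^sup>2 / 2)))
          \<psi> sequentially)"

section \<open>The random matrix ensembles\<close>

(* The random vector (lam k), k in I, has a joint density with respect to Lebesgue measure
   on the I-indexed product that is proportional to w; if I is empty, the product is a
   one-point space. *)
definition has_density_proportional_to ::
  "'a measure \<Rightarrow> nat set \<Rightarrow> (nat \<Rightarrow> 'a \<Rightarrow> real) \<Rightarrow> ((nat \<Rightarrow> real) \<Rightarrow> real) \<Rightarrow> bool" where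
  "has_density_proportional_to M I lam w \<longleftrightarrow>
     (\<exists>C>0. distributed M (\<Pi>\<^sub>M k\<in>I. lborel) (\<lambda>\<omega>. \<lambda>k\<in>I. lam k \<omega>) (\<lambda>x. ennreal (C * w x)))"

definition laguerre_weight :: "real \<Rightarrow> nat \<Rightarrow> (nat \<Rightarrow> real) \<Rightarrow> real" where
  "laguerre_weight \<beta> n x =
     (if \<forall>k\<in>{1..n}. 0 < x k
      then (\<Prod>k=1..n. \<Prod>j=1..<k. \<bar>x k - x j\<bar> powr \<beta>) *
           (\<Prod>k=1..n. x k powr (\<beta>/2 - 1) * exp (- x k / 2))
      else 0)"

definition laguerre_ensemble :: "real \<Rightarrow> nat \<Rightarrow> 'a measure \<Rightarrow> (nat \<Rightarrow> 'a \<Rightarrow> real) \<Rightarrow> bool" where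
  "laguerre_ensemble \<beta> n M lam \<longleftrightarrow>
     prob_space M \<and> has_density_proportional_to M {1..n} lam (laguerre_weight \<beta> n)"

definition jacobi_weight :: "real \<Rightarrow> nat \<Rightarrow> nat \<Rightarrow> (nat \<Rightarrow> real) \<Rightarrow> real" where
  "jacobi_weight \<beta> n1 n2 x =
     (let m = min n1 n2; m' = max n1 n2 in
      if \<forall>k\<in>{1..m}. 0 < x k \<and> x k < 1
      then (\<Prod>k=1..m. \<Prod>j=1..<k. \<bar>x k - x j\<bar> powr \<beta>) *
           (\<Prod>k=1..m. x k powr (\<beta>/2 - 1) *
                      (1 - x k) powr (\<beta>/2 * (real m' - real m + 1) - 1))
      else 0)"

definition jacobi_ensemble ::
  "real \<Rightarrow> nat \<Rightarrow> nat \<Rightarrow> 'a measure \<Rightarrow> (nat \<Rightarrow> 'a \<Rightarrow> real) \<Rightarrow> bool" where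
  "jacobi_ensemble \<beta> n1 n2 M lam \<longleftrightarrow>
     prob_space M \<and> has_density_proportional_to M {1..min n1 n2} lam (jacobi_weight \<beta> n1 n2)"

definition beta_density :: "real \<Rightarrow> real \<Rightarrow> real \<Rightarrow> real" where
  "beta_density a b x =
     (if 0 < x \<and> x < 1 then x powr (a - 1) * (1 - x) powr (b - 1) / Beta a b else 0)"

definition gram_factors :: "real \<Rightarrow> nat \<Rightarrow> 'a measure \<Rightarrow> (nat \<Rightarrow> 'a \<Rightarrow> real) \<Rightarrow> bool" where
  "gram_factors \<beta> n Q \<rho> \<longleftrightarrow>
     prob_space Q \<and> prob_space.indep_vars Q (\<lambda>_. borel) \<rho> {2..n} \<and>
     (\<forall>k\<in>{2..n}. distributed Q lborel (\<rho> k)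
        (\<lambda>x. ennreal (beta_density (\<beta>/2 * (real n - real k + 1)) (\<beta>/2 * (real k - 1)) x)))"

(* The determinant D is only required to have the same law as the product of the factors,
   which may live on another probability space Q. *)
definition gram_determinant ::
  "real \<Rightarrow> nat \<Rightarrow> 'a measure \<Rightarrow> ('a \<Rightarrow> real) \<Rightarrow> 'b measure \<Rightarrow> (nat \<Rightarrow> 'b \<Rightarrow> real) \<Rightarrow> bool" where
  "gram_determinant \<beta> n M D Q \<rho> \<longleftrightarrow>
     prob_space M \<and> D \<in> borel_measurable M \<and> gram_factors \<beta> n Q \<rho> \<and>
     distr M borel D = distr Q borel (\<lambda>\<omega>. \<Prod>k=2..n. \<rho> k \<omega>)"

section \<open>Centerings\<close>

definition mu_L :: "real \<Rightarrow> nat \<Rightarrow> real" where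
  "mu_L \<beta> n = (1/2 - 1/\<beta>) * ln (real n) - real n + real n * ln (\<beta> * real n)"

definition mu_G :: "real \<Rightarrow> nat \<Rightarrow> real" where
  "mu_G \<beta> n = (1/2 - 1/\<beta>) * ln (real n) - real n + 1/\<beta>"

definition eps :: "real \<Rightarrow> real \<Rightarrow> real" where
  "eps x y = x * ln (1 + y / x)"

(* The floor of n * tau. *)
definition dim_J :: "real \<Rightarrow> nat \<Rightarrow> nat" where
  "dim_J \<tau> n = nat \<lfloor>real n * \<tau>\<rfloor>"

(* For the finitely many n for which one of the dimensions vanishes, eps takes the value 0
   because of division by zero; this does not affect the limit. *)
definition mu_J :: "real \<Rightarrow> real \<Rightarrow> real \<Rightarrow> nat \<Rightarrow> real" where
  "mu_J \<beta> \<tau>1 \<tau>2 n =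
     (1/2 - 1/\<beta>) * ln (real n) + (1/2 - 1/\<beta>) * ln (\<tau>1 * \<tau>2 / (\<tau>1 + \<tau>2))
     - eps (real (dim_J \<tau>1 n)) (real (dim_J \<tau>2 n))
     - eps (real (dim_J \<tau>2 n)) (real (dim_J \<tau>1 n))"

section \<open>The Barnes G-function and the limiting function\<close>

(* Weierstrass-type product for G(1+w), at w = z - 1; the product over j >= 1 is reindexed to
   start at 0. *)
definition barnes_G :: "complex \<Rightarrow> complex" where
  "barnes_G z =
     (let w = z - 1 in
      complex_of_real (2 * pi) powr (w / 2) * exp (- ((w + 1) * w / 2)) *
      (\<Prod>j. (1 + w / of_nat (Suc j)) ^ Suc j *
            (1 + 1 / of_nat (Suc j)) powr (w\<^sup>2 / 2) * exp (- w)))"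

(* The analytic logarithm of f on the right half-plane that is real on the positive axis.
   For f without zeros there, any two choices agree on the half-plane; outside of it the
   value is unspecified. *)
definition log_right_half_plane :: "(complex \<Rightarrow> complex) \<Rightarrow> complex \<Rightarrow> complex" where
  "log_right_half_plane f =
     (SOME L. L holomorphic_on {z. 0 < Re z} \<and> (\<forall>z. 0 < Re z \<longrightarrow> exp (L z) = f z) \<and>
              (\<forall>x::real. 0 < x \<longrightarrow> L (complex_of_real x) \<in> \<real>))"

definition phi :: "real \<Rightarrow> real" where
  "phi s = (1/2 - 1/s + 1 / (exp s - 1)) * (1/s)"

(* The library's ln_Gamma is the analytic branch of log Gamma off the nonpositive real axis
   that is real on the positive axis. *)
definition Upsilon :: "real \<Rightarrow> complex \<Rightarrow> complex" where
  "Upsilon \<beta> z =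
     complex_of_real (\<beta>/2) * log_right_half_plane barnes_G (2 * z / of_real \<beta> + 1)
     - (z - 1/2) * ln_Gamma (2 * z / of_real \<beta> + 1)
     + (LINT s:{0<..}|lborel.
          of_real (phi s) * (exp (- (of_real s * z)) - 1) / of_real (exp (s * \<beta> / 2) - 1))
     + z\<^sup>2 / of_real \<beta> + z / 2"

end

theory Submission
  imports Defs "HOL-Complex_Analysis.Complex_Analysis"
begin

text \<open>
The moment generating functions of the three log-determinants are explicit, and the theorem is an
asymptotic expansion of the resulting products of Gamma values.

For the Laguerre and Jacobi ensembles the complex moments of the determinant are quotients of Selberg
integrals. Raising the exponent of the coordinates by one multiplies a Selberg integral by an explicit
rational function of that exponent; this is Aomoto's recursion (\<open>aomoto_product\<close>), an integration by
parts followed by an exchange of two coordinates. The product \<open>\<bar>x i - x j\<bar> powr \<beta>\<close> is not differentiable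
for small \<open>\<beta>\<close>, so the integration by parts is done for \<open>((x i - x j)\<^sup>2 + \<delta>) powr (\<beta> / 2)\<close>. The exchange of
coordinates removes the singular quotient, and only then \<open>\<delta>\<close> tends to 0. As a function of a real
exponent the Selberg integral is log-convex, so the argument of Bohr and Mollerup identifies it with a
quotient of Gamma products (\<open>selberg_real_formula\<close>), and the identity theorem extends the formula to the
right half-plane (\<open>selberg_formula\<close>). A Beta variable is the Jacobi ensemble with one eigenvalue, which
settles the factors of the Gram determinant. With \<open>g = \<beta> / 2\<close> and \<open>L n z = (\<Prod>k=1..n. Gamma (g * k + z) / Gamma (g * k))\<close>
(this is \<open>gamma_product\<close>) the moment generating functions are \<open>2 powr (n * z) * L n z\<close> (Laguerre),
\<open>L n z * (Gamma (g * n) / Gamma (g * n + z)) ^ n\<close> (Gram) and \<open>L n1 z * L n2 z / L (n1 + n2) z\<close> (Jacobi).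

It remains to expand \<open>L n z\<close> locally uniformly (\<open>log_gamma_product_limit\<close>). Binet's formula, proved for
complex arguments in \<open>ln_Gamma_complex_binet\<close>, turns \<open>ln (L n z)\<close> into elementary sums and a sum of Binet
integrals. The latter is geometric under the integral sign and yields the integral in \<open>Upsilon\<close>. The
elementary sums are, with \<open>w = z / g\<close>, a factorial, the sum of \<open>Ln (1 + w / k)\<close>, which is a quotient of Gamma
values, and the sum of \<open>k * Ln (1 + w / k)\<close>, which up to explicit terms is the logarithm of a partial
product of the Barnes function. The result is
\<open>ln (L n z) = z * log_gamma_center \<beta> n + z\<^sup>2 / \<beta> * ln n + Upsilon \<beta> z + o(1)\<close>.
The Laguerre case is immediate. The Gram case needs in addition the second-order expansion of
\<open>Gamma (x + z) / Gamma x\<close> (\<open>ln_Gamma_ratio_limit\<close>), and the Jacobi case combines three expansions.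
\<close>

section \<open>Integration by parts for a weight of Pearson type\<close>

text \<open>Laguerre and Jacobi are treated together. The weight \<open>x powr (a - 1) * v x\<close> on \<open>(0, R)\<close> has the
property that multiplying it by \<open>x * (1 - c * x)\<close> and differentiating gives a linear polynomial times
the weight, because \<open>(1 - c * x) * v x\<close> has derivative \<open>- e0 * v x\<close>. Laguerre is \<open>c = 0\<close>,
\<open>v x = exp (- x / 2)\<close>, \<open>R = \<infinity>\<close>; Jacobi is \<open>c = 1\<close>, \<open>v x = (1 - x) powr (b - 1)\<close>, \<open>R = 1\<close>. The last two
assumptions make the boundary terms of an integration by parts vanish.\<close>
locale pearson_weight =
  fixes R :: ereal and c e0 :: real and v :: "real \<Rightarrow> real"
  assumes R_pos: "0 < R" and c_nonneg: "0 \<le> c" and e0_pos: "0 < e0"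
    and v_nonneg: "\<And>x. 0 \<le> v x"
    and v_outside: "\<And>x. \<not> (0 < x \<and> ereal x < R) \<Longrightarrow> v x = 0"
    and v_meas [measurable]: "v \<in> borel_measurable borel"
    and v_cont: "\<And>x. 0 < x \<Longrightarrow> ereal x < R \<Longrightarrow> isCont v x"
    and v_deriv: "\<And>x. 0 < x \<Longrightarrow> ereal x < R \<Longrightarrow>
          ((\<lambda>x. (1 - c * x) * v x) has_real_derivative - e0 * v x) (at x)"
    and v_moments: "\<And>a p. 0 < a \<Longrightarrow>
          integrable lborel (\<lambda>x. (1 + \<bar>x\<bar>) ^ p * (x powr (a - 1) * v x))"
    and v_left: "\<exists>l. (v \<longlongrightarrow> l) (at_right 0)"
    and v_right: "\<And>p. (((\<lambda>x. (1 + \<bar>x\<bar>) ^ p * ((1 - c * x) * v x)) \<circ> real_of_ereal) \<longlongrightarrow> 0) (at_left R)"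
begin

text \<open>The integrand is the derivative of \<open>x powr a * (1 - c * x) * v x * f x\<close>, which vanishes at both ends
of \<open>(0, R)\<close>.\<close>
lemma integral_by_parts:
  fixes f f' :: "real \<Rightarrow> real"
  assumes a: "0 < a" and f: "\<And>x. (f has_real_derivative f' x) (at x)"
    and f': "continuous_on UNIV f'"
    and bf: "\<And>x. \<bar>f x\<bar> \<le> C * (1 + \<bar>x\<bar>) ^ p" and bf': "\<And>x. \<bar>f' x\<bar> \<le> C * (1 + \<bar>x\<bar>) ^ p"
  shows "(LINT x|lborel. ((a - (c * a + e0) * x) * f x + x * (1 - c * x) * f' x)
            * (x powr (a - 1) * v x)) = 0"
proof -
  define g where "g = (\<lambda>x. ((a - (c * a + e0) * x) * f x + x * (1 - c * x) * f' x)
            * (x powr (a - 1) * v x))"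
  define F where "F = (\<lambda>x. x powr a * ((1 - c * x) * v x) * f x)"
  have contf: "continuous_on UNIV f"
    using f by (meson DERIV_isCont continuous_at_imp_continuous_on)
  have [measurable]: "f \<in> borel_measurable borel" "f' \<in> borel_measurable borel"
    using contf f' by (auto intro: borel_measurable_continuous_onI)
  have C: "0 \<le> C" using bf[of 0] by simp
  have g_int: "integrable lborel g"
  proof (rule Bochner_Integration.integrable_bound)
    show "integrable lborel (\<lambda>x. (\<bar>a\<bar> + \<bar>c * a + e0\<bar> + 1 + \<bar>c\<bar>) * C *
        ((1 + \<bar>x\<bar>) ^ (p + 2) * (x powr (a - 1) * v x)))"
      by (intro integrable_mult_right v_moments a)
    show "AE x in lborel. norm (g x) \<le> norm ((\<bar>a\<bar> + \<bar>c * a + e0\<bar> + 1 + \<bar>c\<bar>) * C *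
        ((1 + \<bar>x\<bar>) ^ (p + 2) * (x powr (a - 1) * v x)))"
    proof (rule AE_I2)
      fix x :: real
      define u where "u = 1 + \<bar>x\<bar>"
      have u: "1 \<le> u" by (simp add: u_def)
      have u2: "u \<le> u\<^sup>2" using u by (simp add: power2_eq_square)
      have xu: "\<bar>x\<bar> \<le> u" by (simp add: u_def)
      have xu2: "\<bar>x\<bar> * \<bar>x\<bar> \<le> u\<^sup>2" using mult_mono[OF xu xu] u by (simp add: power2_eq_square)
      have b1: "\<bar>a - (c * a + e0) * x\<bar> \<le> (\<bar>a\<bar> + \<bar>c * a + e0\<bar>) * u\<^sup>2"
      proof -
        have "\<bar>a - (c * a + e0) * x\<bar> \<le> \<bar>a\<bar> + \<bar>c * a + e0\<bar> * \<bar>x\<bar>"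
          by (metis abs_mult abs_triangle_ineq4)
        also have "\<dots> \<le> \<bar>a\<bar> * u\<^sup>2 + \<bar>c * a + e0\<bar> * u\<^sup>2"
          using u u2 xu by (intro add_mono mult_left_mono) (auto intro: mult_left_mono[of 1 "u\<^sup>2" "\<bar>a\<bar>", simplified])
        finally show ?thesis by (simp add: algebra_simps)
      qed
      have b2: "\<bar>x * (1 - c * x)\<bar> \<le> (1 + \<bar>c\<bar>) * u\<^sup>2"
      proof -
        have "\<bar>x * (1 - c * x)\<bar> = \<bar>x - c * (x * x)\<bar>" by (simp add: algebra_simps)
        also have "\<dots> \<le> \<bar>x\<bar> + \<bar>c\<bar> * (\<bar>x\<bar> * \<bar>x\<bar>)"
          by (metis abs_mult abs_triangle_ineq4)
        also have "\<dots> \<le> u\<^sup>2 + \<bar>c\<bar> * u\<^sup>2"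
          using u u2 xu xu2 by (intro add_mono mult_left_mono) auto
        finally show ?thesis by (simp add: algebra_simps)
      qed
      have "\<bar>(a - (c * a + e0) * x) * f x + x * (1 - c * x) * f' x\<bar> \<le>
          \<bar>a - (c * a + e0) * x\<bar> * \<bar>f x\<bar> + \<bar>x * (1 - c * x)\<bar> * \<bar>f' x\<bar>"
        by (metis abs_mult abs_triangle_ineq)
      also have "\<dots> \<le> ((\<bar>a\<bar> + \<bar>c * a + e0\<bar>) * u\<^sup>2) * (C * u ^ p) + ((1 + \<bar>c\<bar>) * u\<^sup>2) * (C * u ^ p)"
        using b1 b2 bf[of x] bf'[of x] unfolding u_def[symmetric] 
        by (intro add_mono mult_mono) auto
      also have "\<dots> = (\<bar>a\<bar> + \<bar>c * a + e0\<bar> + 1 + \<bar>c\<bar>) * C * u ^ (p + 2)"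
        by (simp add: algebra_simps power_add power2_eq_square)
      finally have "norm (g x) \<le> (\<bar>a\<bar> + \<bar>c * a + e0\<bar> + 1 + \<bar>c\<bar>) * C * u ^ (p + 2) * (x powr (a - 1) * v x)"
        unfolding g_def real_norm_def abs_mult using v_nonneg[of x]
        by (simp add: mult_right_mono)
      also have "\<dots> = norm \<dots>" using C v_nonneg[of x] u by simp
      finally show "norm (g x) \<le> norm ((\<bar>a\<bar> + \<bar>c * a + e0\<bar> + 1 + \<bar>c\<bar>) * C *
        ((1 + \<bar>x\<bar>) ^ (p + 2) * (x powr (a - 1) * v x)))"
        by (simp only: u_def mult.assoc)
    qed
  qed (simp add: g_def)
  have F': "(F has_real_derivative g x) (at x)" if x: "0 < x" "ereal x < R" for x
  proof -
    have "((\<lambda>x. x powr a) has_real_derivative a * x powr (a - 1)) (at x)"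
      using x by (auto intro!: derivative_eq_intros simp: powr_diff)
    from DERIV_mult[OF DERIV_mult[OF this v_deriv[OF x]] f[of x]]
    have "(F has_real_derivative
        (a * x powr (a - 1) * ((1 - c * x) * v x) + x powr a * (- e0 * v x)) * f x
           + x powr a * ((1 - c * x) * v x) * f' x) (at x)"
      by (simp add: F_def mult_ac add_ac)
    also have "(a * x powr (a - 1) * ((1 - c * x) * v x) + x powr a * (- e0 * v x)) * f x
           + x powr a * ((1 - c * x) * v x) * f' x = g x"
    proof -
      have *: "x powr a = x * x powr (a - 1)" using x by (simp add: powr_diff)
      show ?thesis unfolding g_def * by (simp add: algebra_simps)
    qed
    finally show ?thesis .
  qed
  have gcont: "isCont g x" if x: "0 < x" "ereal x < R" for x
    unfolding g_def using v_cont[OF x] contf f' x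
    by (auto intro!: continuous_intros simp: continuous_on_eq_continuous_at)
  have "(LBINT x=0..R. g x) = 0 - 0"
  proof (rule interval_integral_FTC_integrable)
    show "0 < R" by (rule R_pos)
    fix x assume x: "0 < ereal x" "ereal x < R"
    show "(F has_vector_derivative g x) (at x)"
      using F'[of x] x by (simp add: has_real_derivative_iff_has_vector_derivative zero_ereal_def)
    show "isCont g x" using gcont x by (simp add: zero_ereal_def)
  next
    show "set_integrable lborel (einterval 0 R) g"
      unfolding set_integrable_def by (intro integrable_mult_indicator g_int) auto
  next
    obtain l where l: "(v \<longlongrightarrow> l) (at_right 0)" using v_left by blast
    have "(f \<longlongrightarrow> f 0) (at_right 0)"
      using contf by (auto simp: continuous_on_eq_continuous_at isCont_def intro: filterlim_at_split[THEN iffD1, THEN conjunct2])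
    moreover have "((\<lambda>x. x powr a) \<longlongrightarrow> 0) (at_right (0::real))"
      using a by (auto intro!: tendsto_eq_intros simp: eventually_at_filter)
    ultimately have "(F \<longlongrightarrow> 0 * ((1 - c * 0) * l) * f 0) (at_right 0)"
      unfolding F_def by (intro tendsto_intros l)
    then show "((F \<circ> real_of_ereal) \<longlongrightarrow> 0) (at_right 0)"
      by (simp add: zero_ereal_def ereal_tendsto_simps)
  next
    define q where "q = nat \<lceil>a\<rceil> + p"
    have lim: "((\<lambda>t. C * (((\<lambda>x. (1 + \<bar>x\<bar>) ^ q * ((1 - c * x) * v x)) \<circ> real_of_ereal) t)) \<longlongrightarrow> C * 0) (at_left R)"
      by (intro tendsto_mult_left v_right)
    have "\<bar>F x\<bar> \<le> \<bar>C * ((1 + \<bar>x\<bar>) ^ q * ((1 - c * x) * v x))\<bar>" for x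
    proof (cases "0 < x")
      case False
      then show ?thesis using v_outside[of x] by (simp add: F_def)
    next
      case True
      have "x powr a \<le> (1 + \<bar>x\<bar>) powr a"
        using True a by (intro powr_mono2) auto
      also have "\<dots> \<le> (1 + \<bar>x\<bar>) powr real (nat \<lceil>a\<rceil>)"
        using a by (intro powr_mono) linarith+
      also have "\<dots> = (1 + \<bar>x\<bar>) ^ nat \<lceil>a\<rceil>" by (simp add: powr_realpow)
      finally have "x powr a * \<bar>f x\<bar> \<le> (1 + \<bar>x\<bar>) ^ nat \<lceil>a\<rceil> * (C * (1 + \<bar>x\<bar>) ^ p)"
        using bf[of x] by (intro mult_mono) auto
      also have "\<dots> = C * (1 + \<bar>x\<bar>) ^ q" by (simp add: q_def power_add)
      finally have "x powr a * \<bar>f x\<bar> * \<bar>(1 - c * x) * v x\<bar> \<le> C * (1 + \<bar>x\<bar>) ^ q * \<bar>(1 - c * x) * v x\<bar>"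
        by (rule mult_right_mono) simp
      then show ?thesis using C by (simp add: F_def abs_mult mult_ac)
    qed
    then have "eventually (\<lambda>t. norm ((F \<circ> real_of_ereal) t) \<le> norm (C * (((\<lambda>x. (1 + \<bar>x\<bar>) ^ q * ((1 - c * x) * v x)) \<circ> real_of_ereal) t)) * 1) (at_left R)"
      by (intro always_eventually allI) (simp only: o_def real_norm_def mult_1_right)
    from tendsto_0_le[OF lim[unfolded mult_zero_right] this]
    show "((F \<circ> real_of_ereal) \<longlongrightarrow> 0) (at_left R)" .
  qed
  moreover have "(LBINT x=0..R. g x) = (LINT x|lborel. g x)"
  proof -
    have "indicator (einterval 0 R) x *\<^sub>R g x = g x" for x
      using v_outside[of x] by (auto simp: indicator_def einterval_def g_def zero_ereal_def)
    then have "(LINT x|lborel. indicator (einterval 0 R) x *\<^sub>R g x) = (LINT x|lborel. g x)"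
      by (simp only:)
    then show ?thesis using R_pos
      by (simp only: interval_lebesgue_integral_def set_lebesgue_integral_def less_imp_le if_True)
  qed
  ultimately show ?thesis by (simp add: g_def)
qed

end

section \<open>The regularised Vandermonde product\<close>

text \<open>For \<open>\<delta> = 0\<close> this is the product of \<open>\<bar>x i - x j\<bar> powr \<beta>\<close> over unordered pairs: each pair occurs twice,
and squaring doubles the exponent again, hence the exponent \<open>\<beta> / 4\<close>. For \<open>\<delta> > 0\<close> it is smooth, whereas
for \<open>\<beta> < 1\<close> the derivative of the original product is unbounded on the diagonals.\<close>
definition vandermonde :: "real \<Rightarrow> real \<Rightarrow> nat set \<Rightarrow> (nat \<Rightarrow> real) \<Rightarrow> real" where
  "vandermonde \<beta> \<delta> I x = (\<Prod>i\<in>I. \<Prod>j\<in>I - {i}. ((x i - x j)\<^sup>2 + \<delta>) powr (\<beta> / 4))"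

text \<open>The functions integrated against the ensemble weights are dominated by powers of this product. Since it splits over the
coordinates, integrability against a product weight reduces to moments in one variable.\<close>
definition growth :: "nat set \<Rightarrow> (nat \<Rightarrow> real) \<Rightarrow> real" where
  "growth I x = (\<Prod>i\<in>I. 1 + \<bar>x i\<bar>)"

definition poly_bounded :: "nat set \<Rightarrow> ((nat \<Rightarrow> real) \<Rightarrow> real) \<Rightarrow> bool" where
  "poly_bounded I g \<longleftrightarrow> g \<in> borel_measurable (Pi\<^sub>M I (\<lambda>_. lborel)) \<and>
     (\<exists>C p. 0 \<le> C \<and> (\<forall>x. \<bar>g x\<bar> \<le> C * growth I x ^ p))"

lemma growth_ge_1: "1 \<le> growth I x"
  unfolding growth_def by (intro prod_ge_1) auto

lemma coord_le_growth: "finite I \<Longrightarrow> i \<in> I \<Longrightarrow> 1 + \<bar>x i\<bar> \<le> growth I x"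
proof -
  assume "finite I" "i \<in> I"
  then have "growth I x = (1 + \<bar>x i\<bar>) * growth (I - {i}) x" unfolding growth_def by (subst prod.remove) auto
  moreover have "(1 + \<bar>x i\<bar>) * 1 \<le> (1 + \<bar>x i\<bar>) * growth (I - {i}) x"
    by (intro mult_left_mono growth_ge_1) auto
  ultimately show ?thesis by simp
qed

lemma poly_boundedI:
  "g \<in> borel_measurable (Pi\<^sub>M I (\<lambda>_. lborel)) \<Longrightarrow> 0 \<le> C \<Longrightarrow> (\<And>x. \<bar>g x\<bar> \<le> C * growth I x ^ p)
    \<Longrightarrow> poly_bounded I g"
  unfolding poly_bounded_def by blast

lemma poly_bounded_const: "poly_bounded I (\<lambda>_. k)"
  by (rule poly_boundedI[of _ _ "\<bar>k\<bar>" 0]) auto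

lemma poly_bounded_bounded:
  assumes "g \<in> borel_measurable (Pi\<^sub>M I (\<lambda>_. lborel))" "\<And>x. \<bar>g x\<bar> \<le> C"
  shows "poly_bounded I g"
proof (rule poly_boundedI[of _ _ C 0])
  show "0 \<le> C" using assms(2)[of undefined] by linarith
  show "\<bar>g x\<bar> \<le> C * growth I x ^ 0" for x using assms(2)[of x] by simp
qed (rule assms(1))

lemma poly_bounded_coord:
  assumes "finite I" "i \<in> I" shows "poly_bounded I (\<lambda>x. x i)"
proof (rule poly_boundedI[of _ _ 1 1])
  fix x :: "nat \<Rightarrow> real"
  show "\<bar>x i\<bar> \<le> 1 * growth I x ^ 1" using coord_le_growth[OF assms, of x] by simp
next
  show "(\<lambda>x. x i) \<in> borel_measurable (Pi\<^sub>M I (\<lambda>_. lborel))" using assms(2) by measurable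
qed simp

lemma poly_bounded_mult:
  assumes "poly_bounded I f" "poly_bounded I g" shows "poly_bounded I (\<lambda>x. f x * g x)"
proof -
  from assms obtain C p D q where C: "0 \<le> C" "\<And>x. \<bar>f x\<bar> \<le> C * growth I x ^ p"
    and D: "0 \<le> D" "\<And>x. \<bar>g x\<bar> \<le> D * growth I x ^ q" unfolding poly_bounded_def by blast
  have "\<bar>f x * g x\<bar> \<le> (C * D) * growth I x ^ (p + q)" for x
  proof -
    have "\<bar>f x\<bar> * \<bar>g x\<bar> \<le> (C * growth I x ^ p) * (D * growth I x ^ q)"
      using C D growth_ge_1[of I x] by (intro mult_mono) auto
    then show ?thesis by (simp add: abs_mult power_add mult_ac)
  qed
  then show ?thesis using assms C(1) D(1) 
    by (intro poly_boundedI[of _ _ "C * D" "p + q"]) (auto simp: poly_bounded_def)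
qed

lemma poly_bounded_add:
  assumes "poly_bounded I f" "poly_bounded I g" shows "poly_bounded I (\<lambda>x. f x + g x)"
proof -
  from assms obtain C p D q where C: "0 \<le> C" "\<And>x. \<bar>f x\<bar> \<le> C * growth I x ^ p"
    and D: "0 \<le> D" "\<And>x. \<bar>g x\<bar> \<le> D * growth I x ^ q" unfolding poly_bounded_def by blast
  have "\<bar>f x + g x\<bar> \<le> (C + D) * growth I x ^ (p + q)" for x
  proof -
    have "\<bar>f x + g x\<bar> \<le> C * growth I x ^ p + D * growth I x ^ q"
      using C(2)[of x] D(2)[of x] by linarith
    also have "\<dots> \<le> C * growth I x ^ (p + q) + D * growth I x ^ (p + q)"
      using C D growth_ge_1[of I x] by (intro add_mono mult_left_mono power_increasing) auto
    finally show ?thesis by (simp add: algebra_simps)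
  qed
  then show ?thesis using assms C(1) D(1) 
    by (intro poly_boundedI[of _ _ "C + D" "p + q"]) (auto simp: poly_bounded_def)
qed

lemma poly_bounded_diff:
  assumes "poly_bounded I f" "poly_bounded I g" shows "poly_bounded I (\<lambda>x. f x - g x)"
  using poly_bounded_add[OF assms(1) poly_bounded_mult[OF poly_bounded_const[of I "-1"] assms(2)]]
  by simp

lemma poly_bounded_sum:
  "(\<And>j. j \<in> J \<Longrightarrow> poly_bounded I (f j)) \<Longrightarrow> poly_bounded I (\<lambda>x. \<Sum>j\<in>J. f j x)"
  by (induction J rule: infinite_finite_induct)
     (auto intro!: poly_bounded_const[of I 0, simplified] poly_bounded_add)

lemma poly_bounded_prod:
  "(\<And>j. j \<in> J \<Longrightarrow> poly_bounded I (f j)) \<Longrightarrow> poly_bounded I (\<lambda>x. \<Prod>j\<in>J. f j x)"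
  by (induction J rule: infinite_finite_induct)
     (auto intro!: poly_bounded_const[of I 1, simplified] poly_bounded_mult)

lemma diff_sq_le:
  fixes u w \<delta> :: real
  assumes "0 \<le> \<delta>" "\<delta> \<le> 1"
  shows "(u - w)\<^sup>2 + \<delta> \<le> ((1 + \<bar>u\<bar>) * (1 + \<bar>w\<bar>))\<^sup>2"
proof -
  have "(u - w)\<^sup>2 \<le> (\<bar>u\<bar> + \<bar>w\<bar>)\<^sup>2" by (rule power2_le_iff_abs_le[THEN iffD2]) auto
  moreover have "(\<bar>u\<bar> + \<bar>w\<bar>)\<^sup>2 + 1 \<le> (1 + (\<bar>u\<bar> + \<bar>w\<bar>))\<^sup>2" by (simp add: power2_eq_square algebra_simps)
  moreover have "(1 + (\<bar>u\<bar> + \<bar>w\<bar>))\<^sup>2 \<le> ((1 + \<bar>u\<bar>) * (1 + \<bar>w\<bar>))\<^sup>2"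
    by (intro power_mono) (auto simp: algebra_simps)
  ultimately show ?thesis using assms by linarith
qed

lemma pair_powr_le:
  fixes u w \<delta> t :: real
  assumes "0 \<le> \<delta>" "\<delta> \<le> 1" "0 \<le> t"
  shows "((u - w)\<^sup>2 + \<delta>) powr t \<le> ((1 + \<bar>u\<bar>) * (1 + \<bar>w\<bar>)) ^ (2 * nat \<lceil>t\<rceil>)"
proof -
  have 1: "1 \<le> (1 + \<bar>u\<bar>) * (1 + \<bar>w\<bar>)" by (simp add: algebra_simps)
  have "((u - w)\<^sup>2 + \<delta>) powr t \<le> (((1 + \<bar>u\<bar>) * (1 + \<bar>w\<bar>))\<^sup>2) powr t"
    using assms diff_sq_le[of \<delta> u w] by (intro powr_mono2) auto
  also have "\<dots> \<le> (((1 + \<bar>u\<bar>) * (1 + \<bar>w\<bar>))\<^sup>2) powr real (nat \<lceil>t\<rceil>)"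
    using 1 assms by (intro powr_mono) (auto simp: one_le_power)
  also have "\<dots> = ((1 + \<bar>u\<bar>) * (1 + \<bar>w\<bar>)) ^ (2 * nat \<lceil>t\<rceil>)"
  proof -
    have "0 < ((1 + \<bar>u\<bar>) * (1 + \<bar>w\<bar>))\<^sup>2" using 1 by (intro zero_less_power) linarith
    then show ?thesis by (simp only: powr_realpow power_mult)
  qed
  finally show ?thesis .
qed

lemma pair_meas:
  assumes "i \<in> I" "j \<in> I"
  shows "(\<lambda>x. ((x i - x j)\<^sup>2 + \<delta>) powr (t::real)) \<in> borel_measurable (Pi\<^sub>M I (\<lambda>_. lborel))"
  using assms by measurable

lemma vandermonde_meas: "vandermonde \<beta> \<delta> I \<in> borel_measurable (Pi\<^sub>M I (\<lambda>_. lborel))"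
  unfolding vandermonde_def[abs_def] by (intro borel_measurable_prod pair_meas) auto

lemma vandermonde_nonneg: "0 \<le> vandermonde \<beta> \<delta> I x"
  unfolding vandermonde_def by (intro prod_nonneg) auto

text \<open>The exponent is uniform in \<open>\<delta>\<close>, which provides the majorant for the limit \<open>\<delta> \<longlongrightarrow> 0\<close>.\<close>
lemma vandermonde_le:
  assumes "finite I" "0 < \<beta>"
  shows "\<exists>p. \<forall>\<delta> x. 0 \<le> \<delta> \<longrightarrow> \<delta> \<le> 1 \<longrightarrow> vandermonde \<beta> \<delta> I x \<le> growth I x ^ p"
proof -
  define N where "N = 2 * nat \<lceil>\<beta> / 4\<rceil>"
  have "vandermonde \<beta> \<delta> I x \<le> growth I x ^ (2 * N * card I * card I)" if d: "0 \<le> \<delta>" "\<delta> \<le> 1" for \<delta> x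
  proof -
    have B: "1 \<le> growth I x" by (rule growth_ge_1)
    have "vandermonde \<beta> \<delta> I x \<le> (\<Prod>i\<in>I. \<Prod>j\<in>I - {i}. (growth I x * growth I x) ^ N)"
      unfolding vandermonde_def
    proof (intro prod_mono conjI prod_nonneg ballI)
      fix i j assume ij: "i \<in> I" "j \<in> I - {i}"
      have "((x i - x j)\<^sup>2 + \<delta>) powr (\<beta> / 4) \<le> ((1 + \<bar>x i\<bar>) * (1 + \<bar>x j\<bar>)) ^ N"
        unfolding N_def using d assms by (intro pair_powr_le) auto
      also have "\<dots> \<le> (growth I x * growth I x) ^ N"
        using ij assms B by (intro power_mono mult_mono coord_le_growth) auto
      finally show "((x i - x j)\<^sup>2 + \<delta>) powr (\<beta> / 4) \<le> (growth I x * growth I x) ^ N" .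
    qed auto
    also have "\<dots> \<le> (\<Prod>i\<in>I. \<Prod>j\<in>I. (growth I x * growth I x) ^ N)"
      using assms B
      by (intro prod_mono conjI prod_mono2 prod_nonneg) (auto simp: one_le_power mult_ge1_I)
    also have "\<dots> = growth I x ^ (2 * N * card I * card I)"
      by (simp add: power_mult[symmetric] power2_eq_square[symmetric] mult_ac)
    finally show ?thesis .
  qed
  then show ?thesis by blast
qed

lemma poly_bounded_vandermonde:
  assumes "finite I" "0 < \<beta>" "0 \<le> \<delta>" "\<delta> \<le> 1" shows "poly_bounded I (vandermonde \<beta> \<delta> I)"
proof -
  obtain p where p: "vandermonde \<beta> \<delta> I x \<le> growth I x ^ p" for x
    using vandermonde_le[OF assms(1,2)] assms(3,4) by blast
  show ?thesis
  proof (rule poly_boundedI[of _ _ 1 p])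
    fix x
    have "\<bar>vandermonde \<beta> \<delta> I x\<bar> = vandermonde \<beta> \<delta> I x" by (rule abs_of_nonneg[OF vandermonde_nonneg])
    then show "\<bar>vandermonde \<beta> \<delta> I x\<bar> \<le> 1 * growth I x ^ p" using p[of x] by simp
  qed (simp_all add: vandermonde_meas)
qed

text \<open>Separates the dependence on one coordinate, along which the integration by parts is carried out.\<close>
lemma vandermonde_split:
  assumes "finite I" "i \<in> I" "0 \<le> \<delta>"
  shows "vandermonde \<beta> \<delta> I x = vandermonde \<beta> \<delta> (I - {i}) x * (\<Prod>j\<in>I - {i}. ((x i - x j)\<^sup>2 + \<delta>) powr (\<beta> / 2))"
proof -
  have "vandermonde \<beta> \<delta> I x = (\<Prod>j\<in>I - {i}. ((x i - x j)\<^sup>2 + \<delta>) powr (\<beta> / 4)) *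
      (\<Prod>k\<in>I - {i}. \<Prod>j\<in>I - {k}. ((x k - x j)\<^sup>2 + \<delta>) powr (\<beta> / 4))"
    unfolding vandermonde_def using assms by (subst prod.remove[of I i]) auto
  also have "(\<Prod>k\<in>I - {i}. \<Prod>j\<in>I - {k}. ((x k - x j)\<^sup>2 + \<delta>) powr (\<beta> / 4)) =
      (\<Prod>k\<in>I - {i}. ((x k - x i)\<^sup>2 + \<delta>) powr (\<beta> / 4) *
          (\<Prod>j\<in>I - {i} - {k}. ((x k - x j)\<^sup>2 + \<delta>) powr (\<beta> / 4)))"
  proof (intro prod.cong refl)
    fix k assume "k \<in> I - {i}"
    then have "I - {k} - {i} = I - {i} - {k}" "i \<in> I - {k}" using assms by auto
    then show "(\<Prod>j\<in>I - {k}. ((x k - x j)\<^sup>2 + \<delta>) powr (\<beta> / 4)) = ((x k - x i)\<^sup>2 + \<delta>) powr (\<beta> / 4) *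
          (\<Prod>j\<in>I - {i} - {k}. ((x k - x j)\<^sup>2 + \<delta>) powr (\<beta> / 4))"
      using assms by (subst prod.remove[of _ i]) auto
  qed
  also have "\<dots> = (\<Prod>k\<in>I - {i}. ((x i - x k)\<^sup>2 + \<delta>) powr (\<beta> / 4)) * vandermonde \<beta> \<delta> (I - {i}) x"
    unfolding prod.distrib vandermonde_def by (simp add: power2_commute)
  also have "(\<Prod>j\<in>I - {i}. ((x i - x j)\<^sup>2 + \<delta>) powr (\<beta> / 4)) *
     ((\<Prod>k\<in>I - {i}. ((x i - x k)\<^sup>2 + \<delta>) powr (\<beta> / 4)) * vandermonde \<beta> \<delta> (I - {i}) x) =
     vandermonde \<beta> \<delta> (I - {i}) x * (\<Prod>j\<in>I - {i}. (((x i - x j)\<^sup>2 + \<delta>) powr (\<beta> / 4)) * (((x i - x j)\<^sup>2 + \<delta>) powr (\<beta> / 4)))"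
    by (simp add: prod.distrib)
  finally show ?thesis by (simp add: powr_add[symmetric])
qed

context pearson_weight
begin

definition weight_product :: "real \<Rightarrow> nat set \<Rightarrow> (nat \<Rightarrow> real) \<Rightarrow> real" where
  "weight_product a I x = (\<Prod>i\<in>I. x i powr (a - 1) * v (x i))"

lemma weight_product_nonneg: "0 \<le> weight_product a I x"
  unfolding weight_product_def using v_nonneg by (intro prod_nonneg) auto

lemma weight_product_meas [measurable]: "weight_product a I \<in> borel_measurable (Pi\<^sub>M I (\<lambda>_. lborel))"
  unfolding weight_product_def[abs_def] by (intro borel_measurable_prod) measurable

lemma weight_product_growth_integrable:
  assumes "finite I" "0 < a"
  shows "integrable (Pi\<^sub>M I (\<lambda>_. lborel)) (\<lambda>x. growth I x ^ p * weight_product a I x)"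
proof -
  interpret product_sigma_finite "\<lambda>_::nat. lborel :: real measure"
    by standard
  have "integrable (Pi\<^sub>M I (\<lambda>_. lborel)) (\<lambda>x. \<Prod>i\<in>I. (1 + \<bar>x i\<bar>) ^ p * (x i powr (a - 1) * v (x i)))"
    by (rule product_integrable_prod[OF assms(1) v_moments[OF assms(2)]])
  then show ?thesis by (simp add: growth_def weight_product_def prod.distrib prod_power_distrib)
qed

lemma poly_bounded_integrable:
  assumes "finite I" "0 < a" "poly_bounded I g"
  shows "integrable (Pi\<^sub>M I (\<lambda>_. lborel)) (\<lambda>x. g x * weight_product a I x)"
proof -
  from assms(3) obtain C p where C: "0 \<le> C" "\<And>x. \<bar>g x\<bar> \<le> C * growth I x ^ p"
    and [measurable]: "g \<in> borel_measurable (Pi\<^sub>M I (\<lambda>_. lborel))"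
    unfolding poly_bounded_def by blast
  show ?thesis
  proof (rule Bochner_Integration.integrable_bound)
    show "integrable (Pi\<^sub>M I (\<lambda>_. lborel)) (\<lambda>x. C * (growth I x ^ p * weight_product a I x))"
      by (intro integrable_mult_right weight_product_growth_integrable assms)
    show "AE x in Pi\<^sub>M I (\<lambda>_. lborel). norm (g x * weight_product a I x) \<le> norm (C * (growth I x ^ p * weight_product a I x))"
    proof (rule AE_I2)
      fix x
      have "\<bar>g x\<bar> * weight_product a I x \<le> C * growth I x ^ p * weight_product a I x"
        by (intro mult_right_mono C weight_product_nonneg)
      also have "\<dots> \<le> \<bar>C * growth I x ^ p * weight_product a I x\<bar>" by simp
      finally show "norm (g x * weight_product a I x) \<le> norm (C * (growth I x ^ p * weight_product a I x))"
        using weight_product_nonneg[of a I x] by (simp add: abs_mult mult_ac)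
    qed
  qed measurable
qed

text \<open>The logarithmic derivative of the regularised product is bounded, with a bound that depends on \<open>\<delta>\<close>.\<close>
lemma regular_quotient_bound:
  fixes d \<delta> :: real assumes "0 < \<delta>" shows "\<bar>d / (d\<^sup>2 + \<delta>)\<bar> \<le> 1 + 1 / \<delta>"
proof -
  have p: "0 < d\<^sup>2 + \<delta>" using assms by (simp add: add_nonneg_pos)
  have "0 \<le> (\<bar>d\<bar> - 1 / 2)\<^sup>2" by simp
  then have "\<bar>d\<bar> \<le> d\<^sup>2 + 1" by (simp add: power2_diff power_divide)
  also have "\<dots> \<le> (1 + 1 / \<delta>) * (d\<^sup>2 + \<delta>)" using assms by (simp add: field_simps)
  finally show ?thesis using p by (simp add: abs_divide divide_le_eq)
qed

text \<open>Integration by parts in the coordinate \<open>x i\<close>, with the others fixed, applied to \<open>q\<close> times the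
regularised Vandermonde product; the sum over \<open>j\<close> is the logarithmic derivative of the latter.
Fubini's theorem then gives the identity for the full integral.\<close>
lemma aomoto_regularised:
  assumes I: "finite I" "i \<in> I" and a: "0 < a" and \<beta>: "0 < \<beta>" and \<delta>: "0 < \<delta>" "\<delta> \<le> 1"
    and q: "poly_bounded I q" "\<And>x y. q (x(i := y)) = q x"
  shows "(LINT x|Pi\<^sub>M I (\<lambda>_. lborel).
      ((a - (c * a + e0) * x i) * q x +
        (\<Sum>j\<in>I - {i}. \<beta> * (x i * (1 - c * x i) * q x * ((x i - x j) / ((x i - x j)\<^sup>2 + \<delta>)))))
      * vandermonde \<beta> \<delta> I x * weight_product a I x) = 0"
proof -
  interpret product_sigma_finite "\<lambda>_::nat. lborel :: real measure"
    by standard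
  define J where "J = I - {i}"
  have J: "finite J" "i \<notin> J" "I = insert i J" using I by (auto simp: J_def)
  define G where "G x = ((a - (c * a + e0) * x i) * q x +
        (\<Sum>j\<in>I - {i}. \<beta> * (x i * (1 - c * x i) * q x * ((x i - x j) / ((x i - x j)\<^sup>2 + \<delta>)))))
      * vandermonde \<beta> \<delta> I x" for x
  have "poly_bounded I G"
    unfolding G_def[abs_def] using I \<delta> \<beta>
    by (intro poly_bounded_mult poly_bounded_add poly_bounded_diff poly_bounded_const poly_bounded_sum
         poly_bounded_coord poly_bounded_vandermonde q(1) poly_bounded_bounded[OF _ regular_quotient_bound]) (auto simp del: abs_divide)
  then have int: "integrable (Pi\<^sub>M (insert i J) (\<lambda>_. lborel)) (\<lambda>x. G x * weight_product a I x)"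
    using poly_bounded_integrable[OF I(1) a] J(3) by simp
  have inner: "(LINT y|lborel. G (x(i := y)) * weight_product a I (x(i := y))) = 0" for x
  proof -
    define K where "K = q x * vandermonde \<beta> \<delta> J x * weight_product a J x"
    define pp where "pp = (\<lambda>y. \<Prod>j\<in>J. ((y - x j)\<^sup>2 + \<delta>) powr (\<beta> / 2))"
    define f where "f = (\<lambda>y. K * pp y)"
    define f' where "f' = (\<lambda>y. K * (pp y * (\<Sum>j\<in>J. \<beta> * ((y - x j) / ((y - x j)\<^sup>2 + \<delta>)))))"
    have pos: "0 < (y - x j)\<^sup>2 + \<delta>" for y j using \<delta> by (simp add: add_nonneg_pos)
    have der: "(f has_real_derivative f' y) (at y)" for y
    proof -
      have 1: "((\<lambda>y. ((y - x j)\<^sup>2 + \<delta>) powr (\<beta> / 2)) has_real_derivative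
          ((y - x j)\<^sup>2 + \<delta>) powr (\<beta> / 2) * (\<beta> * ((y - x j) / ((y - x j)\<^sup>2 + \<delta>)))) (at y)" for j
      proof -
        have "((\<lambda>y. ((y - x j)\<^sup>2 + \<delta>) powr (\<beta> / 2)) has_real_derivative
            \<beta> / 2 * ((y - x j)\<^sup>2 + \<delta>) powr (\<beta> / 2 - 1) * (2 * (y - x j))) (at y)"
          using pos[of y j] by (auto intro!: derivative_eq_intros)
        also have "((y - x j)\<^sup>2 + \<delta>) powr (\<beta> / 2 - 1) =
            ((y - x j)\<^sup>2 + \<delta>) powr (\<beta> / 2) / ((y - x j)\<^sup>2 + \<delta>)"
          using pos[of y j] by (simp add: powr_diff)
        also have "\<beta> / 2 * (((y - x j)\<^sup>2 + \<delta>) powr (\<beta> / 2) / ((y - x j)\<^sup>2 + \<delta>)) * (2 * (y - x j)) =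
            ((y - x j)\<^sup>2 + \<delta>) powr (\<beta> / 2) * (\<beta> * ((y - x j) / ((y - x j)\<^sup>2 + \<delta>)))"
        proof -
          have "\<beta> / 2 * (A / B) * (2 * t) = A * (\<beta> * (t / B))" for A B t :: real by simp
          then show ?thesis .
        qed
        finally show ?thesis .
      qed
      have "(pp has_real_derivative (pp y * (\<Sum>j\<in>J. \<beta> * ((y - x j) / ((y - x j)\<^sup>2 + \<delta>))))) (at y)"
        unfolding pp_def using J(1)
      proof (induction J rule: finite_induct)
        case (insert k J)
        from DERIV_mult[OF 1[of k] insert(3)] insert(1,2) show ?case
          by (simp add: algebra_simps)
      qed auto
      then show ?thesis unfolding f_def f'_def by (auto intro!: derivative_eq_intros)
    qed
    have cont: "continuous_on UNIV f'"
      unfolding f'_def pp_def using pos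
      by (intro continuous_intros) (auto simp: less_imp_neq[THEN not_sym])
    obtain N where N: "\<And>y. 0 \<le> pp y \<and> pp y \<le> growth J x ^ N * (1 + \<bar>y\<bar>) ^ (N * card J)"
    proof -
      define N where "N = 2 * nat \<lceil>\<beta> / 2\<rceil>"
      have "0 \<le> pp y \<and> pp y \<le> growth J x ^ N * (1 + \<bar>y\<bar>) ^ (N * card J)" for y
      proof
        show "0 \<le> pp y" unfolding pp_def by (intro prod_nonneg) auto
        have "pp y \<le> (\<Prod>j\<in>J. ((1 + \<bar>y\<bar>) * (1 + \<bar>x j\<bar>)) ^ N)"
          unfolding pp_def N_def using \<delta> \<beta> by (intro prod_mono conjI pair_powr_le) auto
        also have "\<dots> = growth J x ^ N * (1 + \<bar>y\<bar>) ^ (N * card J)"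
          by (simp add: power_mult_distrib prod.distrib prod_power_distrib growth_def power_mult)
        finally show "pp y \<le> growth J x ^ N * (1 + \<bar>y\<bar>) ^ (N * card J)" .
      qed
      then show ?thesis using that by blast
    qed
    define p where "p = N * card J"
    \<comment> \<open>one constant that serves for both \<open>f\<close> and its derivative\<close>
    define C where "C = \<bar>K\<bar> * growth J x ^ N * (1 + (\<Sum>j\<in>J. \<beta> * (1 + 1 / \<delta>)))"
    have s0: "0 \<le> (\<Sum>j\<in>J. \<beta> * (1 + 1 / \<delta>))" using \<delta> \<beta> by (intro sum_nonneg) auto
    have B: "0 \<le> growth J x ^ N" using growth_ge_1[of J x] by simp
    have bf: "\<bar>f y\<bar> \<le> C * (1 + \<bar>y\<bar>) ^ p" for y
    proof -
      have "\<bar>f y\<bar> = \<bar>K\<bar> * pp y" unfolding f_def using N[of y] by (simp add: abs_mult)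
      also have "\<dots> \<le> \<bar>K\<bar> * (growth J x ^ N * (1 + \<bar>y\<bar>) ^ p)"
        using N[of y] unfolding p_def by (intro mult_left_mono) auto
      also have "\<dots> = \<bar>K\<bar> * growth J x ^ N * 1 * (1 + \<bar>y\<bar>) ^ p" by simp
      also have "\<dots> \<le> C * (1 + \<bar>y\<bar>) ^ p"
        unfolding C_def using s0 B by (intro mult_right_mono mult_left_mono) auto
      finally show ?thesis .
    qed
    have bf': "\<bar>f' y\<bar> \<le> C * (1 + \<bar>y\<bar>) ^ p" for y
    proof -
      have s: "\<bar>\<Sum>j\<in>J. \<beta> * ((y - x j) / ((y - x j)\<^sup>2 + \<delta>))\<bar> \<le> (\<Sum>j\<in>J. \<beta> * (1 + 1 / \<delta>))"
      proof (rule order_trans[OF sum_abs], rule sum_mono)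
        fix j 
        show "\<bar>\<beta> * ((y - x j) / ((y - x j)\<^sup>2 + \<delta>))\<bar> \<le> \<beta> * (1 + 1 / \<delta>)"
          using regular_quotient_bound[OF \<delta>(1), of "y - x j"] \<beta> by (simp only: abs_mult) (intro mult_mono, auto)
      qed
      have "\<bar>f' y\<bar> = \<bar>K\<bar> * (pp y * \<bar>\<Sum>j\<in>J. \<beta> * ((y - x j) / ((y - x j)\<^sup>2 + \<delta>))\<bar>)"
        unfolding f'_def abs_mult using N[of y] by simp
      also have "\<dots> \<le> \<bar>K\<bar> * ((growth J x ^ N * (1 + \<bar>y\<bar>) ^ p) * (1 + (\<Sum>j\<in>J. \<beta> * (1 + 1 / \<delta>))))"
        using N[of y] s s0 B unfolding p_def by (intro mult_left_mono mult_mono) auto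
      finally show ?thesis unfolding C_def by (simp only: mult_ac)
    qed
    have "G (x(i := y)) * weight_product a I (x(i := y)) =
       ((a - (c * a + e0) * y) * f y + y * (1 - c * y) * f' y) * (y powr (a - 1) * v y)" for y
    proof -
      have v1: "vandermonde \<beta> \<delta> I (x(i := y)) = vandermonde \<beta> \<delta> J x * pp y"
      proof -
        have "vandermonde \<beta> \<delta> J (x(i := y)) = vandermonde \<beta> \<delta> J x"
          unfolding vandermonde_def using J(2) by (intro prod.cong refl) auto
        moreover have "(\<Prod>j\<in>J. (((x(i := y)) i - (x(i := y)) j)\<^sup>2 + \<delta>) powr (\<beta> / 2)) = pp y"
          unfolding pp_def using J(2) by (intro prod.cong refl) auto
        ultimately show ?thesis using vandermonde_split[OF I, of \<delta> \<beta> "x(i:=y)"] \<delta>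
          unfolding J_def[symmetric] by simp
      qed
      have w1: "weight_product a I (x(i := y)) = y powr (a - 1) * v y * weight_product a J x"
      proof -
        have "weight_product a J (x(i := y)) = weight_product a J x"
          unfolding weight_product_def using J(2) by (intro prod.cong refl) auto
        then show ?thesis unfolding weight_product_def J(3) using J by simp
      qed
      have s1: "(\<Sum>j\<in>I - {i}. \<beta> * ((x(i := y)) i * (1 - c * (x(i := y)) i) * q (x(i := y)) * (((x(i := y)) i - (x(i := y)) j) / (((x(i := y)) i - (x(i := y)) j)\<^sup>2 + \<delta>))))
        = y * (1 - c * y) * q x * (\<Sum>j\<in>J. \<beta> * ((y - x j) / ((y - x j)\<^sup>2 + \<delta>)))"
        unfolding J_def[symmetric] q(2) sum_distrib_left
        using J(2) by (intro sum.cong refl) (auto simp: mult_ac)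
      show ?thesis
      proof -
        have "(T1 * Q + T2 * Q * S) * (V * P) * (Y * W) =
            (T1 * (Q * V * W * P) + T2 * (Q * V * W * (P * S))) * Y" for T1 T2 Q S V P Y W :: real
          by (simp add: algebra_simps)
        then show ?thesis
          unfolding G_def s1 unfolding v1 w1 f_def f'_def K_def q(2) fun_upd_same .
      qed
    qed
    then show ?thesis using integral_by_parts[OF a der cont bf bf'] by simp
  qed
  have "(LINT x|Pi\<^sub>M I (\<lambda>_. lborel). G x * weight_product a I x) = 0"
    using product_integral_insert[OF J(1,2) int] inner J(3) by simp
  then show ?thesis by (simp add: G_def)
qed

end

section \<open>Aomoto's recursion\<close>

text \<open>The restriction to \<open>I\<close> keeps the result in the space of the product measure, whose points are
\<open>undefined\<close> outside \<open>I\<close>.\<close>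
definition swap_coords :: "nat set \<Rightarrow> nat \<Rightarrow> nat \<Rightarrow> (nat \<Rightarrow> real) \<Rightarrow> nat \<Rightarrow> real" where
  "swap_coords I i j x = (\<lambda>k\<in>I. x (Transposition.transpose i j k))"

lemma transpose_bij: "i \<in> I \<Longrightarrow> j \<in> I \<Longrightarrow> bij_betw (Transposition.transpose i j) I I"
  by (intro bij_betw_byWitness[where f' = "Transposition.transpose i j"])
     (auto simp: Transposition.transpose_def)

lemma swap_coords_meas:
  assumes "i \<in> I" "j \<in> I"
  shows "swap_coords I i j \<in> Pi\<^sub>M I (\<lambda>_. lborel) \<rightarrow>\<^sub>M Pi\<^sub>M I (\<lambda>_. lborel)"
  unfolding swap_coords_def[abs_def]
proof (rule measurable_restrict)
  fix k assume "k \<in> I"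
  then have "Transposition.transpose i j k \<in> I" using assms by (auto simp: Transposition.transpose_def)
  then show "(\<lambda>x. x (Transposition.transpose i j k)) \<in> Pi\<^sub>M I (\<lambda>_. lborel) \<rightarrow>\<^sub>M lborel"
    by measurable
qed

lemma distr_swap_coords:
  assumes "finite I" "i \<in> I" "j \<in> I"
  shows "distr (Pi\<^sub>M I (\<lambda>_. lborel)) (Pi\<^sub>M I (\<lambda>_. lborel)) (swap_coords I i j) = Pi\<^sub>M I (\<lambda>_. lborel :: real measure)"
proof -
  interpret product_sigma_finite "\<lambda>_::nat. lborel :: real measure"
    by standard
  let ?p = "Transposition.transpose i j"
  note bij = transpose_bij[OF assms(2,3)]
  have pI: "?p k \<in> I \<longleftrightarrow> k \<in> I" for k using assms by (auto simp: Transposition.transpose_def)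
  show ?thesis
  proof (rule PiM_eqI)
    fix A :: "nat \<Rightarrow> real set" assume A: "\<And>k. k \<in> I \<Longrightarrow> A k \<in> sets lborel"
    have "emeasure (distr (Pi\<^sub>M I (\<lambda>_. lborel)) (Pi\<^sub>M I (\<lambda>_. lborel)) (swap_coords I i j)) (Pi\<^sub>E I A) =
        emeasure (Pi\<^sub>M I (\<lambda>_. lborel)) (swap_coords I i j -` Pi\<^sub>E I A \<inter> space (Pi\<^sub>M I (\<lambda>_. lborel)))"
      using A assms by (intro emeasure_distr swap_coords_meas sets_PiM_I_finite) auto
    also have "swap_coords I i j -` Pi\<^sub>E I A \<inter> space (Pi\<^sub>M I (\<lambda>_. lborel)) = Pi\<^sub>E I (\<lambda>k. A (?p k))"
    proof -
      have "(\<forall>k\<in>I. x (?p k) \<in> A k) \<longleftrightarrow> (\<forall>k\<in>I. x k \<in> A (?p k))" for x :: "nat \<Rightarrow> real"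
        by (metis pI transpose_involutory)
      then show ?thesis by (auto simp: space_PiM swap_coords_def PiE_iff)
    qed
    also have "emeasure (Pi\<^sub>M I (\<lambda>_. lborel)) \<dots> = (\<Prod>k\<in>I. emeasure lborel (A (?p k)))"
      using A assms(1) pI by (intro emeasure_PiM) auto
    also have "\<dots> = (\<Prod>k\<in>I. emeasure lborel (A k))"
      by (rule prod.reindex_bij_betw[OF bij])
    finally show "emeasure (distr (Pi\<^sub>M I (\<lambda>_. lborel)) (Pi\<^sub>M I (\<lambda>_. lborel)) (swap_coords I i j)) (Pi\<^sub>E I A) =
        (\<Prod>k\<in>I. emeasure lborel (A k))" .
  qed (use assms in auto)
qed

lemma vandermonde_swap_coords:
  assumes "i \<in> I" "j \<in> I" shows "vandermonde \<beta> \<delta> I (swap_coords I i j x) = vandermonde \<beta> \<delta> I x"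
proof -
  let ?p = "Transposition.transpose i j"
  note bij = transpose_bij[OF assms]
  have "vandermonde \<beta> \<delta> I (swap_coords I i j x) =
      (\<Prod>k\<in>I. \<Prod>l\<in>I - {k}. ((x (?p k) - x (?p l))\<^sup>2 + \<delta>) powr (\<beta> / 4))"
    unfolding vandermonde_def swap_coords_def by (intro prod.cong refl) auto
  also have "\<dots> = (\<Prod>k\<in>I. \<Prod>l\<in>I - {?p k}. ((x (?p k) - x l)\<^sup>2 + \<delta>) powr (\<beta> / 4))"
  proof (rule prod.cong[OF refl])
    fix k assume k: "k \<in> I"
    have "bij_betw ?p (I - {k}) (I - {?p k})"
      using bij_betw_DiffI[OF bij, of "{k}" "{?p k}"] k bij by (auto simp: bij_betw_def)
    from prod.reindex_bij_betw[OF this, of "\<lambda>l. ((x (?p k) - x l)\<^sup>2 + \<delta>) powr (\<beta> / 4)"]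
    show "(\<Prod>l\<in>I - {k}. ((x (?p k) - x (?p l))\<^sup>2 + \<delta>) powr (\<beta> / 4)) =
        (\<Prod>l\<in>I - {?p k}. ((x (?p k) - x l)\<^sup>2 + \<delta>) powr (\<beta> / 4))" .
  qed
  also have "\<dots> = vandermonde \<beta> \<delta> I x"
    unfolding vandermonde_def
    by (rule prod.reindex_bij_betw[OF bij, of "\<lambda>k. \<Prod>l\<in>I - {k}. ((x k - x l)\<^sup>2 + \<delta>) powr (\<beta> / 4)"])
  finally show ?thesis .
qed

lemma vandermonde_tendsto:
  assumes "finite I" "0 < \<beta>"
  shows "(\<lambda>n. vandermonde \<beta> (inverse (real (Suc n))) I x) \<longlonglongrightarrow> vandermonde \<beta> 0 I x"
  unfolding vandermonde_def using assms(2)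
  by (intro tendsto_prod tendsto_powr' tendsto_intros LIMSEQ_inverse_real_of_nat)
     (auto intro!: always_eventually)

text \<open>On the diagonal \<open>x i = x j\<close> the quotient is 0 and not near 1, but there the limit vanishes as well, so
convergence holds everywhere and no null set has to be removed.\<close>
lemma vandermonde_frac_tendsto:
  assumes I: "finite I" and \<beta>: "0 < \<beta>" and ij: "i \<in> I" "j \<in> I" "i \<noteq> j"
  shows "(\<lambda>n. (x i - x j)\<^sup>2 / ((x i - x j)\<^sup>2 + inverse (real (Suc n))) * vandermonde \<beta> (inverse (real (Suc n))) I x)
           \<longlonglongrightarrow> vandermonde \<beta> 0 I x"
proof (cases "x i = x j")
  case True
  have "(\<Prod>l\<in>I - {i}. ((x i - x l)\<^sup>2 + 0) powr (\<beta> / 4)) = 0"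
    using True I ij by (intro prod_zero) (auto intro!: bexI[of _ j])
  then have "vandermonde \<beta> 0 I x = 0"
    unfolding vandermonde_def using I ij(1) by (intro prod_zero) blast+
  then show ?thesis using True by simp
next
  case False
  then have "(\<lambda>n. (x i - x j)\<^sup>2 / ((x i - x j)\<^sup>2 + inverse (real (Suc n))) * vandermonde \<beta> (inverse (real (Suc n))) I x)
           \<longlonglongrightarrow> (x i - x j)\<^sup>2 / ((x i - x j)\<^sup>2 + 0) * vandermonde \<beta> 0 I x"
    by (intro tendsto_intros vandermonde_tendsto I \<beta> LIMSEQ_inverse_real_of_nat) auto
  then show ?thesis using False by simp
qed

context pearson_weight
begin

definition bracket :: "real \<Rightarrow> real \<Rightarrow> real \<Rightarrow> nat set \<Rightarrow> ((nat \<Rightarrow> real) \<Rightarrow> real) \<Rightarrow> real" where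
  "bracket a \<beta> \<delta> I g = (LINT x|Pi\<^sub>M I (\<lambda>_. lborel). g x * vandermonde \<beta> \<delta> I x * weight_product a I x)"

lemma weight_product_swap_coords:
  assumes "i \<in> I" "j \<in> I" shows "weight_product a I (swap_coords I i j x) = weight_product a I x"
proof -
  have "weight_product a I (swap_coords I i j x) = (\<Prod>k\<in>I. x (Transposition.transpose i j k) powr (a - 1) * v (x (Transposition.transpose i j k)))"
    unfolding weight_product_def swap_coords_def by (intro prod.cong refl) auto
  also have "\<dots> = weight_product a I x"
    unfolding weight_product_def by (rule prod.reindex_bij_betw[OF transpose_bij[OF assms], of "\<lambda>k. x k powr (a - 1) * v (x k)"])
  finally show ?thesis .
qed

lemma bracket_swap_coords:
  assumes "finite I" "i \<in> I" "j \<in> I" and [measurable]: "g \<in> borel_measurable (Pi\<^sub>M I (\<lambda>_. lborel))"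
  shows "bracket a \<beta> \<delta> I (\<lambda>x. g (swap_coords I i j x)) = bracket a \<beta> \<delta> I g"
proof -
  note [measurable] = swap_coords_meas[OF assms(2,3)] vandermonde_meas[of \<beta> \<delta> I]
  have "bracket a \<beta> \<delta> I g = (LINT x|distr (Pi\<^sub>M I (\<lambda>_. lborel)) (Pi\<^sub>M I (\<lambda>_. lborel)) (swap_coords I i j).
     g x * vandermonde \<beta> \<delta> I x * weight_product a I x)"
    unfolding bracket_def distr_swap_coords[OF assms(1-3)] ..
  also have "\<dots> = (LINT x|Pi\<^sub>M I (\<lambda>_. lborel). g (swap_coords I i j x) * vandermonde \<beta> \<delta> I (swap_coords I i j x) * weight_product a I (swap_coords I i j x))"
    by (rule integral_distr) measurable
  also have "\<dots> = bracket a \<beta> \<delta> I (\<lambda>x. g (swap_coords I i j x))"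
    unfolding bracket_def vandermonde_swap_coords[OF assms(2,3)] weight_product_swap_coords[OF assms(2,3)] ..
  finally show ?thesis by simp
qed

context
  fixes a \<beta> :: real and I :: "nat set"
  assumes a: "0 < a" and \<beta>: "0 < \<beta>" and I: "finite I"
begin

lemma bracket_integrable:
  assumes "poly_bounded I g" "0 \<le> \<delta>" "\<delta> \<le> 1"
  shows "integrable (Pi\<^sub>M I (\<lambda>_. lborel)) (\<lambda>x. g x * vandermonde \<beta> \<delta> I x * weight_product a I x)"
  by (intro poly_bounded_integrable[OF I a] poly_bounded_mult poly_bounded_vandermonde assms I \<beta>)

lemma bracket_add:
  assumes "poly_bounded I g" "poly_bounded I h" "0 \<le> \<delta>" "\<delta> \<le> 1"
  shows "bracket a \<beta> \<delta> I (\<lambda>x. g x + h x) = bracket a \<beta> \<delta> I g + bracket a \<beta> \<delta> I h"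
  unfolding bracket_def distrib_right using bracket_integrable[OF assms(1,3,4)] bracket_integrable[OF assms(2,3,4)]
  by (rule Bochner_Integration.integral_add)

lemma bracket_cmult: "bracket a \<beta> \<delta> I (\<lambda>x. k * g x) = k * bracket a \<beta> \<delta> I g"
  unfolding bracket_def by (simp add: mult.assoc)

lemma bracket_sum:
  assumes "\<And>j. j \<in> J \<Longrightarrow> poly_bounded I (g j)" "0 \<le> \<delta>" "\<delta> \<le> 1"
  shows "bracket a \<beta> \<delta> I (\<lambda>x. \<Sum>j\<in>J. g j x) = (\<Sum>j\<in>J. bracket a \<beta> \<delta> I (g j))"
  using assms(1)
proof (induction J rule: infinite_finite_induct)
  case (insert k J)
  then show ?case using bracket_add[of "g k" "\<lambda>x. \<Sum>j\<in>J. g j x" \<delta>] assms(2,3)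
    by (simp add: poly_bounded_sum)
qed (simp_all add: bracket_def)

lemma bracket_tendsto:
  assumes g: "poly_bounded I g" 
    and r: "\<And>n. r n \<in> borel_measurable (Pi\<^sub>M I (\<lambda>_. lborel))" "\<And>n x. \<bar>r n x\<bar> \<le> 1"
    and lim: "\<And>x. (\<lambda>n. r n x * vandermonde \<beta> (inverse (real (Suc n))) I x) \<longlonglongrightarrow> vandermonde \<beta> 0 I x"
  shows "(\<lambda>n. bracket a \<beta> (inverse (real (Suc n))) I (\<lambda>x. g x * r n x)) \<longlonglongrightarrow> bracket a \<beta> 0 I g"
proof -
  have [measurable]: "g \<in> borel_measurable (Pi\<^sub>M I (\<lambda>_. lborel))" using g by (simp add: poly_bounded_def)
  note [measurable] = r(1) vandermonde_meas
  obtain p where p: "\<And>\<delta> x. 0 \<le> \<delta> \<Longrightarrow> \<delta> \<le> 1 \<Longrightarrow> vandermonde \<beta> \<delta> I x \<le> growth I x ^ p"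
    using vandermonde_le[OF I \<beta>] by blast
  obtain C q where C: "0 \<le> C" "\<And>x. \<bar>g x\<bar> \<le> C * growth I x ^ q" using g unfolding poly_bounded_def by blast
  show ?thesis unfolding bracket_def
  proof (rule integral_dominated_convergence)
    show "integrable (Pi\<^sub>M I (\<lambda>_. lborel)) (\<lambda>x. C * (growth I x ^ (q + p) * weight_product a I x))"
      by (intro integrable_mult_right weight_product_growth_integrable a I)
    show "AE x in Pi\<^sub>M I (\<lambda>_. lborel). (\<lambda>n. g x * r n x * vandermonde \<beta> (inverse (real (Suc n))) I x * weight_product a I x)
        \<longlonglongrightarrow> g x * vandermonde \<beta> 0 I x * weight_product a I x"
    proof (rule AE_I2)
      fix x
      show "(\<lambda>n. g x * r n x * vandermonde \<beta> (inverse (real (Suc n))) I x * weight_product a I x)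
        \<longlonglongrightarrow> g x * vandermonde \<beta> 0 I x * weight_product a I x"
        using tendsto_mult[OF tendsto_mult[OF tendsto_const lim[of x]] tendsto_const, of "g x" "weight_product a I x"]
        by (simp only: mult_ac)
    qed
    fix n
    show "AE x in Pi\<^sub>M I (\<lambda>_. lborel). norm (g x * r n x * vandermonde \<beta> (inverse (real (Suc n))) I x * weight_product a I x)
        \<le> C * (growth I x ^ (q + p) * weight_product a I x)"
    proof (rule AE_I2)
      fix x
      have "\<bar>g x\<bar> * \<bar>r n x\<bar> * vandermonde \<beta> (inverse (real (Suc n))) I x * weight_product a I x \<le>
          (C * growth I x ^ q) * 1 * growth I x ^ p * weight_product a I x"
        using C r(2) p[of "inverse (real (Suc n))" x] vandermonde_nonneg weight_product_nonneg growth_ge_1[of I x]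
        by (intro mult_right_mono mult_mono) (auto simp: field_simps)
      also have "\<dots> = C * (growth I x ^ (q + p) * weight_product a I x)" by (simp add: power_add)
      finally show "norm (g x * r n x * vandermonde \<beta> (inverse (real (Suc n))) I x * weight_product a I x)
        \<le> C * (growth I x ^ (q + p) * weight_product a I x)"
        using vandermonde_nonneg[of \<beta> "inverse (real (Suc n))" I x] weight_product_nonneg[of a I x] by (simp add: abs_mult)
    qed
  qed measurable
qed

text \<open>Averaging an integrand with its image under the exchange of \<open>x i\<close> and \<open>x j\<close> turns the factor
\<open>(x i - x j) / ((x i - x j)\<^sup>2 + \<delta>)\<close>, which blows up as \<open>\<delta> \<longlongrightarrow> 0\<close>, into one with values in \<open>[0, 1]\<close>: the difference
\<open>g x - g (swap_coords I i j x)\<close> supplies another factor \<open>x i - x j\<close>.\<close>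
lemma bracket_sym_pair:
  assumes ij: "i \<in> I" "j \<in> I" "i \<noteq> j" and \<delta>: "0 < \<delta>" "\<delta> \<le> 1"
    and g: "poly_bounded I g" and h: "\<And>x. g x - g (swap_coords I i j x) = h x * (x i - x j)"
    and hm: "poly_bounded I h"
  shows "bracket a \<beta> \<delta> I (\<lambda>x. g x * ((x i - x j) / ((x i - x j)\<^sup>2 + \<delta>))) =
     bracket a \<beta> \<delta> I (\<lambda>x. h x * ((x i - x j)\<^sup>2 / ((x i - x j)\<^sup>2 + \<delta>))) / 2"
proof -
  define G where "G = (\<lambda>x. g x * ((x i - x j) / ((x i - x j)\<^sup>2 + \<delta>)))"
  have pb: "poly_bounded I (\<lambda>x. (x i - x j) / ((x i - x j)\<^sup>2 + \<delta>))"
  proof (rule poly_bounded_bounded)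
    show "(\<lambda>x. (x i - x j) / ((x i - x j)\<^sup>2 + \<delta>)) \<in> borel_measurable (Pi\<^sub>M I (\<lambda>_. lborel))"
      using ij by measurable
  qed (rule regular_quotient_bound[OF \<delta>(1)])
  have G: "poly_bounded I G" unfolding G_def by (intro poly_bounded_mult g pb)
  define H where "H = (\<lambda>x. h x * ((x i - x j)\<^sup>2 / ((x i - x j)\<^sup>2 + \<delta>)))"
  have H: "poly_bounded I H"
  proof -
    have "H = (\<lambda>x. h x * ((x i - x j) * ((x i - x j) / ((x i - x j)\<^sup>2 + \<delta>))))"
      unfolding H_def by (simp add: power2_eq_square)
    then show ?thesis using ij I by (simp only:) (intro poly_bounded_mult hm pb poly_bounded_diff poly_bounded_coord)
  qed
  have "G (swap_coords I i j x) = H x - G x" for x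
  proof -
    have "(swap_coords I i j x) i = x j" "(swap_coords I i j x) j = x i" using ij by (auto simp: swap_coords_def)
    then have "G (swap_coords I i j x) = g (swap_coords I i j x) * ((x j - x i) / ((x i - x j)\<^sup>2 + \<delta>))"
      unfolding G_def by (simp add: power2_commute)
    also have "g (swap_coords I i j x) = g x - h x * (x i - x j)" using h[of x] by simp
    also have "(g x - h x * (x i - x j)) * ((x j - x i) / ((x i - x j)\<^sup>2 + \<delta>)) = H x - G x"
    proof -
      have "(u - w * t) * (- t / D) = w * (t\<^sup>2 / D) - u * (t / D)" for u w t D :: real
        by (simp add: algebra_simps power2_eq_square diff_divide_distrib)
      from this[of "g x" "h x" "x i - x j"] show ?thesis by (simp only: G_def H_def minus_diff_eq)
    qed
    finally show ?thesis .
  qed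
  then have "bracket a \<beta> \<delta> I (\<lambda>x. H x + (-1) * G x) = bracket a \<beta> \<delta> I G"
    using bracket_swap_coords[OF I ij(1,2), of G a \<beta> \<delta>] G by (simp add: poly_bounded_def)
  then have "bracket a \<beta> \<delta> I H + (-1) * bracket a \<beta> \<delta> I G = bracket a \<beta> \<delta> I G"
    using bracket_add[OF H poly_bounded_mult[OF poly_bounded_const[of I "-1"] G], of \<delta>] bracket_cmult[of \<delta> "-1" G] \<delta> by simp
  then show ?thesis by (simp add: G_def H_def)
qed

text \<open>Aomoto's argument: take \<open>q\<close> to be the product of the coordinates in \<open>K - {i}\<close> in the regularised
identity, symmetrise each term \<open>j\<close>, and let \<open>\<delta> \<longlongrightarrow> 0\<close>. The shape of the symmetrised term depends only on
whether \<open>j \<in> K\<close>, and by symmetry a product over \<open>K - {i}\<close> times \<open>x j\<close> with \<open>j \<notin> K\<close> has the same integral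
as the product over \<open>K\<close>.\<close>
lemma aomoto_recursion:
  assumes K: "K \<subseteq> I" "i \<in> K"
  shows "(a + \<beta> / 2 * (real (card I) - real (card K))) * bracket a \<beta> 0 I (\<lambda>x. \<Prod>l\<in>K - {i}. x l) =
    (c * a + e0 + c * \<beta> * ((real (card K) - 1) / 2 + (real (card I) - real (card K)))) * bracket a \<beta> 0 I (\<lambda>x. \<Prod>l\<in>K. x l)"
proof -
  let ?d = "\<lambda>n. inverse (real (Suc n))"
  have d: "0 < ?d n" "?d n \<le> 1" "0 \<le> ?d n" for n by (auto simp: field_simps)
  define X' where "X' = (\<lambda>x::nat\<Rightarrow>real. \<Prod>l\<in>K - {i}. x l)"
  define X where "X = (\<lambda>x::nat\<Rightarrow>real. \<Prod>l\<in>K. x l)"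
  have finK: "finite K" using K I by (auto intro: finite_subset)
  have iI: "i \<in> I" using K by auto
  have X'X: "X x = x i * X' x" for x unfolding X_def X'_def using finK K by (subst prod.remove[of K i]) auto
  have pX': "poly_bounded I X'" unfolding X'_def using K I by (intro poly_bounded_prod poly_bounded_coord) auto
  have pX: "poly_bounded I X" unfolding X_def using K I by (intro poly_bounded_prod poly_bounded_coord) auto
  have pi: "poly_bounded I (\<lambda>x. x i)" using iI I by (rule poly_bounded_coord[rotated])
  define fr where "fr = (\<lambda>n j (x::nat\<Rightarrow>real). (x i - x j)\<^sup>2 / ((x i - x j)\<^sup>2 + ?d n))"
  \<comment> \<open>what remains of the \<open>j\<close>-th term after division of the antisymmetric part by \<open>x i - x j\<close>\<close>
  define h where "h = (\<lambda>j (x::nat\<Rightarrow>real). if j \<in> K then - c * X x else X' x - c * X x - c * (x j * X' x))"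
  define A where "A = (\<lambda>x::nat\<Rightarrow>real. (a - (c * a + e0) * x i) * X' x)"
  have pA: "poly_bounded I A" unfolding A_def
    by (intro poly_bounded_mult poly_bounded_diff poly_bounded_const pi pX')
  have ph: "poly_bounded I (h j)" if "j \<in> I" for j
    unfolding h_def using that I by (cases "j \<in> K")
      (auto intro!: poly_bounded_mult poly_bounded_diff poly_bounded_const poly_bounded_coord pX pX'
            poly_bounded_mult[OF poly_bounded_const[of I "-c"] pX, simplified])
  define g where "g = (\<lambda>x::nat\<Rightarrow>real. x i * (1 - c * x i) * X' x)"
  have pg: "poly_bounded I g" unfolding g_def
    by (intro poly_bounded_mult poly_bounded_diff poly_bounded_const pi pX')
  have gh: "g x - g (swap_coords I i j x) = h j x * (x i - x j)" if j: "j \<in> I - {i}" for j x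
  proof -
    have sw: "(swap_coords I i j x) i = x j" "(swap_coords I i j x) j = x i" using j iI by (auto simp: swap_coords_def)
    have sw': "(swap_coords I i j x) l = x l" if "l \<in> I - {i, j}" for l
      using that by (auto simp: swap_coords_def transpose_apply_other)
    show ?thesis
    proof (cases "j \<in> K")
      case True
      define Y where "Y = (\<Prod>l\<in>K - {i} - {j}. x l)"
      have 1: "X' x = x j * Y" unfolding X'_def Y_def using finK True j by (subst prod.remove[of _ j]) auto
      have "X' (swap_coords I i j x) = x i * (\<Prod>l\<in>K - {i} - {j}. swap_coords I i j x l)"
        unfolding X'_def using finK True j by (subst prod.remove[of _ j]) (auto simp: sw)
      also have "(\<Prod>l\<in>K - {i} - {j}. swap_coords I i j x l) = Y"
        unfolding Y_def using K by (intro prod.cong refl sw') auto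
      finally have 2: "X' (swap_coords I i j x) = x i * Y" .
      show ?thesis using True unfolding g_def h_def sw 2 X'X 1 by (simp add: algebra_simps)
    next
      case False
      have "X' (swap_coords I i j x) = X' x"
        unfolding X'_def using K False by (intro prod.cong refl sw') auto
      then show ?thesis using False unfolding g_def h_def sw X'X by (simp add: algebra_simps)
    qed
  qed
  have eq: "bracket a \<beta> (?d n) I A + (\<Sum>j\<in>I - {i}. \<beta> / 2 * bracket a \<beta> (?d n) I (\<lambda>x. h j x * fr n j x)) = 0" for n
  proof -
    define q where "q = (\<lambda>j x. \<beta> * (g x * ((x i - x j) / ((x i - x j)\<^sup>2 + ?d n))))"
    have pq: "poly_bounded I (q j)" if "j \<in> I - {i}" for j
    proof -
      have j: "j \<in> I" using that by simp
      have "poly_bounded I (\<lambda>x. (x i - x j) / ((x i - x j)\<^sup>2 + ?d n))"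
      proof (rule poly_bounded_bounded)
        show "(\<lambda>x. (x i - x j) / ((x i - x j)\<^sup>2 + ?d n)) \<in> borel_measurable (Pi\<^sub>M I (\<lambda>_. lborel))"
          using iI j by measurable
      qed (rule regular_quotient_bound[OF d(1)])
      then show ?thesis unfolding q_def by (intro poly_bounded_mult poly_bounded_const pg)
    qed
    have "(X' (x(i := y))) = X' x" for x y
      unfolding X'_def by (intro prod.cong refl) auto
    from aomoto_regularised[OF I iI a \<beta> d(1,2)[of n] pX' this]
    have "bracket a \<beta> (?d n) I (\<lambda>x. A x + (\<Sum>j\<in>I - {i}. q j x)) = 0"
      unfolding bracket_def A_def q_def g_def .
    then have "bracket a \<beta> (?d n) I A + (\<Sum>j\<in>I - {i}. bracket a \<beta> (?d n) I (q j)) = 0"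
      using bracket_add[OF pA poly_bounded_sum[of "I - {i}" I q, OF pq] d(3,2)] bracket_sum[of "I - {i}" q, OF pq d(3,2)]
      by simp
    moreover
    have "bracket a \<beta> (?d n) I (q j) = \<beta> / 2 * bracket a \<beta> (?d n) I (\<lambda>x. h j x * fr n j x)"
      if j: "j \<in> I - {i}" for j
      unfolding q_def bracket_cmult fr_def
      using bracket_sym_pair[OF iI _ _ d(1,2) pg gh[OF j] ph] j by auto
    then have "(\<Sum>j\<in>I - {i}. bracket a \<beta> (?d n) I (q j)) =
        (\<Sum>j\<in>I - {i}. \<beta> / 2 * bracket a \<beta> (?d n) I (\<lambda>x. h j x * fr n j x))"
      by (rule sum.cong[OF refl])
    ultimately show ?thesis by (simp only:)
  qed
  have limA: "(\<lambda>n. bracket a \<beta> (?d n) I A) \<longlonglongrightarrow> bracket a \<beta> 0 I A"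
    using bracket_tendsto[OF pA, of "\<lambda>_ _. 1"] vandermonde_tendsto[OF I \<beta>] by simp
  have limh: "(\<lambda>n. bracket a \<beta> (?d n) I (\<lambda>x. h j x * fr n j x)) \<longlonglongrightarrow> bracket a \<beta> 0 I (h j)" if j: "j \<in> I - {i}" for j
  proof (rule bracket_tendsto)
    show "poly_bounded I (h j)" using ph j by blast
    have jI: "j \<in> I" using j by simp
    show "fr n j \<in> borel_measurable (Pi\<^sub>M I (\<lambda>_. lborel))" for n
      unfolding fr_def using iI jI by measurable
    show "\<bar>fr n j x\<bar> \<le> 1" for n x
    proof -
      have p: "0 < (x i - x j)\<^sup>2 + ?d n" by (rule add_nonneg_pos[OF zero_le_power2 d(1)])
      then have "0 \<le> fr n j x" "fr n j x \<le> 1"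
        unfolding fr_def divide_le_eq_1_pos[OF p] using d(1)[of n] by (simp_all add: less_imp_le)
      then show ?thesis by simp
    qed
    show "(\<lambda>n. fr n j x * vandermonde \<beta> (?d n) I x) \<longlonglongrightarrow> vandermonde \<beta> 0 I x" for x
      unfolding fr_def using j iI by (intro vandermonde_frac_tendsto I \<beta>) auto
  qed
  have "bracket a \<beta> 0 I A + (\<Sum>j\<in>I - {i}. \<beta> / 2 * bracket a \<beta> 0 I (h j)) = 0"
  proof (rule LIMSEQ_unique)
    show "(\<lambda>n. bracket a \<beta> (?d n) I A + (\<Sum>j\<in>I - {i}. \<beta> / 2 * bracket a \<beta> (?d n) I (\<lambda>x. h j x * fr n j x)))
       \<longlonglongrightarrow> bracket a \<beta> 0 I A + (\<Sum>j\<in>I - {i}. \<beta> / 2 * bracket a \<beta> 0 I (h j))"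
      by (intro tendsto_intros limA limh)
  qed (simp only: eq tendsto_const)
  moreover have "bracket a \<beta> 0 I A = a * bracket a \<beta> 0 I X' - (c * a + e0) * bracket a \<beta> 0 I X"
  proof -
    have "A = (\<lambda>x. a * X' x + (- (c * a + e0)) * X x)"
      unfolding A_def X'X by (simp add: algebra_simps fun_eq_iff)
    then have "bracket a \<beta> 0 I A = bracket a \<beta> 0 I (\<lambda>x. a * X' x) + bracket a \<beta> 0 I (\<lambda>x. (- (c * a + e0)) * X x)"
      by (simp only:) (intro bracket_add poly_bounded_mult poly_bounded_const pX pX'; simp)
    then show ?thesis by (simp only: bracket_cmult; simp add: algebra_simps)
  qed
  moreover have "bracket a \<beta> 0 I (h j) = - c * bracket a \<beta> 0 I X" if "j \<in> K" for j
    using that bracket_cmult[of 0 "-c" X] by (simp add: h_def)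
  moreover have "bracket a \<beta> 0 I (h j) = bracket a \<beta> 0 I X' - 2 * c * bracket a \<beta> 0 I X" if j: "j \<in> I - K" for j
  proof -
    have jI: "j \<in> I" "j \<noteq> i" using j K by auto
    have pjX: "poly_bounded I (\<lambda>x. x j * X' x)" using jI I by (intro poly_bounded_mult poly_bounded_coord pX')
    have "X (swap_coords I i j x) = x j * X' x" for x
    proof -
      have "X' (swap_coords I i j x) = X' x" unfolding X'_def using K j
        by (intro prod.cong refl) (auto simp: swap_coords_def Transposition.transpose_def)
      then show ?thesis unfolding X'X using iI by (simp add: swap_coords_def)
    qed
    then have 1: "bracket a \<beta> 0 I (\<lambda>x. x j * X' x) = bracket a \<beta> 0 I X"
      using bracket_swap_coords[OF I iI jI(1), of X a \<beta> 0] pX by (simp add: poly_bounded_def)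
    have "h j = (\<lambda>x. X' x + ((- c) * X x + (- c) * (x j * X' x)))"
      unfolding h_def using j by (simp add: fun_eq_iff)
    then have "bracket a \<beta> 0 I (h j) = bracket a \<beta> 0 I X' + bracket a \<beta> 0 I (\<lambda>x. (- c) * X x + (- c) * (x j * X' x))"
      by (simp only:) (intro bracket_add poly_bounded_add poly_bounded_mult[OF poly_bounded_const] pX pX' pjX; simp)
    also have "bracket a \<beta> 0 I (\<lambda>x. (- c) * X x + (- c) * (x j * X' x)) = bracket a \<beta> 0 I (\<lambda>x. (- c) * X x) + bracket a \<beta> 0 I (\<lambda>x. (- c) * (x j * X' x))"
      by (intro bracket_add poly_bounded_mult[OF poly_bounded_const] pX pjX; simp)
    finally show ?thesis by (simp only: bracket_cmult 1; simp add: algebra_simps)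
  qed
  moreover have "(\<Sum>j\<in>I - {i}. \<beta> / 2 * bracket a \<beta> 0 I (h j)) =
      (\<Sum>j\<in>K - {i}. \<beta> / 2 * bracket a \<beta> 0 I (h j)) + (\<Sum>j\<in>I - K. \<beta> / 2 * bracket a \<beta> 0 I (h j))"
  proof -
    have "I - {i} = (K - {i}) \<union> (I - K)" using K by auto
    then show ?thesis using I finK by (simp only:) (rule sum.union_disjoint, auto)
  qed
  ultimately have "a * bracket a \<beta> 0 I X' - (c * a + e0) * bracket a \<beta> 0 I X
     + (real (card (K - {i})) * (\<beta> / 2 * (- c * bracket a \<beta> 0 I X)) +
        real (card (I - K)) * (\<beta> / 2 * (bracket a \<beta> 0 I X' - 2 * c * bracket a \<beta> 0 I X))) = 0"
    by simp
  moreover have "real (card (K - {i})) = real (card K) - 1"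
    using finK K by (simp add: of_nat_diff card_gt_0_iff Suc_le_eq)
      (metis One_nat_def Suc_leI card_gt_0_iff empty_iff of_nat_1 of_nat_diff)
  moreover have "real (card (I - K)) = real (card I) - real (card K)"
    using finK I K by (simp add: card_Diff_subset of_nat_diff card_mono)
  ultimately show ?thesis unfolding X'_def[symmetric] X_def[symmetric]
    by (simp add: algebra_simps add_divide_distrib diff_divide_distrib)
qed

text \<open>The case \<open>K = I\<close> relates the Selberg integral with exponent \<open>a + 1\<close> to the one with exponent \<open>a\<close>.\<close>
lemma aomoto_product:
  assumes "K \<subseteq> I"
  shows "bracket a \<beta> 0 I (\<lambda>x. \<Prod>l\<in>K. x l) *
      (\<Prod>k=1..card K. c * a + e0 + c * \<beta> * ((real k - 1) / 2 + (real (card I) - real k))) =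
    (\<Prod>k=1..card K. a + \<beta> / 2 * (real (card I) - real k)) * bracket a \<beta> 0 I (\<lambda>x. 1)"
proof -
  have "finite K" using assms I by (rule finite_subset)
  then show ?thesis using assms
  proof (induction K rule: finite_induct)
    case (insert i K)
    define D where "D k = c * a + e0 + c * \<beta> * ((real k - 1) / 2 + (real (card I) - real k))" for k :: nat
    define N where "N k = a + \<beta> / 2 * (real (card I) - real k)" for k :: nat
    have rec: "N (Suc (card K)) * bracket a \<beta> 0 I (\<lambda>x. \<Prod>l\<in>K. x l) =
      D (Suc (card K)) * bracket a \<beta> 0 I (\<lambda>x. \<Prod>l\<in>insert i K. x l)"
      using aomoto_recursion[OF insert.prems, of i] insert.hyps
      unfolding N_def D_def by (simp add: insert_Diff_if)
    have "bracket a \<beta> 0 I (\<lambda>x. \<Prod>l\<in>insert i K. x l) * (\<Prod>k=1..card (insert i K). D k) =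
        (D (Suc (card K)) * bracket a \<beta> 0 I (\<lambda>x. \<Prod>l\<in>insert i K. x l)) * (\<Prod>k=1..card K. D k)"
      using insert.hyps by simp
    also have "\<dots> = N (Suc (card K)) * (bracket a \<beta> 0 I (\<lambda>x. \<Prod>l\<in>K. x l) * (\<Prod>k=1..card K. D k))"
      unfolding rec[symmetric] by simp
    also have "\<dots> = N (Suc (card K)) * ((\<Prod>k=1..card K. N k) * bracket a \<beta> 0 I (\<lambda>x. 1))"
      using insert unfolding N_def D_def by simp
    also have "\<dots> = (\<Prod>k=1..card (insert i K). N k) * bracket a \<beta> 0 I (\<lambda>x. 1)"
      using insert.hyps by simp
    finally show ?case unfolding N_def D_def .
  qed simp
qed

end

end

section \<open>Log-convex solutions of difference equations, Laplace transforms\<close>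

text \<open>The argument of Bohr and Mollerup. The difference of the logarithms is periodic. By convexity both
logarithms have a slope on \<open>[n, n + t]\<close> between \<open>ln (r (n - 1))\<close> and \<open>ln (r n)\<close>, two numbers whose difference
tends to 0, so the periodic difference is constant.\<close>
lemma bohr_mollerup_unique:
  fixes f g r :: "real \<Rightarrow> real"
  assumes f: "\<And>x. 0 < x \<Longrightarrow> 0 < f x" "convex_on {0<..} (ln \<circ> f)" "\<And>x. 0 < x \<Longrightarrow> f (x + 1) = r x * f x"
    and g: "\<And>x. 0 < x \<Longrightarrow> 0 < g x" "convex_on {0<..} (ln \<circ> g)" "\<And>x. 0 < x \<Longrightarrow> g (x + 1) = r x * g x"
    and r: "\<And>x. 0 < x \<Longrightarrow> 0 < r x" "(\<lambda>n. r (real (Suc (Suc n))) / r (real (Suc n))) \<longlonglongrightarrow> 1"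
    and x: "0 < x" and y: "0 < y"
  shows "f x * g y = f y * g x"
proof -
  define h where "h t = ln (f t) - ln (g t)" for t
  have per1: "h (t + 1) = h t" if "0 < t" for t
    using f(1)[OF that] g(1)[OF that] r(1)[OF that] unfolding h_def f(3)[OF that] g(3)[OF that]
    by (simp add: ln_mult)
  have per: "h (t + real n) = h t" if "0 < t" for t n
    using that
  proof (induction n)
    case (Suc n)
    have "h (t + real (Suc n)) = h ((t + real n) + 1)" by (simp add: add_ac)
    also have "\<dots> = h (t + real n)" using Suc by (intro per1) auto
    finally show ?case using Suc by simp
  qed simp
  have slope: "t * ln (r (real (Suc n))) \<le> u (real n + 2 + t) - u (real n + 2) \<and>
      u (real n + 2 + t) - u (real n + 2) \<le> t * ln (r (real (Suc (Suc n))))"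
    if t: "0 < t" "t \<le> 1" and k: "\<And>x. 0 < x \<Longrightarrow> 0 < k x" "convex_on {0<..} (ln \<circ> k)" "\<And>x. 0 < x \<Longrightarrow> k (x + 1) = r x * k x"
      and u: "u = (\<lambda>x. ln (k x))" for t n k u
  proof -
    have step: "u (s + 1) = ln (r s) + u s" if "0 < s" for s
      unfolding u k(3)[OF that] using k(1)[OF that] r(1)[OF that] by (simp add: ln_mult)
    have cv: "convex_on {0<..} u" using k(2) by (simp add: u o_def)
    have e1: "u (real n + 2) = ln (r (real (Suc n))) + u (real n + 1)"
      using step[of "real n + 1"] by (simp add: add_ac)
    have e2: "u (real n + 3) = ln (r (real (Suc (Suc n)))) + u (real n + 2)"
      using step[of "real n + 2"] by (simp add: add_ac)
    have "u ((1 - t) * (real n + 2) + t * (real n + 3)) \<le> (1 - t) * u (real n + 2) + t * u (real n + 3)"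
      using convex_onD[OF cv, of t "real n + 2" "real n + 3"] t by simp
    moreover have "(1 - t) * (real n + 2) + t * (real n + 3) = real n + 2 + t" by (simp add: algebra_simps)
    ultimately have up: "u (real n + 2 + t) \<le> u (real n + 2) + t * (u (real n + 3) - u (real n + 2))"
      by (simp add: algebra_simps)
    \<comment> \<open>the weight that makes \<open>n + 2\<close> a convex combination of \<open>n + 1\<close> and \<open>n + 2 + t\<close>\<close>
    define \<theta> where "\<theta> = 1 / (1 + t)"
    have th: "0 \<le> \<theta>" "\<theta> \<le> 1" "\<theta> * (1 + t) = 1" using t by (auto simp: \<theta>_def)
    have "u ((1 - \<theta>) * (real n + 1) + \<theta> * (real n + 2 + t)) \<le> (1 - \<theta>) * u (real n + 1) + \<theta> * u (real n + 2 + t)"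
      using convex_onD[OF cv, of \<theta> "real n + 1" "real n + 2 + t"] t th by simp
    moreover have "(1 - \<theta>) * (real n + 1) + \<theta> * (real n + 2 + t) = real n + 2"
    proof -
      have "(1 - \<theta>) * (real n + 1) + \<theta> * (real n + 2 + t) = real n + 1 + \<theta> * (1 + t)" by (simp add: algebra_simps)
      then show ?thesis using th(3) by simp
    qed
    ultimately have "u (real n + 2) \<le> (1 - \<theta>) * u (real n + 1) + \<theta> * u (real n + 2 + t)" by simp
    then have "(1 + t) * u (real n + 2) \<le> (1 + t) * ((1 - \<theta>) * u (real n + 1) + \<theta> * u (real n + 2 + t))"
      using t by (intro mult_left_mono) auto
    also have "\<dots> = (1 + t - \<theta> * (1 + t)) * u (real n + 1) + (\<theta> * (1 + t)) * u (real n + 2 + t)"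
      by (simp add: algebra_simps)
    finally have lo: "t * (u (real n + 2) - u (real n + 1)) \<le> u (real n + 2 + t) - u (real n + 2)"
      unfolding th(3) by (simp add: algebra_simps)
    show ?thesis using up lo unfolding e1 e2 by (simp add: algebra_simps)
  qed
  have h1: "h t = h 1" if t: "0 < t" "t \<le> 1" for t
  proof -
    have "\<bar>h t - h 1\<bar> \<le> ln (r (real (Suc (Suc n))) / r (real (Suc n)))" for n
    proof -
      have "h t - h 1 = h (t + real (n + 2)) - h (1 + real (n + 1))" using t by (simp only: per zero_less_one)
      also have "\<dots> = h (real n + 2 + t) - h (real n + 2)" by (simp add: add_ac)
      also have "\<bar>\<dots>\<bar> \<le> t * (ln (r (real (Suc (Suc n)))) - ln (r (real (Suc n))))"
        using slope[OF t f refl, of n] slope[OF t g refl, of n] unfolding h_def right_diff_distrib abs_le_iff by linarith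
      also have "\<dots> \<le> 1 * (ln (r (real (Suc (Suc n)))) - ln (r (real (Suc n))))"
      proof (rule mult_right_mono[OF t(2)])
        show "0 \<le> ln (r (real (Suc (Suc n)))) - ln (r (real (Suc n)))"
          using slope[OF zero_less_one order_refl f refl, of n] by simp
      qed
      also have "\<dots> = ln (r (real (Suc (Suc n))) / r (real (Suc n)))"
        using r(1)[of "real (Suc n)"] r(1)[of "real (Suc (Suc n))"] by (simp add: ln_div)
      finally show ?thesis .
    qed
    moreover have "(\<lambda>n. ln (r (real (Suc (Suc n))) / r (real (Suc n)))) \<longlonglongrightarrow> ln 1"
      by (rule tendsto_ln[OF r(2)]) simp
    ultimately have "\<bar>h t - h 1\<bar> \<le> ln 1"
      by (intro LIMSEQ_le_const[where X = "\<lambda>n. ln (r (real (Suc (Suc n))) / r (real (Suc n)))"]) auto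
    then show ?thesis by simp
  qed
  have h2: "h t = h 1" if t: "0 < t" for t
  proof -
    define n where "n = nat (\<lceil>t\<rceil> - 1)"
    have n: "real n = of_int \<lceil>t\<rceil> - 1" using t by (simp add: n_def)
    have "0 < t - real n" "t - real n \<le> 1" unfolding n using t by linarith+
    from h1[OF this] per[OF this(1), of n] show ?thesis by simp
  qed
  have "ln (f x * g y) = ln (f y * g x)"
    using h2[OF x] h2[OF y] f(1)[OF x] f(1)[OF y] g(1)[OF x] g(1)[OF y]
    unfolding h_def by (simp add: ln_mult)
  then show ?thesis using f(1)[OF x] f(1)[OF y] g(1)[OF x] g(1)[OF y] by simp
qed

text \<open>Hoelder's inequality. It is derived from the convexity of \<open>exp\<close> after normalising both integrals to 1.\<close>
lemma laplace_log_convex: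
  fixes Y H :: "'a \<Rightarrow> real"
  assumes int: "\<And>s. 0 < s \<Longrightarrow> integrable M (\<lambda>x. exp (s * Y x) * H x)"
    and H: "\<And>x. 0 \<le> H x"
    and pos: "\<And>s. 0 < s \<Longrightarrow> 0 < (LINT x|M. exp (s * Y x) * H x)"
  shows "convex_on {0<..} (ln \<circ> (\<lambda>s. LINT x|M. exp (s * Y x) * H x))"
proof (rule convex_onI)
  define F where "F = (\<lambda>s. LINT x|M. exp (s * Y x) * H x)"
  fix t s u :: real assume t: "0 < t" "t < 1" and "s \<in> {0<..}" "u \<in> {0<..}"
  then have su: "0 < s" "0 < u" by auto
  define w where "w = (1 - t) * s + t * u"
  have w: "0 < w" unfolding w_def using t su by (intro add_pos_pos mult_pos_pos) auto
  define A where "A = ln (F s)"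
  define B where "B = ln (F u)"
  have eA: "exp (- A) * F s = 1" and eB: "exp (- B) * F u = 1"
    unfolding A_def B_def using pos[OF su(1)] pos[OF su(2)] by (simp_all add: F_def exp_minus)
  have pt: "exp (- ((1 - t) * A + t * B)) * (exp (w * Y x) * H x) \<le>
      (1 - t) * (exp (- A) * (exp (s * Y x) * H x)) + t * (exp (- B) * (exp (u * Y x) * H x))" for x
  proof -
    have "exp ((1 - t) * (s * Y x - A) + t * (u * Y x - B)) \<le> (1 - t) * exp (s * Y x - A) + t * exp (u * Y x - B)"
      using convex_onD[OF exp_convex, of t "s * Y x - A" "u * Y x - B"] t by simp
    from mult_right_mono[OF this H[of x]]
    have "exp ((1 - t) * (s * Y x - A) + t * (u * Y x - B)) * H x \<le>
      ((1 - t) * exp (s * Y x - A) + t * exp (u * Y x - B)) * H x" .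
    moreover have "(1 - t) * (s * Y x - A) + t * (u * Y x - B) = - ((1 - t) * A + t * B) + w * Y x"
      unfolding w_def by (simp add: algebra_simps)
    moreover have "s * Y x - A = - A + s * Y x" "u * Y x - B = - B + u * Y x" by auto
    ultimately have "exp (- ((1 - t) * A + t * B) + w * Y x) * H x \<le>
      ((1 - t) * exp (- A + s * Y x) + t * exp (- B + u * Y x)) * H x" by (simp only:)
    then show ?thesis unfolding exp_add distrib_right mult.assoc .
  qed
  have "exp (- ((1 - t) * A + t * B)) * F w = (LINT x|M. exp (- ((1 - t) * A + t * B)) * (exp (w * Y x) * H x))"
    unfolding F_def by simp
  also have "\<dots> \<le> (LINT x|M. (1 - t) * (exp (- A) * (exp (s * Y x) * H x)) + t * (exp (- B) * (exp (u * Y x) * H x)))"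
    using su w by (intro integral_mono pt Bochner_Integration.integrable_add integrable_mult_right int) auto
  also have "\<dots> = (1 - t) * (exp (- A) * F s) + t * (exp (- B) * F u)"
    unfolding F_def using su
    by (subst Bochner_Integration.integral_add) (auto intro!: integrable_mult_right int)
  also have "\<dots> = 1" unfolding eA eB by simp
  finally have le1: "exp (- ((1 - t) * A + t * B)) * F w \<le> 1" .
  have "exp (- S) * T \<le> 1 \<Longrightarrow> T \<le> exp S" for S T :: real by (simp add: exp_minus field_simps)
  from this[OF le1] have "F w \<le> exp ((1 - t) * A + t * B)" .
  moreover have "0 < F w" unfolding F_def using pos[OF w] .
  ultimately have "ln (F w) \<le> (1 - t) * A + t * B" 
    by (metis exp_le_cancel_iff exp_ln)
  then show "(ln \<circ> (\<lambda>s. LINT x|M. exp (s * Y x) * H x)) ((1 - t) *\<^sub>R s + t *\<^sub>R u) \<le>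
      (1 - t) * (ln \<circ> (\<lambda>s. LINT x|M. exp (s * Y x) * H x)) s + t * (ln \<circ> (\<lambda>s. LINT x|M. exp (s * Y x) * H x)) u"
    by (simp add: F_def A_def B_def w_def)
qed simp

lemma laplace_integrable_complex:
  fixes Y H :: "'a \<Rightarrow> real"
  assumes int: "integrable M (\<lambda>x. exp (Re z * Y x) * H x)"
    and [measurable]: "Y \<in> borel_measurable M" "H \<in> borel_measurable M"
  shows "integrable M (\<lambda>x. exp (z * complex_of_real (Y x)) * complex_of_real (H x))"
proof (rule Bochner_Integration.integrable_bound[OF int])
  show "AE x in M. norm (exp (z * complex_of_real (Y x)) * complex_of_real (H x)) \<le> norm (exp (Re z * Y x) * H x)"
    by (simp add: norm_mult)
qed measurable

lemma norm_exp_minus_1_le: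
  fixes w :: complex shows "norm (exp w - 1) \<le> norm w * exp (max 0 (Re w))"
proof -
  have "norm (exp w - exp 0) \<le> exp (max 0 (Re w)) * norm (w - 0)"
  proof (rule field_differentiable_bound)
    fix u assume "u \<in> closed_segment 0 w"
    then obtain t where t: "0 \<le> t" "t \<le> 1" "u = of_real t * w"
      by (auto simp: in_segment scaleR_conv_of_real)
    have "t * Re w \<le> max 0 (Re w)"
    proof (cases "0 \<le> Re w")
      case True
      then show ?thesis using t mult_right_mono[of t 1 "Re w"] by simp
    next
      case False
      then show ?thesis using t mult_nonneg_nonpos[of t "Re w"] by simp
    qed
    then show "norm (exp u) \<le> exp (max 0 (Re w))" using t by simp
  qed (auto intro!: derivative_eq_intros)
  then show ?thesis by (simp add: mult.commute)
qed

lemma exp_quotient_bound: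
  fixes w :: complex shows "norm (exp w - 1) \<le> norm w * exp (norm w)"
proof -
  have "max 0 (Re w) \<le> norm w" using complex_Re_le_cmod[of w] by simp
  then have "norm w * exp (max 0 (Re w)) \<le> norm w * exp (norm w)" by (intro mult_left_mono) auto
  then show ?thesis using norm_exp_minus_1_le[of w] by linarith
qed

text \<open>The difference quotients are dominated: \<open>\<bar>Y\<bar> * exp (Re z * Y + \<eta> * \<bar>Y\<bar>)\<close> is at most a constant times
\<open>exp ((Re z + 2 * \<eta>) * Y) + exp ((Re z - 2 * \<eta>) * Y)\<close>, which is integrable for small \<open>\<eta>\<close>.\<close>
lemma laplace_holomorphic:
  fixes Y H :: "'a \<Rightarrow> real"
  assumes int: "\<And>s. 0 < s \<Longrightarrow> integrable M (\<lambda>x. exp (s * Y x) * H x)"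
    and H: "\<And>x. 0 \<le> H x"
    and [measurable]: "Y \<in> borel_measurable M" "H \<in> borel_measurable M"
  shows "(\<lambda>z. LINT x|M. exp (z * complex_of_real (Y x)) * complex_of_real (H x)) holomorphic_on {z. 0 < Re z}"
    (is "?F holomorphic_on _")
proof (rule holomorphic_onI)
  fix z :: complex assume "z \<in> {z. 0 < Re z}"
  then have z: "0 < Re z" by simp
  \<comment> \<open>small enough that \<open>Re z - 2 * \<eta>\<close> is positive\<close>
  define \<eta> where "\<eta> = Re z / 4"
  have \<eta>: "0 < \<eta>" "2 * \<eta> < Re z" using z by (auto simp: \<eta>_def)
  define D where "D = (LINT x|M. complex_of_real (Y x) * exp (z * complex_of_real (Y x)) * complex_of_real (H x))"
  have intz: "integrable M (\<lambda>x. exp (w * complex_of_real (Y x)) * complex_of_real (H x))" if "0 < Re w" for w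
    by (rule laplace_integrable_complex[OF int[OF that]]) measurable
  have "((\<lambda>h. (?F (z + h) - ?F z) / h) \<longlongrightarrow> D) (at 0)"
    unfolding tendsto_at_iff_sequentially
  proof (intro allI impI)
    fix X :: "nat \<Rightarrow> complex" assume X0: "\<forall>i. X i \<in> UNIV - {0}" and X: "X \<longlonglongrightarrow> 0"
    have X0: "X i \<noteq> 0" for i using X0 by auto
    obtain N where N: "\<And>i. N \<le> i \<Longrightarrow> norm (X i) < \<eta>"
      using LIMSEQ_D[OF X \<eta>(1)] by auto
    have Xn: "norm (X (i + N)) \<le> \<eta>" for i using N[of "i + N"] by simp
    have Re_pos: "0 < Re (z + X (i + N))" for i
      using abs_Re_le_cmod[of "X (i + N)"] Xn[of i] \<eta> unfolding plus_complex.sel by linarith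
    have "(\<lambda>i. LINT x|M. (exp ((z + X (i + N)) * complex_of_real (Y x)) - exp (z * complex_of_real (Y x))) / X (i + N)
               * complex_of_real (H x)) \<longlonglongrightarrow> D"
      unfolding D_def
    proof (rule integral_dominated_convergence)
      show "integrable M (\<lambda>x. 1 / \<eta> * (exp ((Re z + 2 * \<eta>) * Y x) * H x + exp ((Re z - 2 * \<eta>) * Y x) * H x))"
        using \<eta> z by (intro integrable_mult_right Bochner_Integration.integrable_add int) auto
      show "AE x in M. (\<lambda>i. (exp ((z + X (i + N)) * complex_of_real (Y x)) - exp (z * complex_of_real (Y x))) / X (i + N)
               * complex_of_real (H x)) \<longlonglongrightarrow> complex_of_real (Y x) * exp (z * complex_of_real (Y x)) * complex_of_real (H x)"
      proof (rule AE_I2)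
        fix x
        have "((\<lambda>w. exp (w * complex_of_real (Y x))) has_field_derivative
            complex_of_real (Y x) * exp (z * complex_of_real (Y x))) (at z)"
          by (auto intro!: derivative_eq_intros)
        then have "((\<lambda>h. (exp ((z + h) * complex_of_real (Y x)) - exp (z * complex_of_real (Y x))) / h) \<longlongrightarrow>
            complex_of_real (Y x) * exp (z * complex_of_real (Y x))) (at 0)"
          by (simp add: DERIV_def)
        then have "(\<lambda>i. (exp ((z + X i) * complex_of_real (Y x)) - exp (z * complex_of_real (Y x))) / X i) \<longlonglongrightarrow>
            complex_of_real (Y x) * exp (z * complex_of_real (Y x))"
          using X0 X unfolding tendsto_at_iff_sequentially o_def by auto
        from tendsto_mult[OF LIMSEQ_ignore_initial_segment[OF this, of N] tendsto_const]
        show "(\<lambda>i. (exp ((z + X (i + N)) * complex_of_real (Y x)) - exp (z * complex_of_real (Y x))) / X (i + N)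
               * complex_of_real (H x)) \<longlonglongrightarrow> complex_of_real (Y x) * exp (z * complex_of_real (Y x)) * complex_of_real (H x)" .
      qed
      fix i
      show "AE x in M. norm ((exp ((z + X (i + N)) * complex_of_real (Y x)) - exp (z * complex_of_real (Y x))) / X (i + N)
               * complex_of_real (H x)) \<le> 1 / \<eta> * (exp ((Re z + 2 * \<eta>) * Y x) * H x + exp ((Re z - 2 * \<eta>) * Y x) * H x)"
      proof (rule AE_I2)
        fix x
        define y where "y = Y x"
        define h where "h = X (i + N)"
        have h: "h \<noteq> 0" "norm h \<le> \<eta>" unfolding h_def using X0 Xn by auto
        have "exp ((z + h) * of_real y) - exp (z * of_real y) = exp (z * of_real y) * (exp (h * of_real y) - 1)"
          by (simp add: algebra_simps exp_add)
        then have "norm ((exp ((z + h) * of_real y) - exp (z * of_real y)) / h) =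
            exp (Re z * y) * (norm (exp (h * of_real y) - 1) / norm h)"
          by (simp add: norm_mult norm_divide)
        also have "\<dots> \<le> exp (Re z * y) * (exp (2 * \<eta> * \<bar>y\<bar>) / \<eta>)"
        proof (rule mult_left_mono)
          have "norm (exp (h * of_real y) - 1) / norm h \<le> \<bar>y\<bar> * exp (norm h * \<bar>y\<bar>)"
            using exp_quotient_bound[of "h * of_real y"] h(1) by (simp add: norm_mult divide_le_eq mult_ac)
          also have "\<dots> \<le> \<bar>y\<bar> * exp (\<eta> * \<bar>y\<bar>)"
            using h(2) by (intro mult_left_mono) (auto intro: mult_right_mono)
          also have "\<dots> \<le> (exp (\<eta> * \<bar>y\<bar>) / \<eta>) * exp (\<eta> * \<bar>y\<bar>)"
          proof (rule mult_right_mono)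
            have "\<eta> * \<bar>y\<bar> \<le> exp (\<eta> * \<bar>y\<bar>)" using exp_ge_add_one_self[of "\<eta> * \<bar>y\<bar>"] by linarith
            then show "\<bar>y\<bar> \<le> exp (\<eta> * \<bar>y\<bar>) / \<eta>" using \<eta>(1) by (simp add: field_simps)
          qed simp
          also have "\<dots> = exp (2 * \<eta> * \<bar>y\<bar>) / \<eta>" by (simp add: exp_add[symmetric])
          finally show "norm (exp (h * of_real y) - 1) / norm h \<le> exp (2 * \<eta> * \<bar>y\<bar>) / \<eta>" .
        qed simp
        also have "\<dots> = 1 / \<eta> * exp (Re z * y + 2 * \<eta> * \<bar>y\<bar>)" by (simp add: exp_add)
        also have "\<dots> \<le> 1 / \<eta> * (exp ((Re z + 2 * \<eta>) * y) + exp ((Re z - 2 * \<eta>) * y))"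
          using \<eta>(1) by (intro mult_left_mono) (cases "0 \<le> y"; auto simp: algebra_simps add_increasing2)+
        finally have "norm ((exp ((z + h) * of_real y) - exp (z * of_real y)) / h) * H x \<le>
            1 / \<eta> * (exp ((Re z + 2 * \<eta>) * y) + exp ((Re z - 2 * \<eta>) * y)) * H x"
          using H[of x] by (rule mult_right_mono)
        then show "norm ((exp ((z + X (i + N)) * complex_of_real (Y x)) - exp (z * complex_of_real (Y x))) / X (i + N)
               * complex_of_real (H x)) \<le> 1 / \<eta> * (exp ((Re z + 2 * \<eta>) * Y x) * H x + exp ((Re z - 2 * \<eta>) * Y x) * H x)"
          using H[of x] unfolding y_def h_def by (simp only: norm_mult norm_of_real abs_of_nonneg distrib_right mult.assoc)
      qed
    qed measurable
    moreover have "(LINT x|M. (exp ((z + X (i + N)) * complex_of_real (Y x)) - exp (z * complex_of_real (Y x))) / X (i + N)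
               * complex_of_real (H x)) = (?F (z + X (i + N)) - ?F z) / X (i + N)" for i
    proof -
      have "(?F (z + X (i + N)) - ?F z) / X (i + N) = (LINT x|M. (exp ((z + X (i + N)) * complex_of_real (Y x)) * complex_of_real (H x)
         - exp (z * complex_of_real (Y x)) * complex_of_real (H x)) / X (i + N))"
        using intz[OF Re_pos[of i]] intz[OF z] by simp
      also have "\<dots> = (LINT x|M. (exp ((z + X (i + N)) * complex_of_real (Y x)) - exp (z * complex_of_real (Y x))) / X (i + N)
               * complex_of_real (H x))"
        by (intro Bochner_Integration.integral_cong refl) (simp add: left_diff_distrib)
      finally show ?thesis by (rule sym)
    qed
    ultimately have "(\<lambda>i. (?F (z + X (i + N)) - ?F z) / X (i + N)) \<longlonglongrightarrow> D" by (simp only:)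
    then show "((\<lambda>h. (?F (z + h) - ?F z) / h) \<circ> X) \<longlonglongrightarrow> D"
      unfolding o_def by (rule LIMSEQ_offset[of "\<lambda>i. (?F (z + X i) - ?F z) / X i" N])
  qed
  then have "(?F has_field_derivative D) (at z)" by (simp add: DERIV_def)
  then show "?F field_differentiable at z within {z. 0 < Re z}"
    by (meson field_differentiable_at_within field_differentiable_def)
qed

section \<open>Selberg's integral as a Mellin transform\<close>

lemma Gamma_shift_log_convex:
  fixes s :: real assumes "0 \<le> s"
  shows "convex_on {0<..} (\<lambda>x. ln (Gamma (x + s)))"
proof (rule convex_onI)
  fix t x y :: real assume t: "0 < t" "t < 1" and xy: "x \<in> {0<..}" "y \<in> {0<..}"
  have "(ln \<circ> Gamma) ((1 - t) *\<^sub>R (x + s) + t *\<^sub>R (y + s)) \<le> (1 - t) * (ln \<circ> Gamma) (x + s) + t * (ln \<circ> Gamma) (y + s)"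
    using t xy assms by (intro convex_onD[OF log_convex_Gamma_real]) auto
  moreover have "(1 - t) *\<^sub>R (x + s) + t *\<^sub>R (y + s) = (1 - t) *\<^sub>R x + t *\<^sub>R y + s" by (simp add: algebra_simps)
  ultimately show "ln (Gamma ((1 - t) *\<^sub>R x + t *\<^sub>R y + s)) \<le> (1 - t) * ln (Gamma (x + s)) + t * ln (Gamma (y + s))"
    by simp
qed simp

lemma Gamma_real_shift:
  fixes x s :: real assumes "0 < x + s"
  shows "Gamma (x + 1 + s) = (x + s) * Gamma (x + s)"
proof -
  have "x + s \<notin> \<int>\<^sub>\<le>\<^sub>0" using assms by (auto dest: nonpos_Ints_nonpos)
  from Gamma_plus1[OF this] show ?thesis by (simp only: add_ac)
qed

lemma exp_of_real_mult: "exp (complex_of_real x * complex_of_real y) = complex_of_real (exp (x * y))"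
  by (metis exp_of_real of_real_mult)

lemma convex_on_pos_cong:
  fixes f g :: "real \<Rightarrow> real"
  assumes f: "convex_on {0<..} f" and eq: "\<And>x. x \<in> {0<..} \<Longrightarrow> g x = f x"
  shows "convex_on {0<..} g"
proof (rule convex_onI)
  fix t x y :: real assume t: "0 < t" "t < 1" and xy: "x \<in> {0<..}" "y \<in> {0<..}"
  have "(1 - t) *\<^sub>R x + t *\<^sub>R y \<in> {0<..}" using t xy by (auto intro!: add_pos_pos)
  then show "g ((1 - t) *\<^sub>R x + t *\<^sub>R y) \<le> (1 - t) * g x + t * g y"
    using convex_onD[OF f, of t x y] t xy eq by auto
qed simp

lemma convex_on_sum_ln:
  fixes f :: "'b \<Rightarrow> real \<Rightarrow> real"
  assumes "finite J" "\<And>j. j \<in> J \<Longrightarrow> convex_on {0<..} (f j)"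
  shows "convex_on {0<..} (\<lambda>x. \<Sum>j\<in>J. f j x)"
  using assms
proof (induction J rule: finite_induct)
  case empty
  show ?case by (simp add: convex_on_const del: greaterThan_iff)
next
  case (insert j J)
  have "convex_on {0<..} (\<lambda>x. f j x + (\<Sum>j\<in>J. f j x))"
    by (rule convex_on_add) (use insert in auto)
  then show ?case using insert.hyps by simp
qed

lemma right_half_plane_identity:
  assumes f: "f holomorphic_on {z. 0 < Re z}" and g: "g holomorphic_on {z. 0 < Re z}"
    and eq: "\<And>x. 0 < x \<Longrightarrow> f (complex_of_real x) = g (complex_of_real x)" and z: "0 < Re z"
  shows "f z = g z"
proof -
  have "f z - g z = 0"
  proof (rule analytic_continuation[of "\<lambda>z. f z - g z" "{z. 0 < Re z}" "complex_of_real ` {0<..}" 1])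
    show "1 islimpt complex_of_real ` {0<..}"
      unfolding islimpt_approachable
    proof (intro allI impI)
      fix e :: real assume e: "0 < e"
      have "dist (complex_of_real (1 + e / 2)) 1 = e / 2" using e by (simp add: dist_norm)
      moreover have "complex_of_real (1 + e / 2) \<noteq> 1" using e by simp
      moreover have "complex_of_real (1 + e / 2) \<in> complex_of_real ` {0<..}" using e by (intro imageI) simp
      ultimately show "\<exists>x'\<in>complex_of_real ` {0<..}. x' \<noteq> 1 \<and> dist x' 1 < e"
        using e by (intro bexI[of _ "complex_of_real (1 + e / 2)"]) linarith+
    qed
    show "open {z. 0 < Re z}" by (rule open_halfspace_Re_gt)
    show "connected {z. 0 < Re z}" by (intro convex_connected convex_halfspace_Re_gt)
  qed (use f g eq z in \<open>auto intro!: holomorphic_intros\<close>)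
  then show ?thesis by simp
qed

lemma Re_pos_not_nonpos_Ints: "0 < Re z \<Longrightarrow> z \<notin> \<int>\<^sub>\<le>\<^sub>0"
  by (auto elim!: nonpos_Ints_cases)

context pearson_weight
begin

definition logprod :: "nat set \<Rightarrow> (nat \<Rightarrow> real) \<Rightarrow> real" where
  "logprod I x = (\<Sum>i\<in>I. ln (x i))"

definition baseweight :: "real \<Rightarrow> nat set \<Rightarrow> (nat \<Rightarrow> real) \<Rightarrow> real" where
  "baseweight \<beta> I x = vandermonde \<beta> 0 I x * weight_product 0 I x"

text \<open>The Selberg integral with the exponent \<open>z - 1\<close> of the coordinates made complex, written as a Laplace
transform in the logarithm of the product of the coordinates.\<close>
definition selberg :: "real \<Rightarrow> nat set \<Rightarrow> complex \<Rightarrow> complex" where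
  "selberg \<beta> I z = (LINT x|Pi\<^sub>M I (\<lambda>_. lborel).
      exp (z * complex_of_real (logprod I x)) * complex_of_real (baseweight \<beta> I x))"

lemma logprod_meas [measurable]: "logprod I \<in> borel_measurable (Pi\<^sub>M I (\<lambda>_. lborel))"
  unfolding logprod_def[abs_def] by measurable

lemma baseweight_meas [measurable]: "baseweight \<beta> I \<in> borel_measurable (Pi\<^sub>M I (\<lambda>_. lborel))"
  unfolding baseweight_def[abs_def] using vandermonde_meas[of \<beta> 0 I] by measurable

lemma baseweight_nonneg: "0 \<le> baseweight \<beta> I x"
  unfolding baseweight_def using vandermonde_nonneg weight_product_nonneg by simp

lemma weight_product_eq_exp:
  assumes "finite I" shows "weight_product a I x = exp (a * logprod I x) * weight_product 0 I x"
proof -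
  have "x i powr (a - 1) * v (x i) = exp (a * ln (x i)) * (x i powr (0 - 1) * v (x i))" for i
  proof (cases "0 < x i")
    case True
    then have "x i powr (a - 1) = exp (a * ln (x i)) * x i powr (0 - 1)"
      by (simp add: powr_def exp_add[symmetric] algebra_simps)
    then show ?thesis by simp
  qed (simp add: v_outside)
  then have "weight_product a I x = (\<Prod>i\<in>I. exp (a * ln (x i)) * (x i powr (0 - 1) * v (x i)))"
    unfolding weight_product_def by (intro prod.cong refl) blast
  also have "\<dots> = (\<Prod>i\<in>I. exp (a * ln (x i))) * weight_product 0 I x"
    unfolding weight_product_def prod.distrib[symmetric] by simp
  also have "(\<Prod>i\<in>I. exp (a * ln (x i))) = exp (a * logprod I x)"
    using assms by (simp add: logprod_def sum_distrib_left exp_sum)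
  finally show ?thesis .
qed

lemma weight_product_Suc: "(\<Prod>i\<in>I. x i) * weight_product a I x = weight_product (a + 1) I x"
proof -
  have "x i * (x i powr (a - 1) * v (x i)) = x i powr (a + 1 - 1) * v (x i)" for i
  proof (cases "0 < x i")
    case True
    then show ?thesis by (simp add: powr_diff)
  qed (simp add: v_outside)
  then show ?thesis unfolding weight_product_def prod.distrib[symmetric] by (intro prod.cong refl) blast
qed

context
  fixes \<beta> :: real and I :: "nat set"
  assumes \<beta>: "0 < \<beta>" and I: "finite I"
begin

definition selberg_real :: "real \<Rightarrow> real" where
  "selberg_real a = (LINT x|Pi\<^sub>M I (\<lambda>_. lborel). exp (a * logprod I x) * baseweight \<beta> I x)"

lemma selberg_real_integrable:
  "0 < a \<Longrightarrow> integrable (Pi\<^sub>M I (\<lambda>_. lborel)) (\<lambda>x. exp (a * logprod I x) * baseweight \<beta> I x)"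
  using bracket_integrable[OF _ \<beta> I poly_bounded_const[of I 1], of a 0]
  by (simp add: weight_product_eq_exp[OF I, of a] baseweight_def mult_ac)

lemma selberg_real_eq_bracket: "selberg_real a = bracket a \<beta> 0 I (\<lambda>x. 1)"
  unfolding selberg_real_def bracket_def by (simp add: weight_product_eq_exp[OF I, of a] baseweight_def mult_ac)

lemma selberg_real_plus1_eq_bracket: "selberg_real (a + 1) = bracket a \<beta> 0 I (\<lambda>x. \<Prod>l\<in>I. x l)"
proof -
  have "(\<Prod>l\<in>I. x l) * vandermonde \<beta> 0 I x * weight_product a I x = 1 * vandermonde \<beta> 0 I x * weight_product (a + 1) I x" for x
    using weight_product_Suc[of x I a] by (simp add: mult_ac)
  then show ?thesis unfolding selberg_real_eq_bracket bracket_def by (simp only:)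
qed

lemma selberg_of_real: "selberg \<beta> I (of_real a) = of_real (selberg_real a)"
proof -
  have "selberg \<beta> I (of_real a) = (LINT x|Pi\<^sub>M I (\<lambda>_. lborel). complex_of_real (exp (a * logprod I x) * baseweight \<beta> I x))"
    unfolding selberg_def of_real_mult exp_of_real_mult ..
  also have "\<dots> = of_real (selberg_real a)" unfolding selberg_real_def by (rule integral_complex_of_real)
  finally show ?thesis .
qed

lemma selberg_holomorphic: "selberg \<beta> I holomorphic_on {z. 0 < Re z}"
  unfolding selberg_def[abs_def]
  by (rule laplace_holomorphic[OF selberg_real_integrable baseweight_nonneg]) measurable

lemma selberg_real_pos:
  assumes "0 < a0" "0 < selberg_real a0" "0 < a" shows "0 < selberg_real a"
proof -
  let ?M = "Pi\<^sub>M I (\<lambda>_. lborel :: real measure)"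
  have nn: "0 \<le> exp (b * logprod I x) * baseweight \<beta> I x" for b x using baseweight_nonneg by simp
  have "0 \<le> selberg_real a" unfolding selberg_real_def using nn by (intro integral_nonneg_AE) auto
  moreover have "selberg_real a \<noteq> 0"
  proof
    assume "selberg_real a = 0"
    then have "AE x in ?M. exp (a * logprod I x) * baseweight \<beta> I x = 0"
      using integral_nonneg_eq_0_iff_AE[OF selberg_real_integrable[OF assms(3)]] nn unfolding selberg_real_def by auto
    then have "AE x in ?M. exp (a0 * logprod I x) * baseweight \<beta> I x = 0" by simp
    then have "selberg_real a0 = (LINT x|?M. 0)" unfolding selberg_real_def by (intro integral_cong_AE) auto
    then show False using assms(2) by simp
  qed
  ultimately show ?thesis by simp
qed

text \<open>The Selberg integral is a product of quotients of Gamma values; \<open>num_shift\<close> and \<open>den_shift\<close> are the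
shifts of the argument in the numerators and in the denominators.\<close>
definition num_shift :: "nat \<Rightarrow> real" where "num_shift k = \<beta> / 2 * (real (card I) - real k)"
definition den_shift :: "nat \<Rightarrow> real" where
  "den_shift k = e0 + \<beta> / 2 * (real (card I) - 1 + (real (card I) - real k))"

lemma num_shift_nonneg: "k \<in> {1..card I} \<Longrightarrow> 0 \<le> num_shift k"
  unfolding num_shift_def using \<beta> by simp

lemma den_shift_pos: "k \<in> {1..card I} \<Longrightarrow> 0 < den_shift k"
  unfolding den_shift_def using \<beta> e0_pos by (intro add_pos_nonneg mult_nonneg_nonneg) auto

text \<open>Solves the difference equation given by the left-hand factor in Aomoto's product formula: constant
coefficients for \<open>c = 0\<close>, Gamma functions for \<open>c = 1\<close>.\<close>
definition denom :: "real \<Rightarrow> real" where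
  "denom a = (if c = 0 then exp (a * (real (card I) * ln e0)) else (\<Prod>k=1..card I. Gamma (a + den_shift k)))"
definition denom_complex :: "complex \<Rightarrow> complex" where
  "denom_complex z = (if c = 0 then exp (z * of_real (real (card I) * ln e0)) else (\<Prod>k=1..card I. Gamma (z + of_real (den_shift k))))"

lemma denom_pos: "0 < a \<Longrightarrow> 0 < denom a"
  unfolding denom_def using den_shift_pos by (auto intro!: prod_pos Gamma_real_pos add_pos_pos)

lemma selberg_real_recursion:
  assumes a: "0 < a" and c01: "c = 0 \<or> c = 1"
  shows "selberg_real (a + 1) * denom (a + 1) = (\<Prod>k=1..card I. a + num_shift k) * (selberg_real a * denom a)"
proof -
  have "(\<Prod>k=1..card I. c * a + e0 + c * \<beta> * ((real k - 1) / 2 + (real (card I) - real k))) * denom a = denom (a + 1)"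
  proof (cases "c = 0")
    case True
    have "exp ((a + 1) * (real (card I) * ln e0)) = exp (a * (real (card I) * ln e0)) * exp (real (card I) * ln e0)"
      by (simp add: exp_add[symmetric] algebra_simps)
    also have "exp (real (card I) * ln e0) = e0 ^ card I" using e0_pos by (simp add: exp_of_nat_mult)
    finally have "exp ((a + 1) * (real (card I) * ln e0)) = exp (a * (real (card I) * ln e0)) * e0 ^ card I" .
    moreover have "(\<Prod>k=1..card I. c * a + e0 + c * \<beta> * ((real k - 1) / 2 + (real (card I) - real k))) = e0 ^ card I"
      using True by simp
    ultimately show ?thesis unfolding denom_def if_P[OF True] by (simp only: mult.commute)
  next
    case False
    then have c: "c = 1" using c01 by simp
    have "Gamma (a + 1 + den_shift k) = (a + den_shift k) * Gamma (a + den_shift k)" if "k \<in> {1..card I}" for k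
      using den_shift_pos[OF that] a by (intro Gamma_real_shift) simp
    then have "denom (a + 1) = (\<Prod>k=1..card I. (a + den_shift k) * Gamma (a + den_shift k))"
      unfolding denom_def using c by simp
    moreover have "c * a + e0 + c * \<beta> * ((real k - 1) / 2 + (real (card I) - real k)) = a + den_shift k" for k
      unfolding den_shift_def c by (simp add: field_simps)
    moreover have "denom a = (\<Prod>k=1..card I. Gamma (a + den_shift k))" unfolding denom_def using c by simp
    ultimately show ?thesis by (simp only: prod.distrib)
  qed
  moreover have "selberg_real (a + 1) * (\<Prod>k=1..card I. c * a + e0 + c * \<beta> * ((real k - 1) / 2 + (real (card I) - real k))) =
      (\<Prod>k=1..card I. a + num_shift k) * selberg_real a"
    unfolding selberg_real_plus1_eq_bracket unfolding selberg_real_eq_bracket num_shift_def by (rule aomoto_product[OF a \<beta> I order_refl])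
  moreover have "E * S = T \<Longrightarrow> P * E = Q * R \<Longrightarrow> P * T = Q * (R * S)" for E S T P Q R :: real
    by (metis mult.assoc)
  ultimately show ?thesis by blast
qed

text \<open>Both sides are log-convex and satisfy \<open>f (a + 1) = (\<Prod>k. a + num_shift k) * f a\<close>. The factor \<open>denom\<close> is
kept on the left, since a quotient of Gamma functions need not be visibly log-convex.\<close>
lemma selberg_real_formula:
  assumes a0: "0 < a0" "0 < selberg_real a0" and c01: "c = 0 \<or> c = 1" and a: "0 < a"
  shows "selberg_real a * denom a * (\<Prod>k=1..card I. Gamma (a0 + num_shift k)) = selberg_real a0 * denom a0 * (\<Prod>k=1..card I. Gamma (a + num_shift k))"
proof (rule bohr_mollerup_unique[where r = "\<lambda>x. \<Prod>k=1..card I. x + num_shift k", OF _ _ _ _ _ _ _ _ a a0(1)])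
  note pos = selberg_real_pos[OF a0]
  fix x :: real assume x: "0 < x"
  show "0 < selberg_real x * denom x" using pos[OF x] denom_pos[OF x] by simp
  have nk: "0 < x + num_shift k" if "k \<in> {1..card I}" for k using x num_shift_nonneg[OF that] by simp
  show "0 < (\<Prod>k=1..card I. Gamma (x + num_shift k))"
    using nk by (intro prod_pos Gamma_real_pos)
  show "0 < (\<Prod>k=1..card I. x + num_shift k)" using nk by (intro prod_pos)
  show "selberg_real (x + 1) * denom (x + 1) = (\<Prod>k=1..card I. x + num_shift k) * (selberg_real x * denom x)"
    by (rule selberg_real_recursion[OF x c01])
  have "Gamma (x + 1 + num_shift k) = (x + num_shift k) * Gamma (x + num_shift k)" if "k \<in> {1..card I}" for k
    using nk[OF that] by (rule Gamma_real_shift)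
  then show "(\<Prod>k=1..card I. Gamma (x + 1 + num_shift k)) = (\<Prod>k=1..card I. x + num_shift k) * (\<Prod>k=1..card I. Gamma (x + num_shift k))"
    unfolding prod.distrib[symmetric] by (intro prod.cong refl) auto
next
  note pos = selberg_real_pos[OF a0]
  have cv: "convex_on {0<..} (\<lambda>x. ln (selberg_real x) + ln (denom x))"
  proof (rule convex_on_add)
    show "convex_on {0<..} (\<lambda>x. ln (selberg_real x))"
      using laplace_log_convex[OF selberg_real_integrable baseweight_nonneg] pos unfolding selberg_real_def o_def by blast
    show "convex_on {0<..} (\<lambda>x. ln (denom x))"
    proof (cases "c = 0")
      case True
      then have "(\<lambda>x. ln (denom x)) = (\<lambda>x. x * (real (card I) * ln e0))" unfolding denom_def if_P[OF True] by simp
      moreover have "convex_on {0<..} (\<lambda>x. x * (real (card I) * ln e0))"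
        by (rule convex_onI) (auto simp: algebra_simps)
      ultimately show ?thesis by simp
    next
      case False
      have "convex_on {0<..} (\<lambda>x. \<Sum>k=1..card I. ln (Gamma (x + den_shift k)))"
        using den_shift_pos by (intro convex_on_sum_ln Gamma_shift_log_convex) (auto intro: less_imp_le)
      moreover have "ln (denom x) = (\<Sum>k=1..card I. ln (Gamma (x + den_shift k)))" if "x \<in> {0<..}" for x
      proof -
        have "0 < Gamma (x + den_shift k)" if "k \<in> {1..card I}" for k
          using \<open>x \<in> {0<..}\<close> den_shift_pos[OF that] by (intro Gamma_real_pos) simp
        then show ?thesis unfolding denom_def if_not_P[OF False] by (intro ln_prod) (simp, metis less_irrefl)
      qed
      ultimately show ?thesis by (rule convex_on_pos_cong)
    qed
  qed
  have "(ln \<circ> (\<lambda>a. selberg_real a * denom a)) x = ln (selberg_real x) + ln (denom x)" if "x \<in> {0<..}" for x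
    using pos[of x] denom_pos[of x] that by (simp add: ln_mult)
  with cv show "convex_on {0<..} (ln \<circ> (\<lambda>a. selberg_real a * denom a))"
    by (rule convex_on_pos_cong)
  have cv: "convex_on {0<..} (\<lambda>x. \<Sum>k=1..card I. ln (Gamma (x + num_shift k)))"
    using num_shift_nonneg by (intro convex_on_sum_ln Gamma_shift_log_convex) auto
  have "(ln \<circ> (\<lambda>a. \<Prod>k=1..card I. Gamma (a + num_shift k))) x = (\<Sum>k=1..card I. ln (Gamma (x + num_shift k)))" if "x \<in> {0<..}" for x
  proof -
    have "0 < Gamma (x + num_shift k)" if "k \<in> {1..card I}" for k
      using \<open>x \<in> {0<..}\<close> num_shift_nonneg[OF that] by (intro Gamma_real_pos) simp
    then show ?thesis unfolding o_def by (intro ln_prod) (simp, metis less_irrefl)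
  qed
  with cv show "convex_on {0<..} (ln \<circ> (\<lambda>a. \<Prod>k=1..card I. Gamma (a + num_shift k)))"
    by (rule convex_on_pos_cong)
next
  define x where "x = (\<lambda>n. real (Suc n))"
  have x: "filterlim x at_top sequentially" unfolding x_def
    by (rule filterlim_compose[OF filterlim_real_sequentially filterlim_Suc])
  have "(\<lambda>n. (x n + 1 + num_shift k) / (x n + num_shift k)) \<longlonglongrightarrow> 1" if k: "k \<in> {1..card I}" for k
  proof -
    have xk: "filterlim (\<lambda>n. x n + num_shift k) at_top sequentially"
      by (rule filterlim_tendsto_add_at_top_iff[THEN iffD2, OF tendsto_const x, of "num_shift k", unfolded add.commute[of "num_shift k"]])
    have "(\<lambda>n. 1 + 1 / (x n + num_shift k)) \<longlonglongrightarrow> 1 + 0"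
      by (intro tendsto_intros tendsto_divide_0[OF tendsto_const] filterlim_at_top_imp_at_infinity[OF xk])
    moreover have "1 + 1 / (x n + num_shift k) = (x n + 1 + num_shift k) / (x n + num_shift k)" for n
      using num_shift_nonneg[OF k] unfolding x_def by (simp add: field_simps)
    ultimately show ?thesis by simp
  qed
  then have "(\<lambda>n. \<Prod>k=1..card I. (x n + 1 + num_shift k) / (x n + num_shift k)) \<longlonglongrightarrow> (\<Prod>k=1..card I. 1)"
    by (intro tendsto_prod)
  then show "(\<lambda>n. (\<Prod>k=1..card I. real (Suc (Suc n)) + num_shift k) / (\<Prod>k=1..card I. real (Suc n) + num_shift k)) \<longlonglongrightarrow> 1"
    by (simp add: prod_dividef x_def add_ac)
qed

text \<open>Analytic continuation of the real formula.\<close>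
lemma selberg_formula:
  assumes a0: "0 < a0" "0 < selberg_real a0" and c01: "c = 0 \<or> c = 1" and z: "0 < Re z"
  shows "selberg \<beta> I z * denom_complex z * (\<Prod>k=1..card I. Gamma (complex_of_real (a0 + num_shift k))) =
     of_real (selberg_real a0) * denom_complex (of_real a0) * (\<Prod>k=1..card I. Gamma (z + of_real (num_shift k)))"
proof (rule right_half_plane_identity[OF _ _ _ z])
  have nI: "w + of_real s \<notin> \<int>\<^sub>\<le>\<^sub>0" if "0 < Re w" "0 \<le> s" for w :: complex and s
    using that by (intro Re_pos_not_nonpos_Ints) simp
  have hcdd: "denom_complex holomorphic_on {z. 0 < Re z}"
  proof (cases "c = 0")
    case True then show ?thesis unfolding denom_complex_def[abs_def] by (auto intro!: holomorphic_intros)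
  next
    case False
    have "w + of_real (den_shift k) \<notin> \<int>\<^sub>\<le>\<^sub>0" if "w \<in> {z. 0 < Re z}" "k \<in> {1..card I}" for w :: complex and k
      using that den_shift_pos[OF that(2)] by (intro nI) auto
    then show ?thesis unfolding denom_complex_def[abs_def] if_not_P[OF False]
      by (intro holomorphic_intros)
  qed
  show "(\<lambda>z. selberg \<beta> I z * denom_complex z * (\<Prod>k=1..card I. Gamma (complex_of_real (a0 + num_shift k)))) holomorphic_on {z. 0 < Re z}"
    by (intro holomorphic_intros selberg_holomorphic hcdd)
  show "(\<lambda>z. of_real (selberg_real a0) * denom_complex (of_real a0) * (\<Prod>k=1..card I. Gamma (z + of_real (num_shift k)))) holomorphic_on {z. 0 < Re z}"
  proof -
    have "w + of_real (num_shift k) \<notin> \<int>\<^sub>\<le>\<^sub>0" if "w \<in> {z. 0 < Re z}" "k \<in> {1..card I}" for w :: complex and k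
      using that num_shift_nonneg[OF that(2)] by (intro nI) auto
    then show ?thesis by (intro holomorphic_intros)
  qed
  fix x :: real assume x: "0 < x"
  have denom_complex_real: "denom_complex (of_real y) = of_real (denom y)" for y
    unfolding denom_complex_def denom_def exp_of_real_mult by (simp add: Gamma_complex_of_real flip: of_real_add)
  have "complex_of_real (selberg_real x * denom x * (\<Prod>k=1..card I. Gamma (a0 + num_shift k))) =
     complex_of_real (selberg_real a0 * denom a0 * (\<Prod>k=1..card I. Gamma (x + num_shift k)))"
    using selberg_real_formula[OF a0 c01 x] by simp
  then show "selberg \<beta> I (of_real x) * denom_complex (of_real x) * (\<Prod>k=1..card I. Gamma (complex_of_real (a0 + num_shift k))) =
     of_real (selberg_real a0) * denom_complex (of_real a0) * (\<Prod>k=1..card I. Gamma (of_real x + of_real (num_shift k)))"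
    unfolding selberg_of_real denom_complex_real by (simp add: Gamma_complex_of_real flip: of_real_add)
qed

end

end

section \<open>The Laguerre and Jacobi weights\<close>

definition laguerre_base :: "real \<Rightarrow> real" where
  "laguerre_base x = (if 0 < x then exp (- x / 2) else 0)"

definition jacobi_base :: "real \<Rightarrow> real \<Rightarrow> real" where
  "jacobi_base b x = (if 0 < x \<and> x < 1 then (1 - x) powr (b - 1) else 0)"

text \<open>Follows from \<open>(1 + y / p) ^ p \<le> exp y\<close> at \<open>y = x / 4\<close>.\<close>
lemma power_le_exp:
  shows "\<exists>K\<ge>0::real. \<forall>x\<ge>0. (1 + x) ^ p \<le> K * exp (x / 4)"
proof (cases "p = 0")
  case True
  then show ?thesis by (intro exI[of _ 1]) auto
next
  case False
  have "(1 + x) ^ p \<le> (4 * real p) ^ p * exp (x / 4)" if x: "0 \<le> x" for x :: real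
  proof -
    have "1 + x \<le> 4 * real p * (1 + (x / 4) / real p)"
      using False x by (simp add: field_simps) 
    then have "(1 + x) ^ p \<le> (4 * real p * (1 + (x / 4) / real p)) ^ p"
      using x by (intro power_mono) auto
    also have "\<dots> = (4 * real p) ^ p * (1 + (x / 4) / real p) ^ p" by (rule power_mult_distrib)
    also have "\<dots> \<le> (4 * real p) ^ p * exp (x / 4)"
      using False x by (intro mult_left_mono exp_ge_one_plus_x_over_n_power_n) auto
    finally show ?thesis .
  qed
  then show ?thesis by (intro exI[of _ "(4 * real p) ^ p"]) auto
qed

lemma laguerre_pearson: "pearson_weight \<infinity> 0 (1/2) laguerre_base"
proof
  show "laguerre_base \<in> borel_measurable borel" unfolding laguerre_base_def[abs_def] by measurable
  fix x :: real assume x: "0 < x"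
  have ev: "eventually (\<lambda>y. y \<in> {0<..}) (nhds x)" using x by (intro eventually_nhds_in_open) auto
  have "isCont (\<lambda>x::real. exp (- x / 2)) x" by (intro continuous_intros) auto
  moreover have "eventually (\<lambda>y. laguerre_base y = exp (- y / 2)) (nhds x)"
    using ev by eventually_elim (auto simp: laguerre_base_def)
  ultimately show "isCont laguerre_base x" by (subst isCont_cong)
  have "((\<lambda>x::real. exp (- x / 2)) has_real_derivative - (1/2) * exp (- x / 2)) (at x)"
    by (auto intro!: derivative_eq_intros)
  moreover have "eventually (\<lambda>y. (1 - 0 * y) * laguerre_base y = exp (- y / 2)) (nhds x)"
    using ev by eventually_elim (auto simp: laguerre_base_def)
  ultimately show "((\<lambda>x. (1 - 0 * x) * laguerre_base x) has_real_derivative - (1/2) * laguerre_base x) (at x)"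
    using x by (subst DERIV_cong_ev[OF refl _ refl]) (auto simp: laguerre_base_def)
next
  fix a :: real and p :: nat assume a: "0 < a"
  obtain K where K: "0 \<le> K" "\<And>x::real. 0 \<le> x \<Longrightarrow> (1 + x) ^ p \<le> K * exp (x / 4)" using power_le_exp[of p] by auto
  have "(\<lambda>t. complex_of_real t powr (complex_of_real a - 1) / of_real (exp ((1/4) * t))) absolutely_integrable_on {0<..}"
    by (rule absolutely_integrable_Gamma_integral) (use a in auto)
  then have "integrable lebesgue (\<lambda>t. norm (indicat_real {0<..} t *\<^sub>R (complex_of_real t powr (complex_of_real a - 1) / of_real (exp ((1/4) * t)))))"
    unfolding set_integrable_def by (rule integrable_norm)
  moreover have "norm (indicat_real {0<..} t *\<^sub>R (complex_of_real t powr (complex_of_real a - 1) / of_real (exp ((1/4) * t)))) =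
      indicator {0<..} t *\<^sub>R (t powr (a - 1) * exp (- t / 4))" for t
    by (cases "0 < t") (simp_all add: norm_divide norm_powr_real_powr exp_minus field_simps)
  ultimately have "integrable lebesgue (\<lambda>t. indicator {0<..} t *\<^sub>R (t powr (a - 1) * exp (- t / 4)))"
    by (simp only:)
  then have 1: "integrable lborel (\<lambda>t. indicator {0<..} t *\<^sub>R (t powr (a - 1) * exp (- t / 4)))"
    by (subst (asm) integrable_completion) measurable
  show "integrable lborel (\<lambda>x. (1 + \<bar>x\<bar>) ^ p * (x powr (a - 1) * laguerre_base x))"
  proof (rule Bochner_Integration.integrable_bound)
    show "integrable lborel (\<lambda>t. K * (indicator {0<..} t *\<^sub>R (t powr (a - 1) * exp (- t / 4))))"
      by (rule integrable_mult_right[OF 1])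
    show "AE x in lborel. norm ((1 + \<bar>x\<bar>) ^ p * (x powr (a - 1) * laguerre_base x)) \<le>
        norm (K * (indicator {0<..} x *\<^sub>R (x powr (a - 1) * exp (- x / 4))))"
    proof (rule AE_I2)
      fix x :: real
      show "norm ((1 + \<bar>x\<bar>) ^ p * (x powr (a - 1) * laguerre_base x)) \<le>
        norm (K * (indicator {0<..} x *\<^sub>R (x powr (a - 1) * exp (- x / 4))))"
      proof (cases "0 < x")
        case True
        have "(1 + x) ^ p * (x powr (a - 1) * exp (- x / 2)) \<le> (K * exp (x / 4)) * (x powr (a - 1) * exp (- x / 2))"
          using True K(2)[of x] by (intro mult_right_mono) auto
        also have "\<dots> = K * (x powr (a - 1) * exp (- x / 4))"
          by (simp add: exp_add[symmetric] mult_ac) 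
        finally show ?thesis using True K(1) by (simp add: laguerre_base_def abs_mult)
      qed (simp add: laguerre_base_def)
    qed
  qed (auto simp: laguerre_base_def[abs_def])
next
  have "((\<lambda>x::real. exp (- x / 2)) \<longlongrightarrow> exp (- 0 / 2)) (at_right 0)" by (intro tendsto_intros) auto
  moreover have "eventually (\<lambda>x. exp (- x / 2) = laguerre_base x) (at_right 0)"
    by (auto simp: eventually_at_filter laguerre_base_def)
  ultimately show "\<exists>l. (laguerre_base \<longlongrightarrow> l) (at_right 0)" using Lim_transform_eventually by blast
next
  fix p :: nat
  obtain K where K: "0 \<le> K" "\<And>x::real. 0 \<le> x \<Longrightarrow> (1 + x) ^ p \<le> K * exp (x / 4)" using power_le_exp[of p] by auto
  have "((\<lambda>x. (1 + \<bar>x\<bar>) ^ p * ((1 - 0 * x) * laguerre_base x)) \<longlongrightarrow> 0) at_top"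
  proof (rule tendsto_sandwich)
    show "eventually (\<lambda>x. 0 \<le> (1 + \<bar>x\<bar>) ^ p * ((1 - 0 * x) * laguerre_base x)) at_top"
      by (simp add: laguerre_base_def)
    show "eventually (\<lambda>x. (1 + \<bar>x\<bar>) ^ p * ((1 - 0 * x) * laguerre_base x) \<le> K * exp (- x / 4)) at_top"
      using eventually_gt_at_top[of 0]
    proof eventually_elim
      case (elim x)
      have "(1 + x) ^ p * exp (- x / 2) \<le> (K * exp (x / 4)) * exp (- x / 2)"
        using elim K(2)[of x] by (intro mult_right_mono) auto
      also have "\<dots> = K * exp (- x / 4)" by (simp add: exp_add[symmetric] mult_ac)
      finally show ?case using elim by (simp add: laguerre_base_def)
    qed
    show "((\<lambda>x::real. K * exp (- x / 4)) \<longlongrightarrow> 0) at_top" by real_asymp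
  qed simp
  then show "(((\<lambda>x. (1 + \<bar>x\<bar>) ^ p * ((1 - 0 * x) * laguerre_base x)) \<circ> real_of_ereal) \<longlongrightarrow> 0) (at_left \<infinity>)"
    by (simp add: ereal_tendsto_simps)
qed (auto simp: laguerre_base_def)

lemma jacobi_pearson: assumes b: "0 < b" shows "pearson_weight 1 1 b (jacobi_base b)"
proof
  show "jacobi_base b \<in> borel_measurable borel" unfolding jacobi_base_def[abs_def] by measurable
  fix x :: real assume "0 < x" "ereal x < 1"
  then have x: "0 < x" "x < 1" by (auto simp: one_ereal_def)
  have ev: "eventually (\<lambda>y. y \<in> {0<..<1}) (nhds x)" using x by (intro eventually_nhds_in_open) auto
  have "isCont (\<lambda>x::real. (1 - x) powr (b - 1)) x" using x by (intro continuous_intros) auto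
  moreover have "eventually (\<lambda>y. jacobi_base b y = (1 - y) powr (b - 1)) (nhds x)"
    using ev by eventually_elim (auto simp: jacobi_base_def)
  ultimately show "isCont (jacobi_base b) x" by (subst isCont_cong)
  have "((\<lambda>x::real. (1 - x) powr b) has_real_derivative - b * (1 - x) powr (b - 1)) (at x)"
    using x by (auto intro!: derivative_eq_intros simp: powr_diff)
  moreover have "eventually (\<lambda>y. (1 - 1 * y) * jacobi_base b y = (1 - y) powr b) (nhds x)"
    using ev by eventually_elim (auto simp: jacobi_base_def powr_diff)
  ultimately show "((\<lambda>x. (1 - 1 * x) * jacobi_base b x) has_real_derivative - b * jacobi_base b x) (at x)"
    using x by (subst DERIV_cong_ev[OF refl _ refl]) (auto simp: jacobi_base_def)
next
  fix a :: real and p :: nat assume a: "0 < a"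
  have 1: "integrable lborel (\<lambda>t. indicator {0..1} t *\<^sub>R (t powr (a - 1) * (1 - t) powr (b - 1)))"
    using integrable_Beta[OF a b] by (simp add: set_integrable_def)
  show "integrable lborel (\<lambda>x. (1 + \<bar>x\<bar>) ^ p * (x powr (a - 1) * jacobi_base b x))"
  proof (rule Bochner_Integration.integrable_bound)
    show "integrable lborel (\<lambda>t. 2 ^ p * (indicator {0..1} t *\<^sub>R (t powr (a - 1) * (1 - t) powr (b - 1))))"
      by (rule integrable_mult_right[OF 1])
    show "AE x in lborel. norm ((1 + \<bar>x\<bar>) ^ p * (x powr (a - 1) * jacobi_base b x)) \<le>
        norm (2 ^ p * (indicator {0..1} x *\<^sub>R (x powr (a - 1) * (1 - x) powr (b - 1))))"
    proof (rule AE_I2)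
      fix x :: real
      show "norm ((1 + \<bar>x\<bar>) ^ p * (x powr (a - 1) * jacobi_base b x)) \<le>
        norm (2 ^ p * (indicator {0..1} x *\<^sub>R (x powr (a - 1) * (1 - x) powr (b - 1))))"
      proof (cases "0 < x \<and> x < 1")
        case True
        then have "(1 + \<bar>x\<bar>) ^ p \<le> 2 ^ p" by (intro power_mono) auto
        then show ?thesis using True by (simp add: jacobi_base_def abs_mult mult_right_mono)
      qed (auto simp: jacobi_base_def)
    qed
  qed (auto simp: jacobi_base_def[abs_def])
next
  have "((\<lambda>x::real. (1 - x) powr (b - 1)) \<longlongrightarrow> (1 - 0) powr (b - 1)) (at_right 0)" by (intro tendsto_intros) auto
  moreover have "eventually (\<lambda>x. (1 - x) powr (b - 1) = jacobi_base b x) (at_right 0)"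
    by (rule eventually_mono[OF eventually_at_right_real[of 0 1]]) (auto simp: jacobi_base_def)
  ultimately show "\<exists>l. (jacobi_base b \<longlongrightarrow> l) (at_right 0)" using Lim_transform_eventually by blast
next
  fix p :: nat
  have "((\<lambda>x::real. (1 + x) ^ p * (1 - x) powr b) \<longlongrightarrow> (1 + 1) ^ p * 0) (at_left 1)"
  proof (intro tendsto_intros)
    show "((\<lambda>x::real. (1 - x) powr b) \<longlongrightarrow> 0) (at_left 1)"
    proof -
      have "((\<lambda>x::real. (1 - x) powr b) \<longlongrightarrow> (1 - 1) powr b) (at_left 1)"
        using b by (intro tendsto_powr' tendsto_intros) (auto simp: eventually_at_filter)
      then show ?thesis by simp
    qed
  qed
  moreover have "eventually (\<lambda>x. (1 + x) ^ p * (1 - x) powr b = (1 + \<bar>x\<bar>) ^ p * ((1 - 1 * x) * jacobi_base b x)) (at_left 1)"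
    by (rule eventually_mono[OF eventually_at_left_real[of 0 1]]) (auto simp: jacobi_base_def powr_diff)
  ultimately have "((\<lambda>x. (1 + \<bar>x\<bar>) ^ p * ((1 - 1 * x) * jacobi_base b x)) \<longlongrightarrow> 0) (at_left 1)"
    using Lim_transform_eventually by simp
  then show "(((\<lambda>x. (1 + \<bar>x\<bar>) ^ p * ((1 - 1 * x) * jacobi_base b x)) \<circ> real_of_ereal) \<longlongrightarrow> 0) (at_left 1)"
    by (simp add: one_ereal_def ereal_tendsto_simps)
qed (use b in \<open>auto simp: jacobi_base_def one_ereal_def\<close>)

text \<open>Identifies the product in the densities, over pairs \<open>j < k\<close>, with the symmetric form used above.\<close>
lemma vandermonde_abs_prod:
  "(\<Prod>k=1..n. \<Prod>j=1..<k. \<bar>x k - x j\<bar> powr \<beta>) = vandermonde \<beta> 0 {1..n} x"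
proof (induction n)
  case (Suc n)
  have "{1..Suc n} - {Suc n} = {1..n}" by auto
  then have "vandermonde \<beta> 0 {1..Suc n} x = vandermonde \<beta> 0 {1..n} x * (\<Prod>j\<in>{1..n}. ((x (Suc n) - x j)\<^sup>2 + 0) powr (\<beta> / 2))"
    using vandermonde_split[of "{1..Suc n}" "Suc n" 0 \<beta> x] by simp
  also have "(\<Prod>j\<in>{1..n}. ((x (Suc n) - x j)\<^sup>2 + 0) powr (\<beta> / 2)) = (\<Prod>j=1..<Suc n. \<bar>x (Suc n) - x j\<bar> powr \<beta>)"
  proof (rule prod.cong)
    fix j
    have "((x (Suc n) - x j)\<^sup>2) powr (\<beta> / 2) = (\<bar>x (Suc n) - x j\<bar> powr 2) powr (\<beta> / 2)" by simp
    also have "\<dots> = \<bar>x (Suc n) - x j\<bar> powr \<beta>" unfolding powr_powr by simp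
    finally show "((x (Suc n) - x j)\<^sup>2 + 0) powr (\<beta> / 2) = \<bar>x (Suc n) - x j\<bar> powr \<beta>" by simp
  qed auto
  finally show ?case using Suc by simp
qed (simp add: vandermonde_def)

text \<open>With \<open>g = \<beta> / 2\<close> all three moment generating functions are built from this product.\<close>
definition gamma_product :: "real \<Rightarrow> nat \<Rightarrow> complex \<Rightarrow> complex" where
  "gamma_product g n z = (\<Prod>k=1..n. Gamma (of_real (g * real k) + z) / Gamma (of_real (g * real k)))"

context pearson_weight
begin

lemma weight_product_eq_0: "finite I \<Longrightarrow> i \<in> I \<Longrightarrow> \<not> (0 < x i \<and> ereal (x i) < R) \<Longrightarrow> weight_product a I x = 0"
  unfolding weight_product_def using v_outside by (intro prod_zero) auto

text \<open>The normalising constant of the density is the inverse of the Selberg integral at the base point, so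
the moments of the determinant are quotients of Selberg integrals.\<close>
lemma ensemble_mellin:
  fixes lam :: "nat \<Rightarrow> 'b \<Rightarrow> real"
  assumes \<beta>: "0 < \<beta>" and I: "finite I" and a0: "0 < a0" and c01: "c = 0 \<or> c = 1"
    and P: "prob_space M"
    and D: "distributed M (\<Pi>\<^sub>M k\<in>I. lborel) (\<lambda>\<omega>. \<lambda>k\<in>I. lam k \<omega>) (\<lambda>x. ennreal (C * (vandermonde \<beta> 0 I x * weight_product a0 I x)))"
    and C: "0 < C" and z: "- a0 < Re z"
  shows "integrable M (\<lambda>\<omega>. exp (z * complex_of_real (ln (\<Prod>k\<in>I. lam k \<omega>))))" (is ?A)
    and "(LINT \<omega>|M. exp (z * complex_of_real (ln (\<Prod>k\<in>I. lam k \<omega>)))) * denom_complex \<beta> I (of_real a0 + z) *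
        (\<Prod>k=1..card I. Gamma (complex_of_real (a0 + num_shift \<beta> I k))) =
        denom_complex \<beta> I (of_real a0) * (\<Prod>k=1..card I. Gamma (complex_of_real (a0 + num_shift \<beta> I k) + z))" (is ?B)
proof -
  interpret prob_space M by fact
  let ?N = "\<Pi>\<^sub>M k\<in>I. (lborel :: real measure)"
  let ?X = "\<lambda>\<omega>. \<lambda>k\<in>I. lam k \<omega>"
  let ?f = "\<lambda>x. C * (vandermonde \<beta> 0 I x * weight_product a0 I x)"
  define w where "w = of_real a0 + z"
  have w: "0 < Re w" using z by (simp add: w_def)
  define G where "G = (\<lambda>u (x::nat\<Rightarrow>real). exp (u * complex_of_real (ln (\<Prod>k\<in>I. x k))))"
  have [measurable]: "G u \<in> borel_measurable ?N" for u unfolding G_def by measurable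
  have [measurable]: "vandermonde \<beta> 0 I \<in> borel_measurable ?N" by (rule vandermonde_meas)
  have X [measurable]: "?X \<in> measurable M ?N" using D by (simp add: distributed_def)
  have dens: "distr M ?N ?X = density ?N (\<lambda>x. ennreal (?f x))" using D by (simp add: distributed_def)
  have f_nonneg: "0 \<le> ?f x" for x using C vandermonde_nonneg weight_product_nonneg by simp
  have f_meas: "?f \<in> borel_measurable ?N" by measurable
  have GX: "G u (?X \<omega>) = exp (u * complex_of_real (ln (\<Prod>k\<in>I. lam k \<omega>)))" for u \<omega>
    unfolding G_def by simp
  have fG: "?f x *\<^sub>R G u x = of_real C * (exp ((of_real a0 + u) * complex_of_real (logprod I x)) * complex_of_real (baseweight \<beta> I x))"
    for u x
  proof (cases "\<forall>i\<in>I. 0 < x i")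
    case True
    then have "ln (\<Prod>k\<in>I. x k) = logprod I x" unfolding logprod_def by (intro ln_prod) (use I in simp, metis less_irrefl)
    then show ?thesis unfolding G_def weight_product_eq_exp[OF I, of a0] baseweight_def
      by (simp add: scaleR_conv_of_real distrib_right exp_add exp_of_real_mult[symmetric] mult_ac)
  next
    case False
    then have "weight_product a I x = 0" for a using weight_product_eq_0[OF I] by blast
    then show ?thesis by (simp add: baseweight_def)
  qed
  have E: "(LINT \<omega>|M. exp (u * complex_of_real (ln (\<Prod>k\<in>I. lam k \<omega>)))) = of_real C * selberg \<beta> I (of_real a0 + u)" for u
  proof -
    have "(LINT \<omega>|M. exp (u * complex_of_real (ln (\<Prod>k\<in>I. lam k \<omega>)))) = (LINT x|distr M ?N ?X. G u x)"
      unfolding GX[symmetric] by (rule integral_distr[symmetric]) measurable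
    also have "\<dots> = (LINT x|?N. ?f x *\<^sub>R G u x)"
      unfolding dens using f_nonneg f_meas by (intro integral_density) auto
    also have "\<dots> = of_real C * selberg \<beta> I (of_real a0 + u)"
      unfolding fG selberg_def by simp
    finally show ?thesis .
  qed
  have "integrable ?N (\<lambda>x. ?f x *\<^sub>R G z x)"
    unfolding fG w_def[symmetric]
    by (intro integrable_mult_right laplace_integrable_complex selberg_real_integrable \<beta> I w) measurable
  then have "integrable (distr M ?N ?X) (G z)"
    unfolding dens using f_nonneg f_meas by (subst integrable_density) auto
  then have "integrable M (\<lambda>\<omega>. G z (?X \<omega>))"
    by (rule integrable_distr[OF X])
  then show ?A unfolding GX .
  have "complex_of_real (C * selberg_real \<beta> I a0) = 1"
    using E[of 0] selberg_of_real[OF \<beta> I, of a0] by (simp add: prob_space)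
  then have Crsel: "C * selberg_real \<beta> I a0 = 1" by (simp only: of_real_eq_1_iff)
  then have pos: "0 < selberg_real \<beta> I a0" using C by (metis zero_less_mult_pos zero_less_one)
  have "of_real C * (selberg \<beta> I w * denom_complex \<beta> I w * (\<Prod>k=1..card I. Gamma (complex_of_real (a0 + num_shift \<beta> I k)))) =
     of_real C * (of_real (selberg_real \<beta> I a0) * denom_complex \<beta> I (of_real a0) * (\<Prod>k=1..card I. Gamma (w + of_real (num_shift \<beta> I k))))"
    using selberg_formula[OF \<beta> I a0 pos c01 w] by simp
  also have "\<dots> = of_real (C * selberg_real \<beta> I a0) * denom_complex \<beta> I (of_real a0) * (\<Prod>k=1..card I. Gamma (w + of_real (num_shift \<beta> I k)))"
    by simp
  also have "\<dots> = denom_complex \<beta> I (of_real a0) * (\<Prod>k=1..card I. Gamma (complex_of_real (a0 + num_shift \<beta> I k) + z))"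
    unfolding Crsel w_def by (simp add: add_ac)
  finally show ?B unfolding E w_def by (simp add: mult_ac)
qed

end

section \<open>Complex moments of the determinants\<close>

lemma prod_reverse:
  fixes f :: "real \<Rightarrow> 'b::comm_monoid_mult"
  shows "(\<Prod>k=1..n. f (real n - real k + 1)) = (\<Prod>k=1..n. f (real k))"
  by (rule prod.reindex_bij_witness[of _ "\<lambda>k. n + 1 - k" "\<lambda>k. n + 1 - k"]) (auto simp: of_nat_diff algebra_simps)

lemma Gamma_Re_pos_nonzero: "0 < Re z \<Longrightarrow> Gamma (z :: complex) \<noteq> 0"
  using Re_pos_not_nonpos_Ints[of z] by (simp add: Gamma_eq_zero_iff)

lemma gamma_product_eq: "gamma_product g n z = (\<Prod>k=1..n. Gamma (of_real (g * real k) + z)) / (\<Prod>k=1..n. Gamma (of_real (g * real k)))"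
  unfolding gamma_product_def by (rule prod_dividef)

lemma Gamma_prod_nonzero:
  assumes "0 < g" "- g < Re z" shows "(\<Prod>k=1..n. Gamma (of_real (g * real k) + z)) \<noteq> 0"
proof -
  have "0 < Re (of_real (g * real k) + z)" if "k \<in> {1..n}" for k
  proof -
    have "g * 1 \<le> g * real k" using that assms(1) by (intro mult_left_mono) auto
    then show ?thesis using assms(2) by simp
  qed
  then show ?thesis using Gamma_Re_pos_nonzero by simp
qed

lemma laguerre_mellin:
  assumes \<beta>: "0 < \<beta>" and ens: "laguerre_ensemble \<beta> n M lam" and z: "- \<beta> / 2 < Re z"
  shows "integrable M (\<lambda>\<omega>. exp (z * complex_of_real (ln (\<Prod>k=1..n. lam k \<omega>))))"
    and "(LINT \<omega>|M. exp (z * complex_of_real (ln (\<Prod>k=1..n. lam k \<omega>)))) =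
           exp (z * of_real (real n * ln 2)) * gamma_product (\<beta>/2) n z"
proof -
  interpret L: pearson_weight \<infinity> 0 "1/2" laguerre_base by (rule laguerre_pearson)
  obtain C where C: "0 < C" and P: "prob_space M"
    and D: "distributed M (\<Pi>\<^sub>M k\<in>{1..n}. lborel) (\<lambda>\<omega>. \<lambda>k\<in>{1..n}. lam k \<omega>) (\<lambda>x. ennreal (C * laguerre_weight \<beta> n x))"
    using ens unfolding laguerre_ensemble_def has_density_proportional_to_def by blast
  have wt: "laguerre_weight \<beta> n x = vandermonde \<beta> 0 {1..n} x * L.weight_product (\<beta>/2) {1..n} x" for x
  proof (cases "\<forall>k\<in>{1..n}. 0 < x k")
    case True
    then have "L.weight_product (\<beta>/2) {1..n} x = (\<Prod>k=1..n. x k powr (\<beta>/2 - 1) * exp (- x k / 2))"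
      unfolding L.weight_product_def by (intro prod.cong) (auto simp: laguerre_base_def)
    then show ?thesis unfolding laguerre_weight_def vandermonde_abs_prod using True by simp
  next
    case False
    then obtain k where k: "k \<in> {1..n}" "\<not> 0 < x k" by blast
    have "L.weight_product (\<beta>/2) {1..n} x = 0" using k(2) by (intro L.weight_product_eq_0[OF _ k(1)]) auto
    then show ?thesis using False unfolding laguerre_weight_def by (simp only: if_False mult_zero_right)
  qed
  have z': "- (\<beta>/2) < Re z" using z by simp
  have g: "0 < \<beta>/2" using \<beta> by simp
  note D' = D[unfolded wt]
  note em = L.ensemble_mellin[OF \<beta> finite_atLeastAtMost g disjI1[OF refl] P D' C z']
  show "integrable M (\<lambda>\<omega>. exp (z * complex_of_real (ln (\<Prod>k=1..n. lam k \<omega>))))" by (rule em(1))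
  let ?E = "LINT \<omega>|M. exp (z * complex_of_real (ln (\<Prod>k=1..n. lam k \<omega>)))"
  define A where "A = (\<Prod>k=1..n. Gamma (complex_of_real (\<beta>/2 * real k)))"
  define B where "B = (\<Prod>k=1..n. Gamma (complex_of_real (\<beta>/2 * real k) + z))"
  have num_shift: "\<beta>/2 + L.num_shift \<beta> {1..n} k = \<beta>/2 * (real n - real k + 1)" for k
    unfolding L.num_shift_def[OF \<beta> finite_atLeastAtMost] by (simp add: field_simps)
  have denom_complex: "L.denom_complex \<beta> {1..n} u = exp (u * of_real (real n * ln (1/2)))" for u
    unfolding L.denom_complex_def[OF \<beta> finite_atLeastAtMost] by simp
  have "?E * exp ((of_real (\<beta>/2) + z) * of_real (real n * ln (1/2))) * A =
      exp (of_real (\<beta>/2) * of_real (real n * ln (1/2))) * B"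
    using em(2) unfolding num_shift denom_complex A_def B_def
      prod_reverse[of "\<lambda>t. Gamma (complex_of_real (\<beta>/2 * t))" n, symmetric]
      prod_reverse[of "\<lambda>t. Gamma (complex_of_real (\<beta>/2 * t) + z)" n, symmetric] by simp
  then have "exp (of_real (\<beta>/2) * of_real (real n * ln (1/2))) * (?E * exp (z * of_real (real n * ln (1/2))) * A) =
      exp (of_real (\<beta>/2) * of_real (real n * ln (1/2))) * B"
    unfolding distrib_right exp_add by (simp only: mult_ac)
  then have "?E * exp (z * of_real (real n * ln (1/2))) * A = B" by simp
  then have "?E * exp (- (z * of_real (real n * ln 2))) * A = B" by (simp add: ln_div)
  moreover have "A \<noteq> 0" using Gamma_prod_nonzero[of "\<beta>/2" 0 n] g unfolding A_def by simp
  ultimately have "?E = exp (z * of_real (real n * ln 2)) * (B / A)"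
    by (simp add: exp_minus field_simps)
  then show "?E = exp (z * of_real (real n * ln 2)) * gamma_product (\<beta>/2) n z"
    unfolding gamma_product_eq A_def B_def .
qed

lemma gamma_product_shift:
  assumes g: "0 < g" and z: "- g < Re z"
  shows "gamma_product g (M + m) z = gamma_product g M z * ((\<Prod>k=1..m. Gamma (of_real (g * real (M + k)) + z)) / (\<Prod>k=1..m. Gamma (of_real (g * real (M + k)))))"
proof -
  have split: "(\<Prod>k=1..M+m. f k) = (\<Prod>k=1..M. f k) * (\<Prod>k=1..m. f (M + k))" for f :: "nat \<Rightarrow> complex"
  proof -
    have "(\<Prod>k=1..M+m. f k) = (\<Prod>k=1..M. f k) * (\<Prod>k=M+1..M+m. f k)"
      by (rule prod.ub_add_nat) simp
    also have "(\<Prod>k=M+1..M+m. f k) = (\<Prod>k=1..m. f (M + k))"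
      by (rule prod.reindex_bij_witness[of _ "\<lambda>k. M + k" "\<lambda>k. k - M"]) auto
    finally show ?thesis .
  qed
  show ?thesis unfolding gamma_product_eq split by simp
qed

lemma gamma_product_nonzero: "0 < g \<Longrightarrow> - g < Re z \<Longrightarrow> gamma_product g n z \<noteq> 0"
  unfolding gamma_product_eq using Gamma_prod_nonzero[of g z n] Gamma_prod_nonzero[of g 0 n] by simp

text \<open>Selberg's formula gives a quotient with indices \<open>1, \<dots>, m\<close> and \<open>M + 1, \<dots>, M + m\<close>, where \<open>m\<close> and \<open>M\<close> are the
minimum and the maximum of the dimensions; in terms of \<open>gamma_product\<close> it is symmetric in \<open>n1\<close> and \<open>n2\<close>.\<close>
lemma jacobi_mellin:
  assumes \<beta>: "0 < \<beta>" and ens: "jacobi_ensemble \<beta> n1 n2 P lam" and z: "- \<beta> / 2 < Re z"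
  shows "integrable P (\<lambda>\<omega>. exp (z * complex_of_real (ln (\<Prod>k=1..min n1 n2. lam k \<omega>))))"
    and "(LINT \<omega>|P. exp (z * complex_of_real (ln (\<Prod>k=1..min n1 n2. lam k \<omega>)))) =
           gamma_product (\<beta>/2) n1 z * gamma_product (\<beta>/2) n2 z / gamma_product (\<beta>/2) (n1 + n2) z"
proof -
  define m where "m = min n1 n2"
  define M where "M = max n1 n2"
  define b where "b = \<beta>/2 * (real M - real m + 1)"
  have mM: "m \<le> M" by (simp add: m_def M_def)
  have g: "0 < \<beta>/2" using \<beta> by simp
  have b: "0 < b" unfolding b_def using mM g by (intro mult_pos_pos) auto
  interpret J: pearson_weight 1 1 b "jacobi_base b" by (rule jacobi_pearson[OF b])
  obtain C where C: "0 < C" and P: "prob_space P"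
    and D: "distributed P (\<Pi>\<^sub>M k\<in>{1..m}. lborel) (\<lambda>\<omega>. \<lambda>k\<in>{1..m}. lam k \<omega>) (\<lambda>x. ennreal (C * jacobi_weight \<beta> n1 n2 x))"
    using ens unfolding jacobi_ensemble_def has_density_proportional_to_def m_def by blast
  have wt: "jacobi_weight \<beta> n1 n2 x = vandermonde \<beta> 0 {1..m} x * J.weight_product (\<beta>/2) {1..m} x" for x
  proof (cases "\<forall>k\<in>{1..m}. 0 < x k \<and> x k < 1")
    case True
    then have "J.weight_product (\<beta>/2) {1..m} x = (\<Prod>k=1..m. x k powr (\<beta>/2 - 1) * (1 - x k) powr (\<beta>/2 * (real M - real m + 1) - 1))"
      unfolding J.weight_product_def by (intro prod.cong) (auto simp: jacobi_base_def b_def)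
    then show ?thesis using True unfolding jacobi_weight_def Let_def vandermonde_abs_prod m_def M_def by simp
  next
    case False
    then have "J.weight_product (\<beta>/2) {1..m} x = 0" using J.weight_product_eq_0[of "{1..m}"] by (fastforce simp: one_ereal_def)
    moreover have "jacobi_weight \<beta> n1 n2 x = 0"
      using False unfolding jacobi_weight_def Let_def m_def by (rule if_not_P)
    ultimately show ?thesis by simp
  qed
  have z': "- (\<beta>/2) < Re z" using z by simp
  note D' = D[unfolded wt]
  note em = J.ensemble_mellin[OF \<beta> finite_atLeastAtMost g disjI2[OF refl] P D' C z']
  show "integrable P (\<lambda>\<omega>. exp (z * complex_of_real (ln (\<Prod>k=1..min n1 n2. lam k \<omega>))))"
    using em(1) unfolding m_def .
  let ?E = "LINT \<omega>|P. exp (z * complex_of_real (ln (\<Prod>k=1..m. lam k \<omega>)))"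
  have num_shift: "\<beta>/2 + J.num_shift \<beta> {1..m} k = \<beta>/2 * (real m - real k + 1)" for k
    unfolding J.num_shift_def[OF \<beta> finite_atLeastAtMost] by (simp add: field_simps)
  have den_shift: "\<beta>/2 + J.den_shift \<beta> {1..m} k = \<beta>/2 * (real M + (real m - real k + 1))" for k
    proof -
    have "g + (g * (M' - m' + 1) + g * (m' - 1 + (m' - t))) = g * (M' + (m' - t + 1))" for g M' m' t :: real
      by (simp add: algebra_simps)
    from this[of "\<beta>/2" "real M" "real m" "real k"] show ?thesis
      unfolding J.den_shift_def[OF \<beta> finite_atLeastAtMost] b_def[symmetric] by simp
  qed
  have denom_complex: "J.denom_complex \<beta> {1..m} (of_real (\<beta>/2) + u) = (\<Prod>k=1..m. Gamma (of_real (\<beta>/2 * real (M + k)) + u))" for u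
  proof -
    have "J.denom_complex \<beta> {1..m} (of_real (\<beta>/2) + u) = (\<Prod>k=1..m. Gamma (of_real (\<beta>/2 + J.den_shift \<beta> {1..m} k) + u))"
      unfolding J.denom_complex_def[OF \<beta> finite_atLeastAtMost] by (simp add: add_ac)
    then show ?thesis unfolding den_shift
      using prod_reverse[of "\<lambda>t. Gamma (complex_of_real (\<beta>/2 * (real M + t)) + u)" m] by simp
  qed
  define A where "A = (\<Prod>k=1..m. Gamma (complex_of_real (\<beta>/2 * real k)))"
  define B where "B = (\<Prod>k=1..m. Gamma (complex_of_real (\<beta>/2 * real k) + z))"
  define A' where "A' = (\<Prod>k=1..m. Gamma (complex_of_real (\<beta>/2 * real (M + k))))"
  define B' where "B' = (\<Prod>k=1..m. Gamma (complex_of_real (\<beta>/2 * real (M + k)) + z))"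
  have "?E * B' * A = A' * B"
    using em(2) denom_complex[of z] denom_complex[of 0]
      prod_reverse[of "\<lambda>t. Gamma (complex_of_real (\<beta>/2 * t))" m]
      prod_reverse[of "\<lambda>t. Gamma (complex_of_real (\<beta>/2 * t) + z)" m]
    unfolding num_shift A_def B_def A'_def B'_def by simp
  moreover have A: "A \<noteq> 0" using Gamma_prod_nonzero[of "\<beta>/2" 0 m] g unfolding A_def by simp
  moreover have B': "B' \<noteq> 0" and A': "A' \<noteq> 0"
  proof -
    have "0 < Re (of_real (\<beta>/2 * real (M + k)) + u)" if "k \<in> {1..m}" "- (\<beta>/2) < Re u" for k u
    proof -
      have "\<beta>/2 * 1 \<le> \<beta>/2 * real (M + k)" using that g by (intro mult_left_mono) auto
      then show ?thesis using that(2) by simp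
    qed
    from this[of _ z] this[of _ 0] show "B' \<noteq> 0" "A' \<noteq> 0"
      using Gamma_Re_pos_nonzero z' g unfolding A'_def B'_def by fastforce+
  qed
  ultimately have "?E = (B / A) * (A' / B')" by (simp add: field_simps)
  also have "B / A = gamma_product (\<beta>/2) m z" unfolding gamma_product_eq A_def B_def ..
  also have "A' / B' = gamma_product (\<beta>/2) M z / gamma_product (\<beta>/2) (M + m) z"
    unfolding gamma_product_shift[OF g z'] A'_def[symmetric] B'_def[symmetric]
    using gamma_product_nonzero[OF g z', of M] A' B' by (simp add: field_simps)
  finally have "?E = gamma_product (\<beta>/2) m z * gamma_product (\<beta>/2) M z / gamma_product (\<beta>/2) (M + m) z" by simp
  moreover have "gamma_product (\<beta>/2) m z * gamma_product (\<beta>/2) M z / gamma_product (\<beta>/2) (M + m) z =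
      gamma_product (\<beta>/2) n1 z * gamma_product (\<beta>/2) n2 z / gamma_product (\<beta>/2) (n1 + n2) z"
    unfolding m_def M_def by (cases "n1 \<le> n2") (auto simp: add.commute mult.commute min_def max_def)
  ultimately show "(LINT \<omega>|P. exp (z * complex_of_real (ln (\<Prod>k=1..min n1 n2. lam k \<omega>)))) =
           gamma_product (\<beta>/2) n1 z * gamma_product (\<beta>/2) n2 z / gamma_product (\<beta>/2) (n1 + n2) z"
    unfolding m_def by simp
qed

text \<open>A Beta variable is a Jacobi ensemble with a single eigenvalue.\<close>
lemma beta_mellin:
  assumes a: "0 < a" and b: "0 < b" and Q: "prob_space Q"
    and D: "distributed Q lborel \<rho> (\<lambda>x. ennreal (beta_density a b x))" and z: "- a < Re z"
  shows "integrable Q (\<lambda>\<omega>. exp (z * complex_of_real (ln (\<rho> \<omega>))))"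
    and "(LINT \<omega>|Q. exp (z * complex_of_real (ln (\<rho> \<omega>)))) =
      Gamma (of_real a + z) / Gamma (of_real a) * (Gamma (of_real (a + b)) / Gamma (of_real (a + b) + z))"
    and "AE \<omega> in Q. 0 < \<rho> \<omega>"
proof -
  interpret Q: prob_space Q by fact
  interpret J: pearson_weight 1 1 b "jacobi_base b" by (rule jacobi_pearson[OF b])
  let ?I = "{1::nat}"
  have \<rho>: "\<rho> \<in> measurable Q lborel" using D by (simp add: distributed_def)
  have D': "distributed Q (\<Pi>\<^sub>M k\<in>?I. lborel) (\<lambda>\<omega>. \<lambda>k\<in>?I. \<rho> \<omega>) (\<lambda>x. ennreal (1 / Beta a b * (vandermonde 1 0 ?I x * J.weight_product a ?I x)))"
  proof -
    interpret product_sigma_finite "\<lambda>_::nat. lborel :: real measure"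
      by standard
    let ?N = "\<Pi>\<^sub>M k\<in>?I. (lborel :: real measure)"
    define h where "h = (\<lambda>y::real. \<lambda>k\<in>?I. y)"
    have h [measurable]: "h \<in> measurable lborel ?N" unfolding h_def by (rule measurable_restrict) simp
    have h\<rho>: "(\<lambda>\<omega>. h (\<rho> \<omega>)) \<in> measurable Q ?N" by (rule measurable_compose[OF \<rho> h])
    have dens: "1 / Beta a b * (vandermonde 1 0 ?I x * J.weight_product a ?I x) = beta_density a b (x 1)" for x
      unfolding vandermonde_def J.weight_product_def beta_density_def jacobi_base_def by simp
    have [measurable]: "beta_density a b \<in> borel_measurable borel" unfolding beta_density_def by measurable
    have hx: "h (x 1) = x" if "x \<in> space ?N" for x
      using that by (auto simp: h_def space_PiM PiE_iff extensional_def restrict_def fun_eq_iff)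
    have "distr Q ?N (\<lambda>\<omega>. h (\<rho> \<omega>)) = density ?N (\<lambda>x. ennreal (beta_density a b (x 1)))"
    proof (rule measure_eqI)
      fix A assume "A \<in> sets (distr Q ?N (\<lambda>\<omega>. h (\<rho> \<omega>)))"
      then have A [measurable]: "A \<in> sets ?N" by simp
      have hA: "h -` A \<inter> space lborel \<in> sets lborel" by (rule measurable_sets[OF h A])
      have "emeasure (distr Q ?N (\<lambda>\<omega>. h (\<rho> \<omega>))) A = emeasure Q ((\<lambda>\<omega>. h (\<rho> \<omega>)) -` A \<inter> space Q)"
        by (rule emeasure_distr[OF h\<rho> A])
      also have "(\<lambda>\<omega>. h (\<rho> \<omega>)) -` A \<inter> space Q = \<rho> -` (h -` A \<inter> space lborel) \<inter> space Q" by auto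
      also have "emeasure Q \<dots> = (\<integral>\<^sup>+y. ennreal (beta_density a b y) * indicator (h -` A \<inter> space lborel) y \<partial>lborel)"
        by (rule distributed_emeasure[OF D hA])
      also have "\<dots> = (\<integral>\<^sup>+y. ennreal (beta_density a b y) * indicator A (h y) \<partial>lborel)"
        by (intro nn_integral_cong) (auto simp: indicator_def)
      also have "\<dots> = (\<integral>\<^sup>+x. ennreal (beta_density a b (x 1)) * indicator A (h (x 1)) \<partial>?N)"
        by (rule product_nn_integral_singleton[symmetric]) measurable
      also have "\<dots> = (\<integral>\<^sup>+x. ennreal (beta_density a b (x 1)) * indicator A x \<partial>?N)"
        by (intro nn_integral_cong) (simp only: hx)
      also have "\<dots> = emeasure (density ?N (\<lambda>x. ennreal (beta_density a b (x 1)))) A"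
        by (rule emeasure_density[symmetric]) measurable
      finally show "emeasure (distr Q ?N (\<lambda>\<omega>. h (\<rho> \<omega>))) A = emeasure (density ?N (\<lambda>x. ennreal (beta_density a b (x 1)))) A" .
    qed simp
    then show ?thesis using h\<rho> unfolding dens distributed_def h_def by simp
  qed
  have Bpos: "0 < 1 / Beta a b" using a b by (simp add: Beta_def Gamma_real_pos)
  note em = J.ensemble_mellin[OF zero_less_one _ a disjI2[OF refl] Q D' Bpos z]
  show "integrable Q (\<lambda>\<omega>. exp (z * complex_of_real (ln (\<rho> \<omega>))))" using em(1) by simp
  have num_shift: "J.num_shift 1 ?I 1 = 0" and den_shift: "J.den_shift 1 ?I 1 = b"
    by (simp_all add: J.num_shift_def J.den_shift_def)
  have "(LINT \<omega>|Q. exp (z * complex_of_real (ln (\<rho> \<omega>)))) * Gamma (of_real (a + b) + z) * Gamma (of_real a) =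
     Gamma (of_real (a + b)) * Gamma (of_real a + z)"
    using em(2) by (simp add: J.denom_complex_def num_shift[unfolded One_nat_def] den_shift[unfolded One_nat_def] add_ac)
  moreover have "Gamma (of_real (a + b) + z) \<noteq> 0" "Gamma (complex_of_real a) \<noteq> 0"
    using a b z by (intro Gamma_Re_pos_nonzero; simp)+
  ultimately show "(LINT \<omega>|Q. exp (z * complex_of_real (ln (\<rho> \<omega>)))) =
      Gamma (of_real a + z) / Gamma (of_real a) * (Gamma (of_real (a + b)) / Gamma (of_real (a + b) + z))"
    by (simp add: field_simps)
  have "AE x in lborel. 0 < ennreal (beta_density a b x) \<longrightarrow> 0 < x"
    by (auto simp: beta_density_def)
  moreover have "(\<lambda>x. ennreal (beta_density a b x)) \<in> borel_measurable lborel" using D by (simp add: distributed_def)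
  ultimately have "AE x in density lborel (\<lambda>x. ennreal (beta_density a b x)). 0 < x"
    by (subst AE_density)
  moreover have "distr Q lborel \<rho> = density lborel (\<lambda>x. ennreal (beta_density a b x))"
    using D by (simp add: distributed_def)
  ultimately have "AE x in distr Q lborel \<rho>. 0 < x" by (simp only:)
  then show "AE \<omega> in Q. 0 < \<rho> \<omega>" by (rule AE_distrD[OF \<rho>])
qed

text \<open>By independence the moment is a product over \<open>k \<in> {2..n}\<close>; with \<open>j = n - k + 1\<close> it is the product of
the first \<open>n - 1\<close> factors of \<open>gamma_product\<close> and a power with exponent \<open>n - 1\<close>. The factor with index \<open>n\<close> is
the inverse of the base of that power, so both can be completed to \<open>n\<close>.\<close>
lemma gram_mellin:
  assumes \<beta>: "0 < \<beta>" and ens: "gram_determinant \<beta> n M D Q \<rho>" and z: "- \<beta> / 2 < Re z" and n: "1 \<le> n"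
  shows "integrable M (\<lambda>\<omega>. exp (z * complex_of_real (ln (D \<omega>))))"
    and "(LINT \<omega>|M. exp (z * complex_of_real (ln (D \<omega>)))) =
      gamma_product (\<beta>/2) n z * (Gamma (of_real (\<beta>/2 * real n)) / Gamma (of_real (\<beta>/2 * real n) + z)) ^ n"
proof -
  have g: "0 < \<beta>/2" and z': "- (\<beta>/2) < Re z" using \<beta> z by auto
  have D [measurable]: "D \<in> borel_measurable M" and gf: "gram_factors \<beta> n Q \<rho>"
    and law: "distr M borel D = distr Q borel (\<lambda>\<omega>. \<Prod>k=2..n. \<rho> k \<omega>)"
    using ens unfolding gram_determinant_def by auto
  interpret Q: prob_space Q using gf unfolding gram_factors_def by simp
  have ind: "Q.indep_vars (\<lambda>_. borel) \<rho> {2..n}" using gf unfolding gram_factors_def by simp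
  define a where "a k = \<beta>/2 * (real n - real k + 1)" for k
  define b where "b k = \<beta>/2 * (real k - 1)" for k
  have dist: "distributed Q lborel (\<rho> k) (\<lambda>x. ennreal (beta_density (a k) (b k) x))" if "k \<in> {2..n}" for k
    using gf that unfolding gram_factors_def a_def b_def by blast
  have ab: "0 < a k" "0 < b k" "- a k < Re z" if "k \<in> {2..n}" for k
  proof -
    have "\<beta>/2 * 1 \<le> a k" unfolding a_def using that g by (intro mult_left_mono) auto
    then show "0 < a k" "- a k < Re z" using g z' by auto
    show "0 < b k" unfolding b_def using that g by (intro mult_pos_pos) auto
  qed
  have bm: "integrable Q (\<lambda>\<omega>. exp (z * complex_of_real (ln (\<rho> k \<omega>))))"
    "(LINT \<omega>|Q. exp (z * complex_of_real (ln (\<rho> k \<omega>)))) =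
      Gamma (of_real (a k) + z) / Gamma (of_real (a k)) * (Gamma (of_real (a k + b k)) / Gamma (of_real (a k + b k) + z))"
    "AE \<omega> in Q. 0 < \<rho> k \<omega>" if "k \<in> {2..n}" for k
    using beta_mellin[OF ab(1)[OF that] ab(2)[OF that] Q.prob_space_axioms dist[OF that] ab(3)[OF that]] .
  have [measurable]: "\<rho> k \<in> borel_measurable Q" if "k \<in> {2..n}" for k
    using dist[OF that] by (simp add: distributed_def)
  have Pm: "(\<lambda>\<omega>. \<Prod>k=2..n. \<rho> k \<omega>) \<in> borel_measurable Q" by (rule borel_measurable_prod) measurable
  have ind': "Q.indep_vars (\<lambda>_. borel) (\<lambda>k \<omega>. exp (z * complex_of_real (ln (\<rho> k \<omega>)))) {2..n}"
    by (rule Q.indep_vars_compose2[OF ind]) measurable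
  have "AE \<omega> in Q. \<forall>k\<in>{2..n}. 0 < \<rho> k \<omega>" using bm(3) by (intro AE_finite_allI) auto
  then have ae: "AE \<omega> in Q. (\<Prod>k=2..n. exp (z * complex_of_real (ln (\<rho> k \<omega>)))) = exp (z * complex_of_real (ln (\<Prod>k=2..n. \<rho> k \<omega>)))"
  proof eventually_elim
    case (elim \<omega>)
    then have "ln (\<Prod>k=2..n. \<rho> k \<omega>) = (\<Sum>k=2..n. ln (\<rho> k \<omega>))" by (intro ln_prod) (simp, metis less_irrefl)
    then show ?case by (simp add: exp_sum[symmetric] sum_distrib_left)
  qed
  have int: "integrable Q (\<lambda>\<omega>. exp (z * complex_of_real (ln (\<Prod>k=2..n. \<rho> k \<omega>))))"
  proof (rule integrable_cong_AE_imp[OF Q.indep_vars_integrable[OF finite_atLeastAtMost ind' bm(1)] _ ae])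
    show "(\<lambda>\<omega>. exp (z * complex_of_real (ln (\<Prod>k=2..n. \<rho> k \<omega>)))) \<in> borel_measurable Q"
      using Pm by measurable
  qed
  have "integrable (distr Q borel (\<lambda>\<omega>. \<Prod>k=2..n. \<rho> k \<omega>)) (\<lambda>y. exp (z * complex_of_real (ln y)))"
    using int Pm by (subst integrable_distr_eq) auto
  then show "integrable M (\<lambda>\<omega>. exp (z * complex_of_real (ln (D \<omega>))))"
    unfolding law[symmetric] by (subst (asm) integrable_distr_eq) auto
  have "(LINT \<omega>|M. exp (z * complex_of_real (ln (D \<omega>)))) = (LINT y|distr M borel D. exp (z * complex_of_real (ln y)))"
    by (rule integral_distr[symmetric]) measurable
  also have "\<dots> = (LINT \<omega>|Q. exp (z * complex_of_real (ln (\<Prod>k=2..n. \<rho> k \<omega>))))"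
    unfolding law using Pm by (intro integral_distr) measurable
  also have "\<dots> = (LINT \<omega>|Q. (\<Prod>k=2..n. exp (z * complex_of_real (ln (\<rho> k \<omega>)))))"
    using ae Pm by (intro integral_cong_AE) (measurable, auto)
  also have "\<dots> = (\<Prod>k=2..n. LINT \<omega>|Q. exp (z * complex_of_real (ln (\<rho> k \<omega>))))"
    by (rule Q.indep_vars_lebesgue_integral[OF finite_atLeastAtMost ind' bm(1)])
  also have "\<dots> = (\<Prod>k=2..n. Gamma (of_real (a k) + z) / Gamma (of_real (a k)) *
      (Gamma (of_real (\<beta>/2 * real n)) / Gamma (of_real (\<beta>/2 * real n) + z)))"
  proof (rule prod.cong[OF refl])
    fix k assume k: "k \<in> {2..n}"
    have "a k + b k = \<beta>/2 * real n" unfolding a_def b_def by (simp add: field_simps)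
    with bm(2)[OF k] show "(LINT \<omega>|Q. exp (z * complex_of_real (ln (\<rho> k \<omega>)))) = Gamma (of_real (a k) + z) / Gamma (of_real (a k)) *
      (Gamma (of_real (\<beta>/2 * real n)) / Gamma (of_real (\<beta>/2 * real n) + z))" by simp
  qed
  also have "\<dots> = (\<Prod>k=2..n. Gamma (of_real (a k) + z) / Gamma (of_real (a k))) *
      (Gamma (of_real (\<beta>/2 * real n)) / Gamma (of_real (\<beta>/2 * real n) + z)) ^ (n - 1)"
    unfolding prod.distrib prod_constant by simp
  also have "(\<Prod>k=2..n. Gamma (of_real (a k) + z) / Gamma (of_real (a k))) = gamma_product (\<beta>/2) (n - 1) z"
    unfolding gamma_product_def a_def
    by (rule prod.reindex_bij_witness[of _ "\<lambda>k. n + 1 - k" "\<lambda>k. n + 1 - k"]) (use n in \<open>auto simp: of_nat_diff add.commute add_diff_eq\<close>)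
  also have "gamma_product (\<beta>/2) (n - 1) z = gamma_product (\<beta>/2) n z * (Gamma (of_real (\<beta>/2 * real n)) / Gamma (of_real (\<beta>/2 * real n) + z))"
  proof -
    have r: "\<beta>/2 * 1 \<le> \<beta>/2 * real n" using n g by (intro mult_left_mono) auto
    have "0 < \<beta>/2 * real n + Re z" "0 < \<beta>/2 * real n" using r z' g by linarith+
    then have "Gamma (of_real (\<beta>/2 * real n) + z) \<noteq> 0" "Gamma (complex_of_real (\<beta>/2 * real n)) \<noteq> 0"
      using Gamma_Re_pos_nonzero[of "of_real (\<beta>/2 * real n) + z"] Gamma_Re_pos_nonzero[of "of_real (\<beta>/2 * real n)"]
      by simp_all
    moreover obtain m where "n = Suc m" using n by (cases n) auto
    ultimately show ?thesis unfolding gamma_product_def by simp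
  qed
  finally show "(LINT \<omega>|M. exp (z * complex_of_real (ln (D \<omega>)))) =
      gamma_product (\<beta>/2) n z * (Gamma (of_real (\<beta>/2 * real n)) / Gamma (of_real (\<beta>/2 * real n) + z)) ^ n"
    using n by (cases n) (simp_all add: mult_ac)
qed

section \<open>Binet's formula\<close>

lemma exp_gt_quadratic: "0 < s \<Longrightarrow> 1 + s + s\<^sup>2 / 2 \<le> exp (s::real)"
  using exp_lower_Taylor_quadratic[of s] by simp

text \<open>Equivalent to \<open>0 \<le> (s - 2) * exp s + s + 2\<close>; this function vanishes at 0 and its derivative
\<open>(s - 1) * exp s + 1\<close> is nonnegative because \<open>1 - s \<le> exp (- s)\<close>.\<close>
lemma phi_nonneg: assumes s: "0 < s" shows "0 \<le> phi s"
proof -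
  define h where "h = (\<lambda>s::real. (s - 2) * exp s + s + 2)"
  have "h 0 \<le> h s"
  proof (rule DERIV_nonneg_imp_nondecreasing[where f = h])
    fix x :: real assume "0 \<le> x" "x \<le> s"
    have "exp x * (1 - x) \<le> exp x * exp (- x)"
      using exp_ge_add_one_self[of "- x"] by (intro mult_left_mono) auto
    then have "0 \<le> (x - 1) * exp x + 1" by (simp add: exp_minus algebra_simps)
    moreover have "(h has_real_derivative (x - 1) * exp x + 1) (at x)"
      unfolding h_def by (auto intro!: derivative_eq_intros simp: algebra_simps)
    ultimately show "\<exists>y. (h has_real_derivative y) (at x) \<and> 0 \<le> y" by blast
  qed (use s in simp)
  then have h: "0 \<le> (s - 2) * exp s + s + 2" by (simp add: h_def)
  have e: "0 < exp s - 1" using s by simp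
  have "1/2 - 1/s + 1/(exp s - 1) = ((s - 2) * exp s + s + 2) / (2 * s * (exp s - 1))"
    using s e by (simp add: field_simps)
  also have "\<dots> \<ge> 0" using h s e by (intro divide_nonneg_pos mult_pos_pos) auto
  finally show ?thesis unfolding phi_def using s by simp
qed

lemma phi_le_1: assumes s: "0 < s" shows "phi s \<le> 1"
proof -
  have q: "0 < 1 - s / 2 + s\<^sup>2"
  proof -
    have "1 - s / 2 + s\<^sup>2 = (s - 1/4)\<^sup>2 + 15/16" by (simp add: power2_eq_square algebra_simps)
    then show ?thesis by (simp add: add_nonneg_pos)
  qed
  have "s \<le> (s + s\<^sup>2 / 2) * (1 - s / 2 + s\<^sup>2)"
  proof -
    have "(s + s\<^sup>2 / 2) * (1 - s / 2 + s\<^sup>2) = s + 3 / 4 * s ^ 3 + s ^ 4 / 2"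
      by (simp add: power2_eq_square power3_eq_cube power4_eq_xxxx field_simps)
    then show ?thesis using s by simp
  qed
  also have "\<dots> \<le> (exp s - 1) * (1 - s / 2 + s\<^sup>2)"
    using q exp_gt_quadratic[OF s] by (intro mult_right_mono) auto
  finally have "1 / (exp s - 1) \<le> (1 - s / 2 + s\<^sup>2) / s"
    using s by (simp add: field_simps)
  also have "\<dots> = 1 / s - 1 / 2 + s" using s by (simp add: field_simps power2_eq_square)
  finally have "(1/2 - 1/s + 1/(exp s - 1)) * (1 / s) \<le> s * (1 / s)"
    using s by (intro mult_right_mono) auto
  then show ?thesis using s by (simp add: phi_def)
qed

lemma phi_meas [measurable]: "phi \<in> borel_measurable borel"
  unfolding phi_def[abs_def] by measurable

text \<open>Extended by 0 to the whole line, so that the Laplace transform lemmas apply to \<open>lborel\<close>.\<close>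
definition binet_weight :: "real \<Rightarrow> real" where "binet_weight s = (if 0 < s then phi s else 0)"

lemma binet_weight_meas [measurable]: "binet_weight \<in> borel_measurable borel"
  unfolding binet_weight_def[abs_def] by measurable

lemma binet_weight_nonneg: "0 \<le> binet_weight s" and binet_weight_le_1: "binet_weight s \<le> 1"
  using phi_nonneg phi_le_1 by (auto simp: binet_weight_def)

lemma exp_integral:
  assumes y: "0 < (y::real)"
  shows "integrable lborel (\<lambda>s. indicator {0..} s * exp (- s * y))"
    and "(LINT s|lborel. indicator {0..} s * exp (- s * y)) = 1 / y"
proof -
  have nn: "(\<integral>\<^sup>+s. ennreal (exp (- s * y)) * indicator {0..} s \<partial>lborel) = ennreal (0 - (- exp (- 0 * y) / y))"
  proof (rule nn_integral_FTC_atLeast)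
    show "((\<lambda>s. - exp (- s * y) / y) \<longlongrightarrow> 0) at_top" using y by real_asymp
    show "((\<lambda>s. - exp (- s * y) / y) has_real_derivative exp (- s * y)) (at s)" for s
      using y by (auto intro!: derivative_eq_intros)
  qed auto
  have "has_bochner_integral lborel (\<lambda>s. indicator {0..} s * exp (- s * y)) (1 / y)"
  proof (rule has_bochner_integral_nn_integral)
    have "(\<integral>\<^sup>+ s. ennreal (indicator {0..} s * exp (- s * y)) \<partial>lborel) = (\<integral>\<^sup>+s. ennreal (exp (- s * y)) * indicator {0..} s \<partial>lborel)"
      by (intro nn_integral_cong) (auto simp: indicator_def)
    then show "(\<integral>\<^sup>+ s. ennreal (indicator {0..} s * exp (- s * y)) \<partial>lborel) = ennreal (1 / y)" using nn by simp
  qed (use y in auto)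
  then show "integrable lborel (\<lambda>s. indicator {0..} s * exp (- s * y))"
    "(LINT s|lborel. indicator {0..} s * exp (- s * y)) = 1 / y"
    by (auto simp: has_bochner_integral_iff)
qed

lemma linear_exp_integral:
  assumes y: "0 < (y::real)"
  shows "integrable lborel (\<lambda>s. indicator {0..} s * (s * exp (- s * y)))"
    and "(LINT s|lborel. indicator {0..} s * (s * exp (- s * y))) = 1 / y\<^sup>2"
proof -
  have nn: "(\<integral>\<^sup>+s. ennreal (s * exp (- s * y)) * indicator {0..} s \<partial>lborel) = ennreal (0 - (- (0 / y + 1 / y\<^sup>2) * exp (- 0 * y)))"
  proof (rule nn_integral_FTC_atLeast)
    show "((\<lambda>s. - (s / y + 1 / y\<^sup>2) * exp (- s * y)) \<longlongrightarrow> 0) at_top" using y by real_asymp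
    show "((\<lambda>s. - (s / y + 1 / y\<^sup>2) * exp (- s * y)) has_real_derivative s * exp (- s * y)) (at s)" for s
      using y by (auto intro!: derivative_eq_intros simp: field_simps power2_eq_square)
  qed auto
  have "has_bochner_integral lborel (\<lambda>s. indicator {0..} s * (s * exp (- s * y))) (1 / y\<^sup>2)"
  proof (rule has_bochner_integral_nn_integral)
    have "(\<integral>\<^sup>+ s. ennreal (indicator {0..} s * (s * exp (- s * y))) \<partial>lborel) = (\<integral>\<^sup>+s. ennreal (s * exp (- s * y)) * indicator {0..} s \<partial>lborel)"
      by (intro nn_integral_cong) (auto simp: indicator_def)
    then show "(\<integral>\<^sup>+ s. ennreal (indicator {0..} s * (s * exp (- s * y))) \<partial>lborel) = ennreal (1 / y\<^sup>2)" using nn by simp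
  qed (use y in \<open>auto simp: indicator_def\<close>)
  then show "integrable lborel (\<lambda>s. indicator {0..} s * (s * exp (- s * y)))"
    "(LINT s|lborel. indicator {0..} s * (s * exp (- s * y))) = 1 / y\<^sup>2"
    by (auto simp: has_bochner_integral_iff)
qed

definition binet :: "real \<Rightarrow> real" where
  "binet x = (LINT s|lborel. exp (x * (- s)) * binet_weight s)"

definition cbinet :: "complex \<Rightarrow> complex" where
  "cbinet z = (LINT s|lborel. exp (z * complex_of_real (- s)) * complex_of_real (binet_weight s))"

lemma binet_integrable: "0 < x \<Longrightarrow> integrable lborel (\<lambda>s. exp (x * (- s)) * binet_weight s)"
proof (rule Bochner_Integration.integrable_bound[OF exp_integral(1)])
  assume "0 < x"
  show "AE s in lborel. norm (exp (x * - s) * binet_weight s) \<le> norm (indicat_real {0..} s * exp (- s * x))"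
    by (intro AE_I2) (auto simp: indicator_def binet_weight_def abs_mult mult_ac phi_nonneg phi_le_1)
qed (measurable)

lemma binet_bounds: assumes x: "0 < x" shows "0 \<le> binet x" "binet x \<le> 1 / x"
proof -
  show "0 \<le> binet x" unfolding binet_def using binet_weight_nonneg by (intro integral_nonneg_AE) auto
  have "binet x \<le> (LINT s|lborel. indicator {0..} s * exp (- s * x))"
    unfolding binet_def
    by (intro integral_mono binet_integrable exp_integral x) (auto simp: indicator_def binet_weight_def mult_ac phi_le_1)
  then show "binet x \<le> 1 / x" using exp_integral(2)[OF x] by simp
qed

lemma cbinet_of_real: "cbinet (of_real x) = of_real (binet x)"
  unfolding cbinet_def binet_def exp_of_real_mult
  unfolding of_real_mult[symmetric] by (rule integral_complex_of_real)

lemma cbinet_holomorphic: "cbinet holomorphic_on {z. 0 < Re z}"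
  unfolding cbinet_def[abs_def]
  by (rule laplace_holomorphic[OF binet_integrable binet_weight_nonneg]) measurable

text \<open>The integral on the left is what makes \<open>binet x - binet (x + 1)\<close> elementary after interchanging
integrals.\<close>
lemma phi_difference:
  assumes s: "0 < s"
  shows "(LINT u|lborel. indicator {0..1} u * ((1/2 - u) * exp (- s * u))) = phi s * (1 - exp (- s))"
proof -
  \<comment> \<open>an antiderivative of the integrand\<close>
  define F where "F = (\<lambda>u. exp (- s * u) * ((u - 1/2) / s + 1 / s\<^sup>2))"
  have "(LINT u|lborel. (1/2 - u) * exp (- s * u) * indicator {0..1} u) = F 1 - F 0"
  proof (rule integral_FTC_Icc_real)
    show "(F has_real_derivative (1/2 - u) * exp (- s * u)) (at u)" for u
      unfolding F_def using s by (auto intro!: derivative_eq_intros simp: field_simps power2_eq_square)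
  qed (auto intro!: continuous_intros)
  also have "F 1 - F 0 = phi s * (1 - exp (- s))"
  proof -
    have "1 / (exp s - 1) * (1 - exp (- s)) = exp (- s)" using s by (simp add: exp_minus field_simps)
    moreover have "(A + T) * B * e = (A * e + T * e) * B" for A T B e :: real by (simp add: algebra_simps)
    ultimately have "phi s * (1 - exp (- s)) = ((1/2 - 1/s) * (1 - exp (- s)) + exp (- s)) * (1 / s)"
      unfolding phi_def by metis
    also have "\<dots> = F 1 - F 0" unfolding F_def using s by (simp add: field_simps power2_eq_square)
    finally show ?thesis by simp
  qed
  finally show ?thesis by (simp add: mult_ac)
qed

text \<open>Writing the integrand as an integral over \<open>u \<in> [0, 1]\<close> and integrating over \<open>s\<close> first leaves
\<open>(1/2 - u) / (x + u)\<close>, which has an elementary antiderivative.\<close>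
lemma binet_step:
  assumes x: "0 < x"
  shows "binet x - binet (x + 1) = (x + 1/2) * (ln (x + 1) - ln x) - 1"
proof -
  define f where "f = (\<lambda>(s::real, u::real). indicator {0<..} s * indicator {0..1} u * ((1/2 - u) * exp (- s * (x + u))))"
  have fm [measurable]: "f \<in> borel_measurable (lborel \<Otimes>\<^sub>M lborel)" unfolding f_def by measurable
  have ind: "integrable lborel (indicat_real {0..1::real})" by (rule integrable_real_indicator) auto
  have f: "integrable (lborel \<Otimes>\<^sub>M lborel) f"
  proof (rule Bochner_Integration.integrable_bound)
    show "integrable (lborel \<Otimes>\<^sub>M lborel) (\<lambda>(s::real, u::real). (indicator {0..} s * exp (- s * x)) * indicat_real {0..1} u)"
    proof (rule lborel_pair.Fubini_integrable)
      show "integrable lborel (\<lambda>s. LINT u|(lborel :: real measure). norm (case (s, u) of (s, u) \<Rightarrow> (indicat_real {0..} s * exp (- s * x)) * indicat_real {0..1} u))"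
        using integrable_norm[OF exp_integral(1)[OF x]] by (simp add: abs_mult)
      show "AE s in lborel. integrable lborel (\<lambda>u::real. case (s, u) of (s, u) \<Rightarrow> (indicat_real {0..} s * exp (- s * x)) * indicat_real {0..1} u)"
        by (intro AE_I2) (simp add: ind)
    qed measurable
    show "AE p in lborel \<Otimes>\<^sub>M lborel. norm (f p) \<le> norm ((\<lambda>(s, u). (indicat_real {0..} s * exp (- s * x)) * indicat_real {0..1} u) p)"
    proof (rule AE_I2)
      fix p :: "real \<times> real"
      obtain s u where p: "p = (s, u)" by force
      show "norm (f p) \<le> norm ((\<lambda>(s, u). (indicat_real {0..} s * exp (- s * x)) * indicat_real {0..1} u) p)"
      proof (cases "0 < s \<and> 0 \<le> u \<and> u \<le> 1")
        case True
        then have "\<bar>1/2 - u\<bar> * exp (- s * (x + u)) \<le> 1 * exp (- s * x)"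
          by (intro mult_mono) (auto simp: algebra_simps)
        then show ?thesis using True by (simp add: p f_def abs_mult)
      qed (auto simp: p f_def indicator_def)
    qed
  qed measurable
  have "(LINT s|lborel. LINT u|lborel. f (s, u)) = (LINT u|lborel. LINT s|lborel. f (s, u))"
    by (rule lborel_pair.Fubini_integral[symmetric]) (use f in simp)
  moreover have "(LINT u|lborel. f (s, u)) = exp (x * - s) * binet_weight s - exp ((x + 1) * - s) * binet_weight s" for s
  proof (cases "0 < s")
    case True
    have "(LINT u|lborel. f (s, u)) = (LINT u|lborel. exp (- s * x) * (indicator {0..1} u * ((1/2 - u) * exp (- s * u))))"
      unfolding f_def using True
      by (intro Bochner_Integration.integral_cong) (auto simp: exp_add[symmetric] algebra_simps)
    also have "\<dots> = exp (- s * x) * (phi s * (1 - exp (- s)))" using phi_difference[OF True] by simp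
    also have "\<dots> = exp (x * - s) * binet_weight s - exp ((x + 1) * - s) * binet_weight s"
      using True by (simp add: binet_weight_def algebra_simps exp_add[symmetric] exp_diff[symmetric])
    finally show ?thesis .
  qed (simp add: f_def binet_weight_def)
  moreover have "(LINT s|lborel. f (s, u)) = indicator {0..1} u * ((1/2 - u) / (x + u))" for u
  proof (cases "u \<in> {0..1}")
    case True
    then have xu: "0 < x + u" using x by auto
    have "(LINT s|lborel. f (s, u)) = (LINT s|lborel. (1/2 - u) * (indicator {0..} s * exp (- s * (x + u))))"
    proof (rule integral_cong_AE)
      show "AE s in lborel. f (s, u) = (1/2 - u) * (indicator {0..} s * exp (- s * (x + u)))"
        using AE_lborel_singleton[of "0::real"]
        by eventually_elim (use True in \<open>auto simp: f_def indicator_def\<close>)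
    qed (simp_all add: f_def)
    then show ?thesis using exp_integral(2)[OF xu] True by simp
  qed (simp add: f_def)
  ultimately have eq: "(LINT s|lborel. exp (x * - s) * binet_weight s - exp ((x + 1) * - s) * binet_weight s) =
     (LINT u|lborel. indicator {0..1} u * ((1/2 - u) / (x + u)))" by simp
  have "(LINT u|lborel. ((1/2 - u) / (x + u)) * indicator {0..1} u) =
     ((x + 1/2) * ln (x + 1) - 1) - ((x + 1/2) * ln (x + 0) - 0)"
  proof (rule integral_FTC_Icc_real)
    show "((\<lambda>u. (x + 1/2) * ln (x + u) - u) has_real_derivative (1/2 - u) / (x + u)) (at u)" if "0 \<le> u" "u \<le> 1" for u
      using x that by (auto intro!: derivative_eq_intros simp: field_simps)
    show "isCont (\<lambda>u. (1/2 - u) / (x + u)) u" if "0 \<le> u" "u \<le> 1" for u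
      using x that by (auto intro!: continuous_intros)
  qed simp
  then have "(LINT u|lborel. indicator {0..1} u * ((1/2 - u) / (x + u))) = (x + 1/2) * (ln (x + 1) - ln x) - 1"
    by (simp add: algebra_simps)
  with eq show ?thesis
    unfolding binet_def using binet_integrable[OF x] binet_integrable[of "x + 1"] x by simp
qed

lemma binet_convex: "convex_on {0<..} binet"
proof (rule convex_onI)
  fix t x y :: real assume t: "0 < t" "t < 1" and "x \<in> {0<..}" "y \<in> {0<..}"
  then have xy: "0 < x" "0 < y" by auto
  have w: "0 < (1 - t) * x + t * y" using t xy by (intro add_pos_pos mult_pos_pos) auto
  have "binet ((1 - t) * x + t * y) \<le>
      (LINT s|lborel. (1 - t) * (exp (x * - s) * binet_weight s) + t * (exp (y * - s) * binet_weight s))"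
    unfolding binet_def
  proof (intro integral_mono binet_integrable w Bochner_Integration.integrable_add integrable_mult_right xy)
    fix s :: real
    have "exp ((1 - t) * (x * - s) + t * (y * - s)) \<le> (1 - t) * exp (x * - s) + t * exp (y * - s)"
      using convex_onD[OF exp_convex, of t "x * - s" "y * - s"] t by simp
    from mult_right_mono[OF this binet_weight_nonneg[of s]]
    show "exp (((1 - t) * x + t * y) * - s) * binet_weight s \<le> (1 - t) * (exp (x * - s) * binet_weight s) + t * (exp (y * - s) * binet_weight s)"
      by (simp add: algebra_simps)
  qed
  also have "\<dots> = (1 - t) * binet x + t * binet y"
    unfolding binet_def using binet_integrable[OF xy(1)] binet_integrable[OF xy(2)] by simp
  finally show "binet ((1 - t) *\<^sub>R x + t *\<^sub>R y) \<le> (1 - t) * binet x + t * binet y" by simp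
qed simp

lemma binet_tendsto_0: "(binet \<longlongrightarrow> 0) at_top"
proof (rule tendsto_sandwich)
  show "eventually (\<lambda>x. 0 \<le> binet x) at_top" using eventually_gt_at_top[of 0]
    by eventually_elim (rule binet_bounds)
  show "eventually (\<lambda>x. binet x \<le> 1 / x) at_top" using eventually_gt_at_top[of 0]
    by eventually_elim (rule binet_bounds)
  show "((\<lambda>x::real. 1 / x) \<longlongrightarrow> 0) at_top" by real_asymp
qed simp

text \<open>Bohr and Mollerup again: the exponential of the right-hand side is log-convex, since both
\<open>(x - 1/2) * ln x - x\<close> and the Laplace transform \<open>binet\<close> of a nonnegative function are convex, and it
satisfies the functional equation of Gamma.\<close>
lemma ln_Gamma_binet_const: "\<exists>C. \<forall>x>0. ln (Gamma x) = (x - 1/2) * ln x - x + C + binet x"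
proof -
  define h where "h = (\<lambda>x. (x - 1/2) * ln x - x + binet x)"
  have "convex_on {0<..} (\<lambda>x::real. (x - 1/2) * ln x - x)"
  proof (rule convex_on_realI[where f' = "\<lambda>x. ln x - 1 / (2 * x)"])
    show "((\<lambda>x. (x - 1/2) * ln x - x) has_real_derivative ln x - 1 / (2 * x)) (at x)" if "x \<in> {0<..}" for x :: real
      using that by (auto intro!: derivative_eq_intros simp: field_simps)
    show "ln x - 1 / (2 * x) \<le> ln y - 1 / (2 * y)" if "x \<in> {0<..}" "y \<in> {0<..}" "x \<le> y" for x y :: real
      using that by (intro diff_mono divide_left_mono) auto
  qed auto
  then have hc: "convex_on {0<..} h" unfolding h_def by (rule convex_on_add[OF _ binet_convex])
  have step: "h (x + 1) = ln x + h x" if "0 < x" for x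
    using binet_step[OF that] unfolding h_def by (simp add: algebra_simps)
  have "Gamma x * exp (h 1) = Gamma 1 * exp (h x)" if x: "0 < x" for x
  proof (rule bohr_mollerup_unique[where r = "\<lambda>x. x", OF _ log_convex_Gamma_real _ _ _ _ _ _ x])
    show "Gamma (x + 1) = x * Gamma x" if "0 < x" for x :: real
      using Gamma_real_shift[of x 0] that by simp
    show "exp (h (x + 1)) = x * exp (h x)" if "0 < x" for x using step[OF that] that by (simp add: exp_add)
    show "convex_on {0<..} (ln \<circ> (\<lambda>x. exp (h x)))" using hc by (simp add: o_def)
    show "(\<lambda>n. real (Suc (Suc n)) / real (Suc n)) \<longlonglongrightarrow> 1" by real_asymp
  qed (auto intro: Gamma_real_pos)
  then have "ln (Gamma x * exp (h 1)) = ln (exp (h x))" if "0 < x" for x using that by simp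
  then have "ln (Gamma x) + h 1 = h x" if "0 < x" for x
    using that Gamma_real_pos[OF that] by (simp add: ln_mult_pos)
  then have "\<forall>x>0. ln (Gamma x) = (x - 1/2) * ln x - x + (- h 1) + binet x"
    unfolding h_def by (auto simp: algebra_simps)
  then show ?thesis by blast
qed

text \<open>The constant is determined by inserting the formula into Legendre's duplication formula and letting
\<open>x\<close> tend to infinity.\<close>
lemma ln_Gamma_binet:
  assumes x: "0 < x" shows "ln (Gamma x) = (x - 1/2) * ln x - x + ln (2 * pi) / 2 + binet x"
proof -
  obtain C where C: "\<And>x. 0 < x \<Longrightarrow> ln (Gamma x) = (x - 1/2) * ln x - x + C + binet x"
    using ln_Gamma_binet_const by blast
  have dup: "ln (Gamma x) + ln (Gamma (x + 1/2)) = (1 - 2 * x) * ln 2 + ln pi / 2 + ln (Gamma (2 * x))" if x: "0 < x" for x :: real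
  proof -
    have "complex_of_real x \<notin> \<int>\<^sub>\<le>\<^sub>0" "complex_of_real x + 1/2 \<notin> \<int>\<^sub>\<le>\<^sub>0" using x by (auto intro!: Re_pos_not_nonpos_Ints)
    from Gamma_legendre_duplication[OF this]
    have "complex_of_real (Gamma x * Gamma (x + 1/2)) = complex_of_real (exp ((1 - 2 * x) * ln 2) * sqrt pi * Gamma (2 * x))"
      by (simp add: exp_of_real_mult[symmetric] Gamma_complex_of_real[symmetric])
    then have "Gamma x * Gamma (x + 1/2) = exp ((1 - 2 * x) * ln 2) * sqrt pi * Gamma (2 * x)" by (simp only: of_real_eq_iff)
    then have "ln (Gamma x * Gamma (x + 1/2)) = ln (exp ((1 - 2 * x) * ln 2) * sqrt pi * Gamma (2 * x))" by simp
    then show ?thesis using x Gamma_real_pos[of x] Gamma_real_pos[of "x + 1/2"] Gamma_real_pos[of "2 * x"]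
      by (simp add: ln_mult_pos ln_sqrt)
  qed
  have "C = ln 2 / 2 + ln pi / 2 + 1/2 - x * (ln (x + 1/2) - ln x) + (binet (2 * x) - binet x - binet (x + 1/2))" if x: "0 < x" for x
    using dup[OF x] C[of x] C[of "x + 1/2"] C[of "2 * x"] x by (simp add: ln_mult_pos algebra_simps)
  note Ceq = this
  have "eventually (\<lambda>x. ln 2 / 2 + ln pi / 2 + 1/2 - x * (ln (x + 1/2) - ln x) + (binet (2 * x) - binet x - binet (x + 1/2)) = C) at_top"
    using eventually_gt_at_top[of 0] by eventually_elim (rule Ceq[symmetric])
  moreover have "((\<lambda>x. ln 2 / 2 + ln pi / 2 + 1/2 - x * (ln (x + 1/2) - ln x) + (binet (2 * x) - binet x - binet (x + 1/2))) \<longlongrightarrow>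
      (ln 2 / 2 + ln pi / 2 + 1/2 - 1/2) + (0 - 0 - 0)) at_top"
  proof (intro tendsto_add tendsto_diff)
    show "((\<lambda>x::real. x * (ln (x + 1/2) - ln x)) \<longlongrightarrow> 1/2) at_top" by real_asymp
    show "((\<lambda>x. binet (2 * x)) \<longlongrightarrow> 0) at_top"
      by (rule filterlim_compose[OF binet_tendsto_0]) real_asymp
    show "((\<lambda>x. binet (x + 1/2)) \<longlongrightarrow> 0) at_top"
      by (rule filterlim_compose[OF binet_tendsto_0]) real_asymp
  qed (auto intro: binet_tendsto_0)
  ultimately have "((\<lambda>x::real. C) \<longlongrightarrow> ln 2 / 2 + ln pi / 2) at_top"
    using Lim_transform_eventually by fastforce
  then have "C = ln 2 / 2 + ln pi / 2" by (simp add: tendsto_const_iff)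
  then show ?thesis using C[OF x] by (simp add: ln_mult_pos add_divide_distrib)
qed

lemma ln_Gamma_complex_binet:
  assumes "0 < Re z"
  shows "ln_Gamma z = (z - 1/2) * Ln z - z + of_real (ln (2 * pi) / 2) + cbinet z"
proof (rule right_half_plane_identity[OF _ _ _ assms])
  show "ln_Gamma holomorphic_on {z. 0 < Re z}"
    by (rule holomorphic_ln_Gamma) (auto elim!: nonpos_Reals_cases)
  show "(\<lambda>z. (z - 1/2) * Ln z - z + of_real (ln (2 * pi) / 2) + cbinet z) holomorphic_on {z. 0 < Re z}"
    by (intro holomorphic_intros cbinet_holomorphic) (auto elim!: nonpos_Reals_cases)
  fix x :: real assume x: "0 < x"
  have "ln_Gamma (complex_of_real x) = of_real (ln (Gamma x))"
    using x Gamma_real_pos_exp[OF x] by (simp add: ln_Gamma_complex_of_real)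
  then show "ln_Gamma (complex_of_real x) = (of_real x - 1/2) * Ln (of_real x) - of_real x + of_real (ln (2 * pi) / 2) + cbinet (of_real x)"
    unfolding ln_Gamma_binet[OF x] cbinet_of_real using x by (simp add: Ln_of_real)
qed

section \<open>Sums of Binet integrals\<close>

text \<open>The integrand of the integral in \<open>Upsilon\<close>: summing \<open>exp (- s * (g * k + z)) - exp (- s * g * k)\<close> over
\<open>k \<ge> 1\<close> is a geometric series.\<close>
definition binet_kernel :: "real \<Rightarrow> complex \<Rightarrow> real \<Rightarrow> complex" where
  "binet_kernel g z s = of_real (binet_weight s) * ((exp (- (of_real s * z)) - 1) / of_real (exp (s * g) - 1))"

lemma binet_kernel_meas [measurable]: "binet_kernel g z \<in> borel_measurable borel"
  unfolding binet_kernel_def[abs_def] by measurable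

text \<open>The numerator grows at most like \<open>exp (s * (g - \<kappa>))\<close> on this half-plane and the denominator supplies
\<open>exp (- s * g)\<close>, which leaves exponential decay; near 0 both are of order \<open>s\<close>.\<close>
lemma binet_kernel_bound:
  assumes g: "0 < g" and \<kappa>: "0 < \<kappa>" "\<kappa> \<le> g" and z: "- g + \<kappa> \<le> Re z" "norm z \<le> B"
  shows "norm (binet_kernel g z s) \<le> indicator {0..} s * (B * ((1 / g + s) * exp (- s * \<kappa>)))"
proof (cases "0 < s")
  case False
  have "0 \<le> B" using z(2) norm_ge_zero[of z] by linarith
  then show ?thesis using False g
    by (auto simp: binet_kernel_def binet_weight_def indicator_def intro!: mult_nonneg_nonneg add_nonneg_nonneg)
next
  case s: True
  have B: "0 \<le> B" using z(2) norm_ge_zero[of z] by linarith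
  have e0: "0 < exp (s * g) - 1" using s g by simp
  have n1: "norm (exp (- (of_real s * z)) - 1) \<le> (s * B) * exp (s * (g - \<kappa>))"
  proof -
    have "norm (exp (- (of_real s * z)) - 1) \<le> norm (- (of_real s * z)) * exp (max 0 (Re (- (of_real s * z))))"
      by (rule norm_exp_minus_1_le)
    also have "\<dots> \<le> (s * B) * exp (s * (g - \<kappa>))"
    proof (intro mult_mono)
      show "norm (- (of_real s * z)) \<le> s * B" using s z(2) by (simp add: norm_mult)
      have "s * (- Re z) \<le> s * (g - \<kappa>)" using s z(1) by (intro mult_left_mono) auto
      moreover have "0 \<le> s * (g - \<kappa>)" using s \<kappa> by simp
      ultimately show "exp (max 0 (Re (- (of_real s * z)))) \<le> exp (s * (g - \<kappa>))" by simp
    qed (use s B in auto)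
    finally show ?thesis .
  qed
  have n2: "1 / (exp (s * g) - 1) \<le> exp (- s * g) * ((1 + s * g) / (s * g))"
  proof -
    have "exp (- s * g) * (1 + s * g) \<le> exp (- s * g) * exp (s * g)"
      using exp_ge_add_one_self[of "s * g"] by (intro mult_left_mono) auto
    then have "s * g \<le> (1 + s * g) * (1 - exp (- s * g))" by (simp add: exp_minus algebra_simps)
    also have "\<dots> = ((1 + s * g) * exp (- s * g)) * (exp (s * g) - 1)" by (simp add: exp_minus field_simps)
    finally show ?thesis using e0 s g by (simp add: field_simps)
  qed
  have "norm (binet_kernel g z s) = binet_weight s * (norm (exp (- (of_real s * z)) - 1) * (1 / (exp (s * g) - 1)))"
    unfolding binet_kernel_def norm_mult norm_divide norm_of_real using e0 binet_weight_nonneg[of s] by simp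
  also have "\<dots> \<le> 1 * (((s * B) * exp (s * (g - \<kappa>))) * (exp (- s * g) * ((1 + s * g) / (s * g))))"
    using binet_weight_nonneg binet_weight_le_1 n1 n2 e0 s B by (intro mult_mono) auto
  also have "\<dots> = B * ((1 / g + s) * (exp (s * (g - \<kappa>)) * exp (- s * g)))"
    using s g by (simp add: field_simps)
  also have "exp (s * (g - \<kappa>)) * exp (- s * g) = exp (- s * \<kappa>)"
    by (simp add: exp_add[symmetric] algebra_simps)
  finally show ?thesis using s by simp
qed

lemma binet_bound_integral:
  fixes y B g :: real
  assumes y: "0 < y"
  shows "integrable lborel (\<lambda>s. indicator {0..} s * (B * ((1 / g + s) * exp (- s * y))))"
    and "(LINT s|lborel. indicator {0..} s * (B * ((1 / g + s) * exp (- s * y)))) = B / g * (1 / y) + B * (1 / y\<^sup>2)"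
proof -
  have eq: "(\<lambda>s. indicator {0..} s * (B * ((1 / g + s) * exp (- s * y)))) =
     (\<lambda>s. B / g * (indicator {0..} s * exp (- s * y)) + B * (indicator {0..} s * (s * exp (- s * y))))"
    by (simp add: fun_eq_iff algebra_simps)
  show "integrable lborel (\<lambda>s. indicator {0..} s * (B * ((1 / g + s) * exp (- s * y))))"
    unfolding eq using exp_integral(1)[OF y] linear_exp_integral(1)[OF y] by auto
  show "(LINT s|lborel. indicator {0..} s * (B * ((1 / g + s) * exp (- s * y)))) = B / g * (1 / y) + B * (1 / y\<^sup>2)"
    unfolding eq using exp_integral[OF y] linear_exp_integral[OF y] by simp
qed

lemma cbinet_integrable:
  "0 < Re z \<Longrightarrow> integrable lborel (\<lambda>s. exp (z * complex_of_real (- s)) * complex_of_real (binet_weight s))"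
  by (rule laplace_integrable_complex[OF binet_integrable]) auto

text \<open>The finite geometric sum differs from the infinite one by a factor \<open>exp (- s * g * n)\<close>, so the error
is the integral of the bound on the kernel with \<open>\<kappa>\<close> replaced by \<open>\<kappa> + g * n\<close>.\<close>
lemma binet_sum_limit:
  assumes g: "0 < g" and \<kappa>: "0 < \<kappa>" "\<kappa> \<le> g" and K: "\<And>z. z \<in> K \<Longrightarrow> - g + \<kappa> \<le> Re z" "\<And>z. z \<in> K \<Longrightarrow> norm z \<le> B"
  shows "uniform_limit K (\<lambda>n z. \<Sum>k=1..n. cbinet (of_real (g * real k) + z) - cbinet (of_real (g * real k)))
    (\<lambda>z. LINT s|lborel. binet_kernel g z s) sequentially"
proof -
  \<comment> \<open>the integral of the bound on the kernel with decay rate \<open>\<kappa> + g * n\<close>\<close>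
  define E where "E = (\<lambda>n. B / g * (1 / (\<kappa> + g * real n)) + B * (1 / (\<kappa> + g * real n)\<^sup>2))"
  have diff: "norm ((\<Sum>k=1..n. cbinet (of_real (g * real k) + z) - cbinet (of_real (g * real k))) -
      (LINT s|lborel. binet_kernel g z s)) \<le> E n" if z: "z \<in> K" for n z
  proof -
    have y: "0 < \<kappa> + g * real n" using \<kappa> g by (simp add: add_pos_nonneg)
    note bb = binet_kernel_bound[OF g \<kappa> K(1)[OF z] K(2)[OF z]]
    have ker: "integrable lborel (binet_kernel g z)"
    proof (rule Bochner_Integration.integrable_bound[OF binet_bound_integral(1)[OF \<kappa>(1), of B g]])
      show "AE s in lborel. norm (binet_kernel g z s) \<le> norm (indicat_real {0..} s * (B * ((1 / g + s) * exp (- s * \<kappa>))))"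
        by (intro AE_I2 order_trans[OF bb]) (simp only: real_norm_def abs_ge_self)
    qed simp
    have int: "integrable lborel (\<lambda>s. exp ((of_real (g * real k) + z) * complex_of_real (- s)) * complex_of_real (binet_weight s))"
       "integrable lborel (\<lambda>s. exp (of_real (g * real k) * complex_of_real (- s)) * complex_of_real (binet_weight s))"
      if k: "k \<in> {1..n}" for k
    proof -
      have "g * 1 \<le> g * real k" using k g by (intro mult_left_mono) auto
      then have "0 < g * real k" "0 < g * real k + Re z" using g \<kappa> K(1)[OF z] by linarith+
      then show "integrable lborel (\<lambda>s. exp ((of_real (g * real k) + z) * complex_of_real (- s)) * complex_of_real (binet_weight s))"
       "integrable lborel (\<lambda>s. exp (of_real (g * real k) * complex_of_real (- s)) * complex_of_real (binet_weight s))"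
        by (intro cbinet_integrable; simp)+
    qed
    have sumE: "(\<Sum>k=1..n. cbinet (of_real (g * real k) + z) - cbinet (of_real (g * real k))) =
      (LINT s|lborel. (\<Sum>k=1..n. exp ((of_real (g * real k) + z) * complex_of_real (- s)) * complex_of_real (binet_weight s)
         - exp (of_real (g * real k) * complex_of_real (- s)) * complex_of_real (binet_weight s)))"
      unfolding cbinet_def using int
      by (subst Bochner_Integration.integral_sum)
        (simp_all add: Bochner_Integration.integral_diff Bochner_Integration.integrable_diff del: of_real_minus of_real_mult)
    have pt: "(\<Sum>k=1..n. exp ((of_real (g * real k) + z) * complex_of_real (- s)) * complex_of_real (binet_weight s)
         - exp (of_real (g * real k) * complex_of_real (- s)) * complex_of_real (binet_weight s)) =
         binet_kernel g z s - binet_kernel g z s * of_real (exp (- s * (g * real n)))" for s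
    proof (cases "0 < s")
      case s: True
      define q where "q = exp (- s * g)"
      have q: "0 < q" "q < 1" using s g by (auto simp: q_def)
      have qpow: "exp (g * real k * - s) = q ^ k" for k
      proof -
        have "g * real k * - s = real k * (- s * g)" by simp
        then show ?thesis unfolding q_def by (simp only: exp_of_nat_mult)
      qed
      have qk: "exp (of_real (g * real k) * complex_of_real (- s)) = of_real (q ^ k)" for k
        unfolding exp_of_real_mult by (simp only: qpow)
      have geo: "(\<Sum>k=1..n. q ^ k) = (1 - q ^ n) / (exp (s * g) - 1)"
      proof -
        have "(1 - q) * (\<Sum>k=1..n. q ^ k) = q * (1 - q ^ n)"
        proof (induction n)
          case (Suc n)
          have "(1 - q) * (\<Sum>k=1..Suc n. q ^ k) = (1 - q) * (\<Sum>k=1..n. q ^ k) + (1 - q) * (q * q ^ n)"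
            by (simp add: distrib_left)
          also have "\<dots> = q * (1 - q ^ n) + (1 - q) * (q * q ^ n)" by (simp only: Suc)
          also have "\<dots> = q * (1 - q ^ Suc n)" by (simp add: algebra_simps)
          finally show ?case .
        qed simp
        then have "(\<Sum>k=1..n. q ^ k) = q * (1 - q ^ n) / (1 - q)" using q by (simp add: field_simps)
        also have "\<dots> = (1 - q ^ n) / (1 / q - 1)" using q by (simp add: field_simps)
        also have "1 / q = exp (s * g)" by (simp add: q_def exp_minus divide_inverse)
        finally show ?thesis .
      qed
      have "(\<Sum>k=1..n. exp ((of_real (g * real k) + z) * complex_of_real (- s)) * complex_of_real (binet_weight s)
         - exp (of_real (g * real k) * complex_of_real (- s)) * complex_of_real (binet_weight s)) =
         (\<Sum>k=1..n. of_real (q ^ k) * (of_real (binet_weight s) * (exp (- (of_real s * z)) - 1)))"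
        by (intro sum.cong refl) (simp only: qk distrib_right exp_add, simp add: algebra_simps)
      also have "\<dots> = of_real (\<Sum>k=1..n. q ^ k) * (of_real (binet_weight s) * (exp (- (of_real s * z)) - 1))"
        by (simp add: sum_distrib_right)
      also have "\<dots> = binet_kernel g z s * of_real (1 - q ^ n)"
        unfolding geo binet_kernel_def by (simp add: algebra_simps)
      also have "q ^ n = exp (- s * (g * real n))" unfolding qpow[symmetric] by (simp add: mult_ac)
      finally show ?thesis by (simp add: algebra_simps)
    qed (simp add: binet_kernel_def binet_weight_def)
    have kn: "norm (binet_kernel g z s * of_real (exp (- s * (g * real n)))) \<le>
        indicator {0..} s * (B * ((1 / g + s) * exp (- s * (\<kappa> + g * real n))))" for s
    proof -
      have "norm (binet_kernel g z s * of_real (exp (- s * (g * real n)))) \<le>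
        (indicator {0..} s * (B * ((1 / g + s) * exp (- s * \<kappa>)))) * exp (- s * (g * real n))"
        unfolding norm_mult norm_of_real abs_exp_cancel by (intro mult_right_mono bb) simp
      also have "\<dots> = indicator {0..} s * (B * ((1 / g + s) * (exp (- s * \<kappa>) * exp (- s * (g * real n)))))" by simp
      also have "exp (- s * \<kappa>) * exp (- s * (g * real n)) = exp (- s * (\<kappa> + g * real n))"
        by (simp add: exp_add[symmetric] algebra_simps)
      finally show ?thesis .
    qed
    have kint: "integrable lborel (\<lambda>s. binet_kernel g z s * of_real (exp (- s * (g * real n))))"
    proof (rule Bochner_Integration.integrable_bound[OF binet_bound_integral(1)[OF y, of B g]])
      show "AE s in lborel. norm (binet_kernel g z s * of_real (exp (- s * (g * real n)))) \<le> norm (indicat_real {0..} s * (B * ((1 / g + s) * exp (- s * (\<kappa> + g * real n)))))"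
        by (intro AE_I2 order_trans[OF kn]) (simp only: real_norm_def abs_ge_self)
    qed simp
    have "(\<Sum>k=1..n. cbinet (of_real (g * real k) + z) - cbinet (of_real (g * real k))) -
      (LINT s|lborel. binet_kernel g z s) = - (LINT s|lborel. binet_kernel g z s * of_real (exp (- s * (g * real n))))"
      unfolding sumE pt using ker kint by simp
    also have "norm \<dots> \<le> (LINT s|lborel. norm (binet_kernel g z s * of_real (exp (- s * (g * real n)))))"
      unfolding norm_minus_cancel by (rule integral_norm_bound)
    also have "\<dots> \<le> (LINT s|lborel. indicator {0..} s * (B * ((1 / g + s) * exp (- s * (\<kappa> + g * real n)))))"
      by (intro integral_mono integrable_norm kint binet_bound_integral y kn)
    also have "\<dots> = E n" unfolding E_def by (rule binet_bound_integral(2)[OF y])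
    finally show ?thesis .
  qed
  have E1: "(\<lambda>n. 1 / (\<kappa> + g * real n)) \<longlonglongrightarrow> 0" using g by real_asymp
  have "E \<longlonglongrightarrow> B / g * 0 + B * 0\<^sup>2"
    unfolding E_def power_one_over[symmetric] by (intro tendsto_intros E1)
  then have "E \<longlonglongrightarrow> 0" by simp
  show ?thesis
  proof (rule uniform_limitI)
    fix e :: real assume "0 < e"
    then have "eventually (\<lambda>n. E n < e) sequentially" using \<open>E \<longlonglongrightarrow> 0\<close> by (rule order_tendstoD(2)[rotated])
    then show "\<forall>\<^sub>F n in sequentially. \<forall>z\<in>K. dist (\<Sum>k=1..n. cbinet (of_real (g * real k) + z) - cbinet (of_real (g * real k)))
        (LINT s|lborel. binet_kernel g z s) < e"
      by eventually_elim (use diff in \<open>auto simp: dist_norm intro: le_less_trans\<close>)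
  qed
qed

section \<open>Quotients of Gamma values far to the right\<close>

text \<open>The function inside the norm has derivative \<open>u\<^sup>2 / (1 + u)\<close>.\<close>
lemma Ln_cubic_bound:
  fixes u :: complex assumes u: "norm u \<le> 1/2"
  shows "norm (Ln (1 + u) - (u - u\<^sup>2 / 2)) \<le> 2 * norm u ^ 3"
proof -
  define F where "F = (\<lambda>u. Ln (1 + u) - (u - u\<^sup>2 / 2))"
  have "norm (F u - F 0) \<le> (2 * (norm u)\<^sup>2) * norm (u - 0)"
  proof (rule field_differentiable_bound)
    show "convex (closed_segment 0 u)" by simp
    fix v assume "v \<in> closed_segment 0 u"
    then have v: "norm v \<le> norm u" using segment_bound1[of v 0 u] by simp
    then have v2: "norm v \<le> 1/2" using u by simp
    have r: "0 < Re (1 + v)" using abs_Re_le_cmod[of v] v2 by simp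
    then have "1 + v \<notin> \<real>\<^sub>\<le>\<^sub>0" by (auto simp: complex_nonpos_Reals_iff)
    moreover have nz: "1 + v \<noteq> 0" using r by (metis less_irrefl zero_complex.sel(1))
    ultimately have "((\<lambda>u. Ln (1 + u)) has_field_derivative 1 / (1 + v)) (at v within closed_segment 0 u)"
      by (auto intro!: derivative_eq_intros simp: inverse_eq_divide)
    moreover have "((\<lambda>u. u - u\<^sup>2 / 2) has_field_derivative 1 - v) (at v within closed_segment 0 u)"
      by (auto intro!: derivative_eq_intros)
    ultimately have "(F has_field_derivative 1 / (1 + v) - (1 - v)) (at v within closed_segment 0 u)"
      unfolding F_def by (rule Deriv.field_differentiable_diff)
    moreover have "1 / (1 + v) - (1 - v) = v\<^sup>2 / (1 + v)"
      using nz by (simp add: eq_divide_eq power2_eq_square) (simp add: algebra_simps)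
    ultimately show "(F has_field_derivative v\<^sup>2 / (1 + v)) (at v within closed_segment 0 u)" by simp
    have "1/2 \<le> norm (1 + v)" using norm_triangle_ineq2[of 1 "- v"] v2 by simp
    moreover have "(norm v)\<^sup>2 \<le> (norm u)\<^sup>2" using v by (intro power_mono) auto
    ultimately have "(norm v)\<^sup>2 / norm (1 + v) \<le> (norm u)\<^sup>2 / (1/2)" by (intro frac_le) auto
    then show "norm (v\<^sup>2 / (1 + v)) \<le> 2 * (norm u)\<^sup>2" by (simp add: norm_divide norm_power)
  qed auto
  then show ?thesis by (simp add: F_def power2_eq_square power3_eq_cube)
qed

lemma cbinet_diff_bound:
  assumes x: "2 * B < x" and z: "norm z \<le> B"
  shows "norm (cbinet (of_real x + z) - cbinet (of_real x)) \<le> 4 * B / x\<^sup>2"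
proof -
  have B: "0 \<le> B" using z norm_ge_zero[of z] by linarith
  have x0: "0 < x" "0 < x - B" using x B by auto
  have rz: "\<bar>Re z\<bar> \<le> B" using abs_Re_le_cmod[of z] z by linarith
  have int: "integrable lborel (\<lambda>s. exp ((of_real x + z) * complex_of_real (- s)) * complex_of_real (binet_weight s))"
    "integrable lborel (\<lambda>s. exp (of_real x * complex_of_real (- s)) * complex_of_real (binet_weight s))"
    using x0 rz by (intro cbinet_integrable; simp)+
  have bd: "norm (exp ((of_real x + z) * complex_of_real (- s)) * complex_of_real (binet_weight s)
      - exp (of_real x * complex_of_real (- s)) * complex_of_real (binet_weight s)) \<le>
      B * (indicator {0..} s * (s * exp (- s * (x - B))))" for s
  proof (cases "0 < s")
    case s: True
    have "exp ((of_real x + z) * complex_of_real (- s)) * complex_of_real (binet_weight s)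
      - exp (of_real x * complex_of_real (- s)) * complex_of_real (binet_weight s) =
      complex_of_real (exp (x * - s)) * ((exp (z * complex_of_real (- s)) - 1) * complex_of_real (binet_weight s))"
      unfolding distrib_right exp_add exp_of_real_mult by (simp add: algebra_simps)
    then have "norm (exp ((of_real x + z) * complex_of_real (- s)) * complex_of_real (binet_weight s)
      - exp (of_real x * complex_of_real (- s)) * complex_of_real (binet_weight s)) =
      exp (x * - s) * (norm (exp (z * complex_of_real (- s)) - 1) * binet_weight s)"
      using binet_weight_nonneg[of s] by (simp add: norm_mult)
    also have "\<dots> \<le> exp (x * - s) * ((s * B * exp (s * B)) * 1)"
    proof (intro mult_left_mono mult_mono)
      have "norm (exp (z * complex_of_real (- s)) - 1) \<le> norm (z * complex_of_real (- s)) * exp (max 0 (Re (z * complex_of_real (- s))))"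
        by (rule norm_exp_minus_1_le)
      also have "\<dots> \<le> (s * B) * exp (s * B)"
      proof (intro mult_mono)
        show "norm (z * complex_of_real (- s)) \<le> s * B" using s z by (simp add: norm_mult mult.commute)
        have "s * (- Re z) \<le> s * B" using rz s by (intro mult_left_mono) auto
        then show "exp (max 0 (Re (z * complex_of_real (- s)))) \<le> exp (s * B)" using s B by (simp add: mult.commute)
      qed (use s B in auto)
      finally show "norm (exp (z * complex_of_real (- s)) - 1) \<le> s * B * exp (s * B)" .
    qed (use s B binet_weight_le_1 binet_weight_nonneg in auto)
    also have "\<dots> = B * (s * (exp (x * - s) * exp (s * B)))" by simp
    also have "exp (x * - s) * exp (s * B) = exp (- s * (x - B))" by (simp add: exp_add[symmetric] algebra_simps)
    finally show ?thesis using s by simp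
  qed (use B in \<open>simp add: binet_weight_def indicator_def\<close>)
  have "cbinet (of_real x + z) - cbinet (of_real x) = (LINT s|lborel. exp ((of_real x + z) * complex_of_real (- s)) * complex_of_real (binet_weight s)
      - exp (of_real x * complex_of_real (- s)) * complex_of_real (binet_weight s))"
    unfolding cbinet_def using int by simp
  also have "norm \<dots> \<le> (LINT s|lborel. norm (exp ((of_real x + z) * complex_of_real (- s)) * complex_of_real (binet_weight s)
      - exp (of_real x * complex_of_real (- s)) * complex_of_real (binet_weight s)))"
    by (rule integral_norm_bound)
  also have "\<dots> \<le> (LINT s|lborel. B * (indicator {0..} s * (s * exp (- s * (x - B)))))"
    by (intro integral_mono integrable_norm Bochner_Integration.integrable_diff int integrable_mult_right linear_exp_integral(1) x0 bd)
  also have "\<dots> = B * (1 / (x - B)\<^sup>2)" using linear_exp_integral(2)[OF x0(2)] by simp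
  also have "\<dots> \<le> B * (1 / (x / 2)\<^sup>2)"
    using B x x0 by (intro mult_left_mono divide_left_mono power_mono mult_pos_pos zero_less_power) auto
  finally show ?thesis by (simp add: power_divide mult.commute)
qed

lemma Ln_of_real_mult: "0 < r \<Longrightarrow> u \<noteq> 0 \<Longrightarrow> Ln (of_real r * u) = of_real (ln r) + Ln u"
  by (simp add: Ln_times_of_real Ln_of_real)

lemma Ln_shift:
  assumes "0 < x" "0 < x + Re z" shows "Ln (of_real x + z) = of_real (ln x) + Ln (1 + z / of_real x)"
proof -
  have "of_real x + z = of_real x * (1 + z / of_real x)" using assms(1) by (simp add: field_simps)
  moreover have "of_real x + z \<noteq> 0" using assms(2) by (metis Re_complex_of_real less_irrefl plus_complex.sel(1) zero_complex.sel(1))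
  ultimately have "1 + z / of_real x \<noteq> 0" by auto
  then show ?thesis using Ln_of_real_mult[OF assms(1)] \<open>of_real x + z = of_real x * (1 + z / of_real x)\<close> by simp
qed

text \<open>Binet's formula with \<open>Ln (1 + z / x)\<close> expanded to second order; the main terms combine to
\<open>(z\<^sup>2 - z) / 2\<close>, and the cubic remainder and the Binet integrals contribute terms of order \<open>1 / x\<close>.\<close>
lemma ln_Gamma_ratio_bound:
  fixes z :: complex
  assumes x: "2 * B + 1 \<le> x" and z: "norm z \<le> B"
  shows "norm (of_real x * (ln_Gamma (of_real x + z) - ln_Gamma (of_real x) - z * of_real (ln x)) - (z\<^sup>2 - z) / 2)
     \<le> (B\<^sup>2 + 5 * B ^ 3 + 4 * B) / x"
proof -
  have B: "0 \<le> B" using z norm_ge_zero[of z] by linarith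
  have x0: "0 < x" "1 \<le> x" "2 * B < x" using x B by auto
  have rz: "\<bar>Re z\<bar> \<le> B" using abs_Re_le_cmod[of z] z by linarith
  define X where "X = complex_of_real x"
  have X: "X \<noteq> 0" "norm X = x" using x0 by (auto simp: X_def)
  define u where "u = z / X"
  have nu: "norm u = norm z / x" unfolding u_def using X by (simp add: norm_divide)
  have u: "norm u \<le> 1/2" "norm u \<le> B / x"
    using z x0 B unfolding nu by (auto simp: field_simps)
  define Rm where "Rm = Ln (1 + u) - (u - u\<^sup>2 / 2)"
  define \<Delta> where "\<Delta> = cbinet (X + z) - cbinet X"
  have zu: "z = X * u" using X by (simp add: u_def)
  have "ln_Gamma (X + z) - ln_Gamma X - z * of_real (ln x) =
      (X + z - 1/2) * (of_real (ln x) + Ln (1 + u)) - (X + z) + cbinet (X + z)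
      - ((X - 1/2) * of_real (ln x) - X + cbinet X) - z * of_real (ln x)"
  proof -
    have "ln_Gamma (X + z) = (X + z - 1/2) * Ln (X + z) - (X + z) + of_real (ln (2 * pi) / 2) + cbinet (X + z)"
      using x0 rz by (intro ln_Gamma_complex_binet) (simp add: X_def)
    moreover have "ln_Gamma X = (X - 1/2) * Ln X - X + of_real (ln (2 * pi) / 2) + cbinet X"
      using x0 by (intro ln_Gamma_complex_binet) (simp add: X_def)
    moreover have "Ln X = of_real (ln x)" using x0 unfolding X_def by (simp add: Ln_of_real)
    moreover have "Ln (X + z) = of_real (ln x) + Ln (1 + u)"
      unfolding X_def u_def using x0 rz by (intro Ln_shift) auto
    ultimately show ?thesis by simp
  qed
  also have "\<dots> = (X + z - 1/2) * Ln (1 + u) - z + \<Delta>" by (simp add: \<Delta>_def algebra_simps)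
  also have "Ln (1 + u) = u - u\<^sup>2 / 2 + Rm" by (simp add: Rm_def)
  finally have D: "ln_Gamma (X + z) - ln_Gamma X - z * of_real (ln x) =
      (X + z - 1/2) * (u - u\<^sup>2 / 2 + Rm) - z + \<Delta>" .
  have "X * (Y * (q + R') - z + D') - k = X * (Y * q - z) - k + X * Y * R' + X * D'" for Y q R' D' k
    by (simp add: algebra_simps)
  then have main: "X * (ln_Gamma (X + z) - ln_Gamma X - z * of_real (ln x)) - (z\<^sup>2 - z) / 2 =
     X * ((X + z - 1/2) * (u - u\<^sup>2 / 2) - z) - (z\<^sup>2 - z) / 2 + X * (X + z - 1/2) * Rm + X * \<Delta>"
    unfolding D .
  have "X * ((X + z - 1/2) * (u - u\<^sup>2 / 2) - z) - (z\<^sup>2 - z) / 2 = (z\<^sup>2 / 4 - z ^ 3 / 2) / X"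
    unfolding u_def using X by (simp add: field_simps power2_eq_square power3_eq_cube)
  moreover have "norm ((z\<^sup>2 / 4 - z ^ 3 / 2) / X) \<le> (B\<^sup>2 + B ^ 3) / x"
  proof -
    have "norm (z\<^sup>2 / 4 - z ^ 3 / 2) \<le> norm z ^ 2 / 4 + norm z ^ 3 / 2"
      using norm_triangle_ineq4[of "z\<^sup>2 / 4" "z ^ 3 / 2"] by (simp add: norm_divide norm_power)
    also have "\<dots> \<le> B ^ 2 / 4 + B ^ 3 / 2" using z by (intro add_mono divide_right_mono power_mono) auto
    also have "\<dots> \<le> B\<^sup>2 + B ^ 3" using zero_le_power[OF B, of 2] zero_le_power[OF B, of 3] by linarith
    finally show ?thesis unfolding norm_divide X(2) using x0 by (intro divide_right_mono) auto
  qed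
  moreover have "norm (X * (X + z - 1/2) * Rm) \<le> 4 * B ^ 3 / x"
  proof -
    have "norm (X + z - 1/2) \<le> 2 * x"
    proof -
      have "norm (X + z - 1/2) \<le> norm X + norm z + norm (1/2 :: complex)"
        using norm_triangle_ineq4[of "X + z" "1/2"] norm_triangle_ineq[of X z] by linarith
      also have "\<dots> \<le> 2 * x" using X z x B by (simp add: norm_divide)
      finally show ?thesis .
    qed
    moreover have "norm Rm \<le> 2 * (B / x) ^ 3"
    proof -
      have "norm Rm \<le> 2 * norm u ^ 3" unfolding Rm_def by (rule Ln_cubic_bound[OF u(1)])
      also have "\<dots> \<le> 2 * (B / x) ^ 3" using u(2) by (intro mult_left_mono power_mono) auto
      finally show ?thesis .
    qed
    ultimately have "norm (X * (X + z - 1/2) * Rm) \<le> x * (2 * x) * (2 * (B / x) ^ 3)"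
      unfolding norm_mult X(2) using x0 by (intro mult_mono) auto
    also have "\<dots> = 4 * B ^ 3 / x" using x0 by (simp add: power3_eq_cube power_divide field_simps)
    finally show ?thesis .
  qed
  moreover have "norm (X * \<Delta>) \<le> 4 * B / x"
  proof -
    have "norm (X * \<Delta>) \<le> x * (4 * B / x\<^sup>2)"
      unfolding norm_mult X(2) unfolding \<Delta>_def X_def using x0 by (intro mult_left_mono cbinet_diff_bound z) auto
    also have "\<dots> = 4 * B / x" using x0 by (simp add: power2_eq_square)
    finally show ?thesis .
  qed
  ultimately have "norm (X * (ln_Gamma (X + z) - ln_Gamma X - z * of_real (ln x)) - (z\<^sup>2 - z) / 2) \<le>
     (B\<^sup>2 + B ^ 3) / x + 4 * B ^ 3 / x + 4 * B / x"
    unfolding main using norm_triangle_ineq[of "(z\<^sup>2 / 4 - z ^ 3 / 2) / X + X * (X + z - 1/2) * Rm" "X * \<Delta>"]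
      norm_triangle_ineq[of "(z\<^sup>2 / 4 - z ^ 3 / 2) / X" "X * (X + z - 1/2) * Rm"] by simp
  also have "\<dots> = (B\<^sup>2 + 5 * B ^ 3 + 4 * B) / x" by (simp add: add_divide_distrib)
  finally show ?thesis unfolding X_def .
qed

lemma uniform_limit_bound:
  fixes f :: "nat \<Rightarrow> 'b \<Rightarrow> complex"
  assumes "eventually (\<lambda>n. \<forall>z\<in>K. norm (f n z - l z) \<le> E n) sequentially" "E \<longlonglongrightarrow> 0"
  shows "uniform_limit K f l sequentially"
proof (rule uniform_limitI)
  fix e :: real assume "0 < e"
  then have "eventually (\<lambda>n. E n < e) sequentially" using assms(2) by (rule order_tendstoD(2)[rotated])
  with assms(1) show "\<forall>\<^sub>F n in sequentially. \<forall>z\<in>K. dist (f n z) (l z) < e"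
    by eventually_elim (auto simp: dist_norm intro: le_less_trans)
qed

lemma ln_Gamma_ratio_limit:
  fixes K :: "complex set"
  assumes x: "filterlim x at_top sequentially" and K: "\<And>z. z \<in> K \<Longrightarrow> norm z \<le> B"
  shows "uniform_limit K (\<lambda>n z. of_real (x n) * (ln_Gamma (of_real (x n) + z) - ln_Gamma (of_real (x n)) - z * of_real (ln (x n))))
     (\<lambda>z. (z\<^sup>2 - z) / 2) sequentially"
proof (rule uniform_limit_bound)
  show "\<forall>\<^sub>F n in sequentially. \<forall>z\<in>K. norm (of_real (x n) * (ln_Gamma (of_real (x n) + z) - ln_Gamma (of_real (x n)) - z * of_real (ln (x n))) - (z\<^sup>2 - z) / 2)
     \<le> (B\<^sup>2 + 5 * B ^ 3 + 4 * B) / x n"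
    using filterlim_at_top[THEN iffD1, OF x, rule_format, of "2 * B + 1"]
    by eventually_elim (use ln_Gamma_ratio_bound K in blast)
  show "(\<lambda>n. (B\<^sup>2 + 5 * B ^ 3 + 4 * B) / x n) \<longlonglongrightarrow> 0"
    by (rule tendsto_divide_0[OF tendsto_const filterlim_at_top_imp_at_infinity[OF x]])
qed

lemma ln_Gamma_ratio_limit_0:
  fixes K :: "complex set"
  assumes x: "filterlim x at_top sequentially" and K: "\<And>z. z \<in> K \<Longrightarrow> norm z \<le> B"
  shows "uniform_limit K (\<lambda>n z. ln_Gamma (of_real (x n) + z) - ln_Gamma (of_real (x n)) - z * of_real (ln (x n)))
     (\<lambda>z. 0) sequentially"
proof (rule uniform_limit_bound)
  \<comment> \<open>the error bound for \<open>x n \<ge> 1\<close> plus a bound on \<open>(z\<^sup>2 - z) / 2\<close>\<close>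
  define C where "C = (B\<^sup>2 + 5 * B ^ 3 + 4 * B) + (B\<^sup>2 + B)"
  show "\<forall>\<^sub>F n in sequentially. \<forall>z\<in>K. norm (ln_Gamma (of_real (x n) + z) - ln_Gamma (of_real (x n)) - z * of_real (ln (x n)) - 0) \<le> C / x n"
    using filterlim_at_top[THEN iffD1, OF x, rule_format, of "\<bar>2 * B + 1\<bar> + 1"]
  proof eventually_elim
    case (elim n)
    then have x1: "1 \<le> x n" "2 * B + 1 \<le> x n" by auto
    show ?case
    proof
      fix z assume z: "z \<in> K"
      have B: "0 \<le> B" using K[OF z] norm_ge_zero[of z] by linarith
      have N: "0 \<le> B\<^sup>2 + 5 * B ^ 3 + 4 * B" using B by (intro add_nonneg_nonneg) auto
      let ?d = "ln_Gamma (of_real (x n) + z) - ln_Gamma (of_real (x n)) - z * of_real (ln (x n))"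
      have "norm (of_real (x n) * ?d) \<le> norm (of_real (x n) * ?d - (z\<^sup>2 - z) / 2) + norm ((z\<^sup>2 - z) / 2)"
        using norm_triangle_ineq[of "of_real (x n) * ?d - (z\<^sup>2 - z) / 2" "(z\<^sup>2 - z) / 2"] by simp
      also have "\<dots> \<le> (B\<^sup>2 + 5 * B ^ 3 + 4 * B) / x n + (B\<^sup>2 + B)"
      proof (rule add_mono[OF ln_Gamma_ratio_bound[OF x1(2) K[OF z]]])
        have "norm (z\<^sup>2 - z) \<le> (norm z)\<^sup>2 + norm z" using norm_triangle_ineq4[of "z\<^sup>2" z] by (simp add: norm_power)
        also have "\<dots> \<le> B\<^sup>2 + B" using K[OF z] by (intro add_mono power_mono) auto
        finally have "norm (z\<^sup>2 - z) \<le> B\<^sup>2 + B" .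
        moreover have "0 \<le> B\<^sup>2 + B" using B by simp
        ultimately show "norm ((z\<^sup>2 - z) / 2) \<le> B\<^sup>2 + B" by (simp add: norm_divide)
      qed
      also have "\<dots> \<le> C"
        unfolding C_def using x1 N by (intro add_right_mono) (simp add: divide_le_eq mult_le_cancel_left1)
      finally have "x n * norm ?d \<le> C" using x1 by (simp add: norm_mult)
      then show "norm (?d - 0) \<le> C / x n" using x1 by (simp add: field_simps)
    qed
  qed
  show "(\<lambda>n. C / x n) \<longlonglongrightarrow> 0"
    by (rule tendsto_divide_0[OF tendsto_const filterlim_at_top_imp_at_infinity[OF x]])
qed

section \<open>The logarithm of the Barnes function\<close>

text \<open>The logarithm of a factor of the product that defines the Barnes function.\<close>
definition barnes_term :: "nat \<Rightarrow> complex \<Rightarrow> complex" where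
  "barnes_term i w = of_nat (Suc i) * Ln (1 + w / of_nat (Suc i)) + w\<^sup>2 / 2 * of_real (ln (1 + 1 / real (Suc i))) - w"

definition barnes_series :: "complex \<Rightarrow> complex" where
  "barnes_series w = (\<Sum>i. barnes_term i w)"

text \<open>The three parts of the term cancel up to second order in \<open>w / (i + 1)\<close>.\<close>
lemma barnes_term_bound:
  assumes w: "norm w \<le> B" and i: "2 * B \<le> real (Suc i)"
  shows "norm (barnes_term i w) \<le> (2 * B ^ 3 + B\<^sup>2) * (1 / real (Suc i) ^ 2)"
proof -
  define j where "j = real (Suc i)"
  have j: "0 < j" "1 \<le> j" by (auto simp: j_def)
  have B: "0 \<le> B" using w norm_ge_zero[of w] by linarith
  define J where "J = complex_of_real j"
  have J: "J \<noteq> 0" "norm J = j" "of_nat (Suc i) = J" using j by (auto simp: J_def j_def simp del: of_nat_Suc)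
  define u where "u = w / J"
  have nu: "norm u = norm w / j" unfolding u_def using J by (simp add: norm_divide)
  have u: "norm u \<le> 1/2" "norm u \<le> B / j"
    using w j i unfolding nu j_def[symmetric] by (auto simp: field_simps)
  define Rm where "Rm = Ln (1 + u) - (u - u\<^sup>2 / 2)"
  define r where "r = ln (1 + 1 / j) - 1 / j"
  have "barnes_term i w = J * (u - u\<^sup>2 / 2 + Rm) + w\<^sup>2 / 2 * (1 / J + of_real r) - w"
    unfolding barnes_term_def J(3) j_def[symmetric] Rm_def r_def u_def by (simp add: J_def)
  also have "\<dots> = J * Rm + w\<^sup>2 / 2 * of_real r"
    unfolding u_def using J(1) by (simp add: field_simps power2_eq_square)
  also have "norm \<dots> \<le> norm (J * Rm) + norm (w\<^sup>2 / 2 * of_real r)" by (rule norm_triangle_ineq)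
  also have "\<dots> \<le> 2 * B ^ 3 * (1 / j ^ 2) + B\<^sup>2 * (1 / j ^ 2)"
  proof (rule add_mono)
    have "norm Rm \<le> 2 * norm u ^ 3" unfolding Rm_def by (rule Ln_cubic_bound[OF u(1)])
    also have "\<dots> \<le> 2 * (B / j) ^ 3" using u(2) by (intro mult_left_mono power_mono) auto
    finally have "norm (J * Rm) \<le> j * (2 * (B / j) ^ 3)"
      unfolding norm_mult J(2) using j by (intro mult_left_mono) auto
    also have "\<dots> = 2 * B ^ 3 * (1 / j ^ 2)" using j by (simp add: power3_eq_cube power2_eq_square)
    finally show "norm (J * Rm) \<le> 2 * B ^ 3 * (1 / j ^ 2)" .
    have "\<bar>r\<bar> \<le> (1 / j)\<^sup>2" unfolding r_def using j by (intro abs_ln_one_plus_x_minus_x_bound_nonneg) auto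
    then have r: "\<bar>r\<bar> \<le> 1 / j ^ 2" by (simp add: power_divide)
    have "norm (w\<^sup>2 / 2 * of_real r) \<le> norm w ^ 2 * \<bar>r\<bar>" by (simp add: norm_mult norm_divide norm_power)
    also have "\<dots> \<le> B\<^sup>2 * (1 / j ^ 2)" using w r by (intro mult_mono power_mono) auto
    finally show "norm (w\<^sup>2 / 2 * of_real r) \<le> B\<^sup>2 * (1 / j ^ 2)" .
  qed
  finally show ?thesis by (simp only: j_def distrib_right)
qed

lemma barnes_series_limit:
  assumes K: "\<And>w. w \<in> K \<Longrightarrow> norm w \<le> B"
  shows "uniform_limit K (\<lambda>n w. \<Sum>i<n. barnes_term i w) barnes_series sequentially"
  unfolding barnes_series_def[abs_def]
proof (rule Weierstrass_m_test_ev)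
  have "eventually (\<lambda>i. 2 * B \<le> real (Suc i)) sequentially"
    by (rule eventually_mono[OF eventually_ge_at_top[of "nat \<lceil>2 * B\<rceil>"]]) linarith
  then show "\<forall>\<^sub>F i in sequentially. \<forall>w\<in>K. norm (barnes_term i w) \<le> (2 * B ^ 3 + B\<^sup>2) * (1 / real (Suc i) ^ 2)"
    by eventually_elim (use barnes_term_bound K in blast)
  have "summable (\<lambda>n. 1 / real n ^ 2)" using inverse_power_summable[of 2, where 'a = real] by (simp add: divide_inverse)
  then have "summable (\<lambda>i. 1 / real (Suc i) ^ 2)" by (subst summable_Suc_iff)
  then show "summable (\<lambda>i. (2 * B ^ 3 + B\<^sup>2) * (1 / real (Suc i) ^ 2))" by (rule summable_mult)
qed

lemma barnes_series_sums: "(\<lambda>i. barnes_term i w) sums barnes_series w"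
proof -
  have "uniform_limit {w} (\<lambda>n w. \<Sum>i<n. barnes_term i w) barnes_series sequentially"
    by (rule barnes_series_limit[of _ "norm w"]) simp
  then show ?thesis unfolding sums_def by (rule tendsto_uniform_limitI) simp
qed

lemma Re_gt_minus_one_div:
  assumes "- 1 < Re w" shows "0 < Re (1 + w / of_nat (Suc i))"
proof -
  have e: "Re (1 + w / of_nat (Suc i)) = 1 + Re w / real (Suc i)"
    using Re_divide_of_nat[of w "Suc i"] by simp
  have "- real (Suc i) < Re w" using assms by linarith
  then have "- 1 < Re w / real (Suc i)" by (simp add: less_divide_eq)
  then show ?thesis unfolding e by linarith
qed

lemma barnes_series_holomorphic: "barnes_series holomorphic_on {w. - 1 < Re w}"
proof (rule holomorphic_uniform_sequence)
  show "open {w. - 1 < Re w}" by (rule open_halfspace_Re_gt)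
  show "(\<lambda>w. \<Sum>i<n. barnes_term i w) holomorphic_on {w. - 1 < Re w}" for n
    unfolding barnes_term_def
  proof (intro holomorphic_intros)
    fix i and w :: complex assume "w \<in> {w. - 1 < Re w}"
    then have "0 < Re (1 + w / of_nat (Suc i))" by (intro Re_gt_minus_one_div) simp
    then show "1 + w / of_nat (Suc i) \<notin> \<real>\<^sub>\<le>\<^sub>0" by (auto simp: complex_nonpos_Reals_iff simp del: of_nat_Suc)
  qed (auto simp del: of_nat_Suc)
  fix x :: complex assume "x \<in> {w. - 1 < Re w}"
  then obtain d where d: "0 < d" "cball x d \<subseteq> {w. - 1 < Re w}"
    using open_contains_cball[of "{w. - 1 < Re w}"] open_halfspace_Re_gt[of "-1"] by blast
  have "norm w \<le> norm x + d" if "w \<in> cball x d" for w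
    using that norm_triangle_sub[of w x] by (simp add: dist_norm norm_minus_commute)
  then have "uniform_limit (cball x d) (\<lambda>n w. \<Sum>i<n. barnes_term i w) barnes_series sequentially"
    by (rule barnes_series_limit)
  with d show "\<exists>d>0. cball x d \<subseteq> {w. - 1 < Re w} \<and> uniform_limit (cball x d) (\<lambda>n w. \<Sum>i<n. barnes_term i w) barnes_series sequentially"
    by blast
qed

text \<open>The candidate for the analytic logarithm of \<open>barnes_G\<close>; \<open>z - 1\<close> is the variable of the product formula.\<close>
definition log_barnes :: "complex \<Rightarrow> complex" where
  "log_barnes z = (z - 1) / 2 * of_real (ln (2 * pi)) - (z - 1 + 1) * (z - 1) / 2 + barnes_series (z - 1)"

lemma exp_log_barnes: assumes z: "0 < Re z" shows "exp (log_barnes z) = barnes_G z"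
proof -
  define w where "w = z - 1"
  have w: "- 1 < Re w" using z by (simp add: w_def)
  have factor: "(1 + w / of_nat (Suc i)) ^ Suc i * (1 + 1 / of_nat (Suc i)) powr (w\<^sup>2 / 2) * exp (- w) = exp (barnes_term i w)" for i
  proof -
    have "1 + w / of_nat (Suc i) \<noteq> 0" using Re_gt_minus_one_div[OF w, of i] by (metis less_irrefl zero_complex.sel(1))
    then have "(1 + w / of_nat (Suc i)) ^ Suc i = exp (of_nat (Suc i) * Ln (1 + w / of_nat (Suc i)))"
      by (simp add: exp_of_nat_mult del: of_nat_Suc)
    moreover have "(1 + 1 / of_nat (Suc i) :: complex) = of_real (1 + 1 / real (Suc i))" by simp
    moreover have "complex_of_real (1 + 1 / real (Suc i)) powr (w\<^sup>2 / 2) = exp (w\<^sup>2 / 2 * of_real (ln (1 + 1 / real (Suc i))))"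
    proof -
      have "0 < 1 + 1 / real (Suc i)" by (intro add_pos_pos) auto
      then show ?thesis by (simp add: powr_def Ln_of_real del: of_real_add of_real_divide of_nat_Suc)
    qed
    ultimately show ?thesis unfolding barnes_term_def diff_conv_add_uminus exp_add by simp
  qed
  have "raw_has_prod (\<lambda>i. exp (barnes_term i w)) 0 (exp (barnes_series w))"
    by (rule sums_imp_has_prod_exp[OF barnes_series_sums])
  then have "(\<lambda>i. exp (barnes_term i w)) has_prod exp (barnes_series w)" by (simp add: has_prod_def)
  then have "(\<Prod>i. exp (barnes_term i w)) = exp (barnes_series w)" by (rule has_prod_unique[symmetric])
  moreover have "complex_of_real (2 * pi) powr (w / 2) = exp (w / 2 * of_real (ln (2 * pi)))"
    by (simp add: powr_def Ln_of_real del: of_real_mult)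
  moreover have "log_barnes z = w / 2 * of_real (ln (2 * pi)) + - ((w + 1) * w / 2) + barnes_series w"
    unfolding log_barnes_def w_def by simp
  ultimately show ?thesis
    unfolding barnes_G_def Let_def w_def[symmetric] factor by (simp only: exp_add)
qed

lemma log_barnes_holomorphic: "log_barnes holomorphic_on {z. 0 < Re z}"
proof -
  have "(barnes_series \<circ> (\<lambda>z. z - 1)) holomorphic_on {z. 0 < Re z}"
    by (rule holomorphic_on_compose_gen[OF _ barnes_series_holomorphic]) (auto intro!: holomorphic_intros)
  then show ?thesis unfolding log_barnes_def[abs_def] o_def by (intro holomorphic_intros) auto
qed

lemma log_barnes_real: assumes x: "0 < x" shows "log_barnes (of_real x) \<in> \<real>"
proof -
  have "barnes_term i (of_real (x - 1)) \<in> \<real>" for i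
  proof -
    have "0 < Re (1 + of_real (x - 1) / of_nat (Suc i))" using x by (intro Re_gt_minus_one_div) simp
    then have p: "0 < 1 + (x - 1) / real (Suc i)" using Re_divide_of_nat[of "of_real (x - 1)" "Suc i"] by simp
    have "(1 + of_real (x - 1) / of_nat (Suc i) :: complex) = of_real (1 + (x - 1) / real (Suc i))" by simp
    then have "barnes_term i (of_real (x - 1)) = of_real (real (Suc i) * ln (1 + (x - 1) / real (Suc i)) + (x - 1)\<^sup>2 / 2 * ln (1 + 1 / real (Suc i)) - (x - 1))"
      unfolding barnes_term_def using p by (simp only: Ln_of_real) simp
    then show ?thesis by (simp only: Reals_of_real)
  qed
  then have "barnes_series (of_real (x - 1)) \<in> \<real>"
  proof -
    assume "\<And>i. barnes_term i (of_real (x - 1)) \<in> \<real>"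
    then have "(\<lambda>i. 0) sums Im (barnes_series (of_real (x - 1)))"
      using sums_Im[OF barnes_series_sums[of "of_real (x - 1)"]] by (simp add: complex_is_Real_iff)
    then show ?thesis using sums_unique2[OF _ sums_zero] by (auto simp: complex_is_Real_iff)
  qed
  then show ?thesis unfolding log_barnes_def by (auto intro!: Reals_add Reals_diff Reals_mult Reals_divide)
qed

text \<open>Two logarithms that are real on the positive axis agree there, since the real exponential is injective,
and hence on the half-plane by the identity theorem.\<close>
lemma log_right_half_plane_barnes:
  assumes z: "0 < Re z" shows "log_right_half_plane barnes_G z = log_barnes z"
proof -
  define P where "P = (\<lambda>L. L holomorphic_on {z. 0 < Re z} \<and> (\<forall>z. 0 < Re z \<longrightarrow> exp (L z) = barnes_G z) \<and>
              (\<forall>x::real. 0 < x \<longrightarrow> L (complex_of_real x) \<in> \<real>))"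
  have "P log_barnes" unfolding P_def using exp_log_barnes log_barnes_holomorphic log_barnes_real by blast
  then have L: "P (log_right_half_plane barnes_G)" unfolding log_right_half_plane_def P_def[symmetric] by (rule someI[of P])
  show ?thesis
  proof (rule right_half_plane_identity[OF _ log_barnes_holomorphic _ z])
    show "log_right_half_plane barnes_G holomorphic_on {z. 0 < Re z}" using L unfolding P_def by blast
    fix x :: real assume x: "0 < x"
    obtain a b where a: "log_right_half_plane barnes_G (of_real x) = of_real a" and b: "log_barnes (of_real x) = of_real b"
      using L log_barnes_real[OF x] x unfolding P_def by (auto elim!: Reals_cases)
    have "exp (complex_of_real a) = exp (complex_of_real b)"
      using L exp_log_barnes[of "of_real x"] x a b unfolding P_def by (metis Re_complex_of_real)
    then have "exp a = exp b" by (simp only: exp_of_real of_real_eq_iff)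
    then show "log_right_half_plane barnes_G (of_real x) = log_barnes (of_real x)" unfolding a b by simp
  qed
qed

section \<open>Asymptotics of the product of Gamma quotients\<close>

lemma ln_Gamma_complex_plus1:
  assumes "0 < Re z" shows "ln_Gamma (z + 1) = ln_Gamma z + Ln z"
proof (rule right_half_plane_identity[OF _ _ _ assms])
  show "(\<lambda>z. ln_Gamma (z + 1)) holomorphic_on {z. 0 < Re z}"
  proof -
    have "(ln_Gamma \<circ> (\<lambda>z. z + 1)) holomorphic_on {z. 0 < Re z}"
      by (rule holomorphic_on_compose_gen[OF _ holomorphic_ln_Gamma[of "{z. 0 < Re z}"]])
         (auto intro!: holomorphic_intros simp: complex_nonpos_Reals_iff)
    then show ?thesis by (simp add: o_def)
  qed
  show "(\<lambda>z. ln_Gamma z + Ln z) holomorphic_on {z. 0 < Re z}"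
    by (intro holomorphic_intros holomorphic_ln_Gamma) (auto simp: complex_nonpos_Reals_iff)
  fix x :: real assume x: "0 < x"
  have g: "ln_Gamma (complex_of_real y) = of_real (ln (Gamma y))" if "0 < y" for y
    using that Gamma_real_pos_exp[OF that] by (simp add: ln_Gamma_complex_of_real)
  have "ln (Gamma (x + 1)) = ln (Gamma x) + ln x"
    using Gamma_real_shift[of x 0] x Gamma_real_pos[OF x] by (simp add: ln_mult_pos)
  then show "ln_Gamma (complex_of_real x + 1) = ln_Gamma (of_real x) + Ln (of_real x)"
    using g[of "x + 1"] g[OF x] x by (simp add: Ln_of_real)
qed

lemma sum_Ln_shift:
  assumes w: "- 1 < Re w"
  shows "(\<Sum>k=1..n. Ln (of_nat k + w)) = ln_Gamma (of_nat (n + 1) + w) - ln_Gamma (w + 1)"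
proof (induction n)
  case (Suc n)
  have "0 < Re (of_nat (n + 1) + w)" using w by simp
  from ln_Gamma_complex_plus1[OF this] show ?case using Suc by (simp add: add_ac)
qed (simp add: add.commute)

text \<open>The sum telescopes through the functional equation of the logarithm of Gamma.\<close>
lemma sum_Ln_one_plus:
  assumes w: "- 1 < Re w"
  shows "(\<Sum>k=1..n. Ln (1 + w / of_nat k)) = ln_Gamma (of_nat (n + 1) + w) - ln_Gamma (of_nat (n + 1)) - ln_Gamma (w + 1)"
proof -
  have "(\<Sum>k=1..n. Ln (1 + w / of_nat k)) = (\<Sum>k=1..n. Ln (of_nat k + w) - Ln (of_nat k + 0))"
  proof (rule sum.cong[OF refl])
    fix k assume k: "k \<in> {1..n}"
    have p: "0 < real k" "0 < real k + Re w" using k w by auto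
    show "Ln (1 + w / of_nat k) = Ln (of_nat k + w) - Ln (of_nat k + 0)"
      using Ln_shift[OF p] Ln_of_real[OF p(1)] unfolding of_real_of_nat_eq by (simp only: add_0_right add_diff_cancel_left')
  qed
  also have "\<dots> = (\<Sum>k=1..n. Ln (of_nat k + w)) - (\<Sum>k=1..n. Ln (of_nat k + 0))" by (rule sum_subtractf)
  also have "\<dots> = ln_Gamma (of_nat (n + 1) + w) - ln_Gamma (of_nat (n + 1)) - ln_Gamma (w + 1)"
    using sum_Ln_shift[OF w, of n] sum_Ln_shift[of 0 n] ln_Gamma_complex_conv_fact[of 1] by simp
  finally show ?thesis .
qed

lemma sum_ln_fact: "(\<Sum>k=1..n. ln (real k)) = ln (Gamma (real n + 1))"
proof (induction n)
  case (Suc n)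
  have "Gamma (real n + 1 + 1) = (real n + 1) * Gamma (real n + 1)" using Gamma_real_shift[of "real n + 1" 0] by simp
  then show ?case using Suc Gamma_real_pos[of "real n + 1"] by (simp add: ln_mult_pos add_ac)
qed simp

lemma exp_ln_Gamma_complex: "0 < Re z \<Longrightarrow> exp (ln_Gamma z) = Gamma (z :: complex)"
  using Re_pos_not_nonpos_Ints[of z] by (simp add: Gamma_def rGamma_complex_altdef exp_minus)

definition log_gamma_product :: "real \<Rightarrow> nat \<Rightarrow> complex \<Rightarrow> complex" where
  "log_gamma_product g n z = (\<Sum>k=1..n. ln_Gamma (of_real (g * real k) + z) - ln_Gamma (of_real (g * real k)))"

lemma exp_log_gamma_product:
  assumes g: "0 < g" and z: "- g < Re z" shows "exp (log_gamma_product g n z) = gamma_product g n z"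
proof -
  have "exp (ln_Gamma (of_real (g * real k) + z) - ln_Gamma (of_real (g * real k))) = Gamma (of_real (g * real k) + z) / Gamma (of_real (g * real k))"
    if k: "k \<in> {1..n}" for k
  proof -
    have "g * 1 \<le> g * real k" using k g by (intro mult_left_mono) auto
    then have "0 < g * real k + Re z" "0 < g * real k" using g z by linarith+
    then have "0 < Re (of_real (g * real k) + z)" "0 < Re (complex_of_real (g * real k))" by simp_all
    then show ?thesis by (simp only: exp_diff exp_ln_Gamma_complex)
  qed
  then show ?thesis unfolding log_gamma_product_def gamma_product_def by (simp add: exp_sum)
qed

lemma uniform_limit_mult_bounded:
  fixes h :: "'b \<Rightarrow> complex"
  assumes f: "uniform_limit K f l F" and h: "\<And>z. z \<in> K \<Longrightarrow> norm (h z) \<le> C"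
  shows "uniform_limit K (\<lambda>n z. h z * f n z) (\<lambda>z. h z * l z) F"
proof (rule uniform_limitI)
  fix e :: real assume e: "0 < e"
  define C' where "C' = \<bar>C\<bar> + 1"
  have C': "0 < C'" "\<And>z. z \<in> K \<Longrightarrow> norm (h z) \<le> C'" using h by (fastforce simp: C'_def)+
  have "\<forall>\<^sub>F n in F. \<forall>z\<in>K. dist (f n z) (l z) < e / C'" using uniform_limitD[OF f] e C' by simp
  then show "\<forall>\<^sub>F n in F. \<forall>z\<in>K. dist (h z * f n z) (h z * l z) < e"
  proof eventually_elim
    case (elim n)
    show ?case
    proof
      fix z assume z: "z \<in> K"
      have "dist (h z * f n z) (h z * l z) = norm (h z) * dist (f n z) (l z)"
        by (simp add: dist_norm norm_mult flip: right_diff_distrib)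
      also have "\<dots> \<le> C' * dist (f n z) (l z)" using C' z by (intro mult_right_mono) auto
      also have "\<dots> < C' * (e / C')" using C' elim z by (intro mult_strict_left_mono) auto
      finally show "dist (h z * f n z) (h z * l z) < e" using C' by simp
    qed
  qed
qed

lemma uniform_limit_tendsto_const:
  "(f \<longlongrightarrow> l) F \<Longrightarrow> uniform_limit K (\<lambda>n z. complex_of_real (f n)) (\<lambda>z. of_real l) F"
  by (rule uniform_limitI) (auto dest: tendstoD elim!: eventually_mono simp: dist_of_real)

text \<open>The coefficient of \<open>z\<close> in the expansion of \<open>log_gamma_product (\<beta>/2) n z\<close>; it is \<open>mu_L\<close> without the part
\<open>n * ln 2\<close> that comes from the scale of the exponential weight.\<close>
definition log_gamma_center :: "real \<Rightarrow> nat \<Rightarrow> real" where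
  "log_gamma_center \<beta> n = (1/2 - 1/\<beta>) * ln (real n) - real n + real n * ln (\<beta>/2 * real n)"

text \<open>Collects the coefficients of \<open>l = ln n\<close> and of \<open>n\<close>; \<open>e1\<close>, \<open>e2\<close>, \<open>e3\<close> stand for the errors that tend to 0.\<close>
lemma exponent_algebra:
  fixes z :: complex
  assumes g: "g \<noteq> 0" and z: "z = g * w"
  shows "z * (N * lg + (e1 + (N * l - N + P + l / 2))) + g * (S - w\<^sup>2 / 2 * (e3 + l) + N * w)
      + (z - 1/2) * (e2 + w * (e3 + l) - G) - N * z + b'
      - z * ((1/2 - 1 / (2 * g)) * l - N + (N * lg + N * l)) - z\<^sup>2 / (2 * g) * l =
    g * S + z * P + z * e1 - z\<^sup>2 / (2 * g) * e3 + (z - 1/2) * e2 + ((z - 1/2) * w) * e3 - (z - 1/2) * G + b'"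
proof -
  have a: "z\<^sup>2 / (2 * g) = z * w / 2" unfolding z using g by (simp add: power2_eq_square)
  have b: "z * ((1/2 - 1 / (2 * g)) * l - N + (N * lg + N * l)) = z * l / 2 - w * l / 2 - z * N + z * N * lg + z * N * l"
    unfolding z using g by (simp add: algebra_simps)
  have c: "g * (S - w\<^sup>2 / 2 * (e3 + l) + N * w) = g * S - z * w / 2 * (e3 + l) + N * z"
    unfolding z by (simp add: algebra_simps power2_eq_square)
  show ?thesis unfolding a b c by (simp add: algebra_simps add_divide_distrib)
qed

text \<open>The heart of the asymptotics. With \<open>w = z / g\<close>, Binet's formula splits the summand with index \<open>k\<close> into
\<open>z * ln (g * k)\<close>, which sums to a factorial and is handled by Stirling's formula; \<open>g * k * Ln (1 + w / k)\<close>,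
whose sum is a partial product of the Barnes function; \<open>(z - 1/2) * Ln (1 + w / k)\<close>, whose sum is a
quotient of Gamma values; and a difference of Binet integrals. The limits add up to
\<open>Upsilon\<close>: the summand \<open>z / 2 * ln (2 * pi)\<close> from Stirling's formula and the explicit factors in the product
formula of the Barnes function account for \<open>z\<^sup>2 / \<beta> + z / 2\<close>.\<close>
lemma log_gamma_product_limit:
  assumes \<beta>: "0 < \<beta>" and \<kappa>: "0 < \<kappa>" "\<kappa> \<le> \<beta>/2"
    and K: "\<And>z. z \<in> K \<Longrightarrow> - (\<beta>/2) + \<kappa> \<le> Re z" "\<And>z. z \<in> K \<Longrightarrow> norm z \<le> B"
  shows "uniform_limit K (\<lambda>n z. log_gamma_product (\<beta>/2) n z - z * of_real (log_gamma_center \<beta> n) - z\<^sup>2 / of_real \<beta> * of_real (ln (real n)))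
    (Upsilon \<beta>) sequentially"
proof -
  define g where "g = \<beta>/2"
  have g: "0 < g" using \<beta> by (simp add: g_def)
  define e1 where "e1 n = ln (Gamma (real n + 1)) - (real n * ln (real n) - real n + ln (2 * pi) / 2 + ln (real n) / 2)" for n
  define e3 where "e3 n = ln (real n + 1) - ln (real n)" for n
  define W where "W z = z / of_real g" for z :: complex
  define e2 where "e2 n z = ln_Gamma (of_real (real n + 1) + W z) - ln_Gamma (of_real (real n + 1)) - W z * of_real (ln (real n + 1))" for n z
  have nW: "norm (W z) \<le> B / g" if "z \<in> K" for z
    unfolding W_def norm_divide using K(2)[OF that] g by (simp add: divide_right_mono)
  have rW: "- 1 < Re (W z)" if "z \<in> K" for z
  proof -
    have "- g < Re z" using K(1)[OF that] \<kappa> g_def by linarith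
    then show ?thesis unfolding W_def using g by (simp add: less_divide_eq)
  qed
  have e1: "e1 \<longlonglongrightarrow> 0"
  proof -
    have "e1 = (\<lambda>n. ((real n + 1/2) * (ln (real n + 1) - ln (real n)) - 1) + binet (real n + 1))"
      unfolding e1_def using ln_Gamma_binet[of "real n + 1" for n] by (intro ext) (simp add: algebra_simps)
    moreover have "(\<lambda>n. (real n + 1/2) * (ln (real n + 1) - ln (real n)) - 1) \<longlonglongrightarrow> 0" by real_asymp
    moreover have "(\<lambda>n. binet (real n + 1)) \<longlonglongrightarrow> 0"
      by (rule filterlim_compose[OF binet_tendsto_0]) real_asymp
    ultimately show ?thesis using tendsto_add_zero by blast
  qed
  have e3: "e3 \<longlonglongrightarrow> 0" unfolding e3_def by real_asymp
  have xlim: "filterlim (\<lambda>n. real n + 1) at_top sequentially" by real_asymp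
  have e2: "uniform_limit K e2 (\<lambda>z. 0) sequentially"
  proof -
    have "uniform_limit (W ` K) (\<lambda>n z. ln_Gamma (of_real (real n + 1) + z) - ln_Gamma (of_real (real n + 1)) - z * of_real (ln (real n + 1))) (\<lambda>z. 0) sequentially"
      by (rule ln_Gamma_ratio_limit_0[OF xlim, of _ "B / g"]) (use nW in auto)
    from uniform_limit_compose'[OF this, of W K] show ?thesis unfolding e2_def by simp
  qed
  have bs: "uniform_limit K (\<lambda>n z. \<Sum>i<n. barnes_term i (W z)) (\<lambda>z. barnes_series (W z)) sequentially"
  proof -
    have "uniform_limit (W ` K) (\<lambda>n w. \<Sum>i<n. barnes_term i w) barnes_series sequentially"
      by (rule barnes_series_limit[of _ "B / g"]) (use nW in auto)
    from uniform_limit_compose'[OF this, of W K] show ?thesis by simp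
  qed
  have bin: "uniform_limit K (\<lambda>n z. \<Sum>k=1..n. cbinet (of_real (g * real k) + z) - cbinet (of_real (g * real k)))
    (\<lambda>z. LINT s|lborel. binet_kernel g z s) sequentially"
    by (rule binet_sum_limit[OF g \<kappa>(1), of K B]) (use \<kappa> K g_def in auto)
  define R where "R n z = of_real g * (\<Sum>i<n. barnes_term i (W z)) + z * of_real (ln (2 * pi) / 2)
      + z * of_real (e1 n) - z\<^sup>2 / of_real \<beta> * of_real (e3 n)
      + (z - 1/2) * e2 n z + ((z - 1/2) * W z) * of_real (e3 n) - (z - 1/2) * ln_Gamma (W z + 1)
      + (\<Sum>k=1..n. cbinet (of_real (g * real k) + z) - cbinet (of_real (g * real k)))" for n z
  have eq: "log_gamma_product g n z - z * of_real (log_gamma_center \<beta> n) - z\<^sup>2 / of_real \<beta> * of_real (ln (real n)) = R n z" if z: "z \<in> K" for n z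
  proof -
    define w where "w = W z"
    have zw: "z = of_real g * w" unfolding w_def W_def using g by simp
    have summand: "ln_Gamma (of_real (g * real k) + z) - ln_Gamma (of_real (g * real k)) =
        z * of_real (ln (g * real k)) + of_real g * (of_nat k * Ln (1 + w / of_nat k)) + (z - 1/2) * Ln (1 + w / of_nat k) - z
        + (cbinet (of_real (g * real k) + z) - cbinet (of_real (g * real k)))" if k: "k \<in> {1..n}" for k
    proof -
      have gk: "g * 1 \<le> g * real k" using k g by (intro mult_left_mono) auto
      have p: "0 < g * real k" "0 < g * real k + Re z" using gk g K(1)[OF z] \<kappa> g_def by linarith+
      have "Ln (of_real (g * real k) + z) = of_real (ln (g * real k)) + Ln (1 + z / of_real (g * real k))"
        by (rule Ln_shift[OF p])
      also have "z / of_real (g * real k) = w / of_nat k" using g by (simp add: zw)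
      finally have L1: "Ln (of_real (g * real k) + z) = of_real (ln (g * real k)) + Ln (1 + w / of_nat k)" .
      have L2: "Ln (of_real (g * real k)) = of_real (ln (g * real k))" by (rule Ln_of_real[OF p(1)])
      have r: "0 < Re (of_real (g * real k) + z)" "0 < Re (complex_of_real (g * real k))" using p by simp_all
      show ?thesis
        unfolding ln_Gamma_complex_binet[OF r(1)] ln_Gamma_complex_binet[OF r(2)] L1 L2
        by (simp add: algebra_simps)
    qed
    have s1: "(\<Sum>k=1..n. ln (g * real k)) = real n * ln g + ln (Gamma (real n + 1))"
    proof -
      have "(\<Sum>k=1..n. ln (g * real k)) = (\<Sum>k=1..n. ln g + ln (real k))"
        using g by (intro sum.cong refl) (simp add: ln_mult_pos)
      then show ?thesis unfolding sum.distrib sum_ln_fact by simp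
    qed
    have s2: "(\<Sum>k=1..n. of_nat k * Ln (1 + w / of_nat k)) = (\<Sum>i<n. barnes_term i w) - w\<^sup>2 / 2 * of_real (ln (real n + 1)) + of_nat n * w"
    proof (induction n)
      case (Suc n)
      have "ln (1 + 1 / real (Suc n)) = ln (real (Suc n) + 1) - ln (real (Suc n))"
      proof -
        have "1 + 1 / real (Suc n) = (real (Suc n) + 1) / real (Suc n)" by (simp add: field_simps)
        then show ?thesis by (simp add: ln_div)
      qed
      then have "of_nat (Suc n) * Ln (1 + w / of_nat (Suc n)) =
          barnes_term n w - w\<^sup>2 / 2 * (of_real (ln (real (Suc n) + 1)) - of_real (ln (real (Suc n)))) + w"
        unfolding barnes_term_def by simp
      moreover have "(\<Sum>k=1..Suc n. of_nat k * Ln (1 + w / of_nat k)) =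
          (\<Sum>k=1..n. of_nat k * Ln (1 + w / of_nat k)) + of_nat (Suc n) * Ln (1 + w / of_nat (Suc n))" by simp
      moreover have "real n + 1 = real (Suc n)" by simp
      ultimately show ?case unfolding Suc by (simp only: sum.lessThan_Suc) (simp add: algebra_simps)
    qed simp
    have s3: "(\<Sum>k=1..n. Ln (1 + w / of_nat k)) = e2 n z + w * of_real (ln (real n + 1)) - ln_Gamma (w + 1)"
      using sum_Ln_one_plus[OF rW[OF z], of n] unfolding e2_def w_def by (simp add: add_ac)
    have lgeq: "log_gamma_product g n z = z * of_real (\<Sum>k=1..n. ln (g * real k)) + of_real g * (\<Sum>k=1..n. of_nat k * Ln (1 + w / of_nat k))
       + (z - 1/2) * (\<Sum>k=1..n. Ln (1 + w / of_nat k)) - of_nat n * z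
       + (\<Sum>k=1..n. cbinet (of_real (g * real k) + z) - cbinet (of_real (g * real k)))"
    proof -
      have "log_gamma_product g n z = (\<Sum>k=1..n. z * of_real (ln (g * real k)) + of_real g * (of_nat k * Ln (1 + w / of_nat k)) + (z - 1/2) * Ln (1 + w / of_nat k) - z
        + (cbinet (of_real (g * real k) + z) - cbinet (of_real (g * real k))))"
        unfolding log_gamma_product_def by (rule sum.cong[OF refl summand])
      also have "\<dots> = (\<Sum>k=1..n. z * of_real (ln (g * real k))) + (\<Sum>k=1..n. of_real g * (of_nat k * Ln (1 + w / of_nat k)))
         + (\<Sum>k=1..n. (z - 1/2) * Ln (1 + w / of_nat k)) - (\<Sum>k=1..n. z)
         + (\<Sum>k=1..n. cbinet (of_real (g * real k) + z) - cbinet (of_real (g * real k)))"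
        by (simp only: sum.distrib sum_subtractf)
      also have "(\<Sum>k=1..n. z) = of_nat n * z" by simp
      finally show ?thesis unfolding sum_distrib_left[symmetric] of_real_sum .
    qed
    have cen: "log_gamma_center \<beta> n = (1/2 - 1 / (2 * g)) * ln (real n) - real n + (real n * ln g + real n * ln (real n))"
    proof -
      have "real n * ln (g * real n) = real n * ln g + real n * ln (real n)"
        using g by (cases "n = 0") (simp_all add: ln_mult_pos distrib_left)
      moreover have "1 / \<beta> = 1 / (2 * g)" by (simp add: g_def)
      ultimately show ?thesis unfolding log_gamma_center_def g_def[symmetric] by (simp only:)
    qed
    have l1: "ln (Gamma (real n + 1)) = e1 n + (real n * ln (real n) - real n + ln (2 * pi) / 2 + ln (real n) / 2)"
      by (simp add: e1_def)
    have l3: "ln (real n + 1) = e3 n + ln (real n)" by (simp add: e3_def)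
    have b2: "of_real \<beta> = 2 * complex_of_real g" by (simp add: g_def)
    have g0: "complex_of_real g \<noteq> 0" using g by simp
    have ofr: "complex_of_real (real n * ln g + (e1 n + (real n * ln (real n) - real n + ln (2 * pi) / 2 + ln (real n) / 2))) =
        of_nat n * of_real (ln g) + (of_real (e1 n) + (of_nat n * of_real (ln (real n)) - of_nat n + of_real (ln (2 * pi) / 2) + of_real (ln (real n)) / 2))"
      "complex_of_real ((1/2 - 1 / (2 * g)) * ln (real n) - real n + (real n * ln g + real n * ln (real n))) =
        (1/2 - 1 / (2 * of_real g)) * of_real (ln (real n)) - of_nat n + (of_nat n * of_real (ln g) + of_nat n * of_real (ln (real n)))"
      "complex_of_real (e3 n + ln (real n)) = of_real (e3 n) + of_real (ln (real n))"
      by simp_all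
    show ?thesis
      unfolding R_def lgeq s1 s2 s3 w_def[symmetric] cen l1 l3 b2 ofr
      by (rule exponent_algebra[OF g0 zw])
  qed
  have bz: "norm z \<le> B" "norm (z - 1/2) \<le> B + 1/2" "norm (z\<^sup>2 / of_real \<beta>) \<le> B\<^sup>2 / \<beta>" "norm ((z - 1/2) * W z) \<le> (B + 1/2) * (B / g)"
    if z: "z \<in> K" for z
  proof -
    show B: "norm z \<le> B" by (rule K(2)[OF z])
    have B0: "0 \<le> B" using B norm_ge_zero[of z] by linarith
    have "norm (1/2 :: complex) = 1/2" by simp
    then show h: "norm (z - 1/2) \<le> B + 1/2" using B norm_triangle_ineq4[of z "1/2"] by linarith
    show "norm (z\<^sup>2 / of_real \<beta>) \<le> B\<^sup>2 / \<beta>"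
      unfolding norm_divide norm_power using B \<beta> by (simp add: divide_right_mono power_mono)
    show "norm ((z - 1/2) * W z) \<le> (B + 1/2) * (B / g)"
      unfolding norm_mult using h nW[OF z] B0 by (intro mult_mono) auto
  qed
  define L' where "L' z = of_real g * barnes_series (W z) + z * of_real (ln (2 * pi) / 2)
      + z * of_real 0 - z\<^sup>2 / of_real \<beta> * of_real 0
      + (z - 1/2) * 0 + ((z - 1/2) * W z) * of_real 0 - (z - 1/2) * ln_Gamma (W z + 1)
      + (LINT s|lborel. binet_kernel g z s)" for z
  have lim: "uniform_limit K R L' sequentially"
  proof -
    have u1: "uniform_limit K (\<lambda>n z. of_real g * (\<Sum>i<n. barnes_term i (W z))) (\<lambda>z. of_real g * barnes_series (W z)) sequentially"
      by (rule uniform_limit_mult_bounded[OF bs order_refl])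
    have u2: "uniform_limit K (\<lambda>n z. z * of_real (e1 n)) (\<lambda>z. z * of_real 0) sequentially"
      by (rule uniform_limit_mult_bounded[OF uniform_limit_tendsto_const[OF e1] bz(1)])
    have u3: "uniform_limit K (\<lambda>n z. z\<^sup>2 / of_real \<beta> * of_real (e3 n)) (\<lambda>z. z\<^sup>2 / of_real \<beta> * of_real 0) sequentially"
      by (rule uniform_limit_mult_bounded[OF uniform_limit_tendsto_const[OF e3] bz(3)])
    have u4: "uniform_limit K (\<lambda>n z. (z - 1/2) * e2 n z) (\<lambda>z. (z - 1/2) * 0) sequentially"
      by (rule uniform_limit_mult_bounded[OF e2 bz(2)])
    have u5: "uniform_limit K (\<lambda>n z. ((z - 1/2) * W z) * of_real (e3 n)) (\<lambda>z. ((z - 1/2) * W z) * of_real 0) sequentially"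
      by (rule uniform_limit_mult_bounded[OF uniform_limit_tendsto_const[OF e3] bz(4)])
    show ?thesis unfolding R_def[abs_def] L'_def[abs_def]
      by (intro uniform_limit_add uniform_limit_minus u1 u2 u3 u4 u5 bin uniform_limit_const)
  qed
  have ptw: "L' z = Upsilon \<beta> z" if z: "z \<in> K" for z
  proof -
    have arg: "2 * z / of_real \<beta> + 1 = W z + 1" unfolding W_def g_def by simp
    have "0 < Re (W z + 1)" using rW[OF z] by simp
    from log_right_half_plane_barnes[OF this]
    have lb: "log_right_half_plane barnes_G (W z + 1) = W z / 2 * of_real (ln (2 * pi)) - (W z + 1) * W z / 2 + barnes_series (W z)"
      by (simp add: log_barnes_def)
    have int: "(LINT s:{0<..}|lborel. of_real (phi s) * (exp (- (of_real s * z)) - 1) / of_real (exp (s * \<beta> / 2) - 1)) =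
        (LINT s|lborel. binet_kernel g z s)"
      unfolding set_lebesgue_integral_def
      by (intro Bochner_Integration.integral_cong refl) (auto simp: indicator_def binet_kernel_def binet_weight_def g_def)
    have zW: "z = of_real g * W z" using g by (simp add: W_def)
    have "of_real (\<beta>/2) * (W z / 2 * of_real (ln (2 * pi)) - (W z + 1) * W z / 2 + barnes_series (W z)) + z\<^sup>2 / of_real \<beta> + z / 2 =
        of_real g * barnes_series (W z) + z * of_real (ln (2 * pi) / 2)"
    proof -
      have alg: "G * (w / 2 * p - (w + 1) * w / 2 + b) + (G * w)\<^sup>2 / (2 * G) + G * w / 2 = G * b + G * w * (p / 2)"
        if "G \<noteq> 0" for G w p b :: complex
        using that by (simp add: field_simps power2_eq_square)
      have "of_real (\<beta>/2) = complex_of_real g" "of_real \<beta> = 2 * complex_of_real g" "complex_of_real g \<noteq> 0"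
        using g by (auto simp: g_def)
      with alg[of "of_real g" "W z" "of_real (ln (2 * pi))" "barnes_series (W z)"] show ?thesis
        unfolding zW[symmetric] by simp
    qed
    moreover have "Upsilon \<beta> z = (of_real (\<beta>/2) * (W z / 2 * of_real (ln (2 * pi)) - (W z + 1) * W z / 2 + barnes_series (W z)) + z\<^sup>2 / of_real \<beta> + z / 2)
       - (z - 1/2) * ln_Gamma (W z + 1) + (LINT s|lborel. binet_kernel g z s)"
    proof -
      have "x - y + i + a + b = (x + a + b) - y + i" for x y i a b :: complex by simp
      then show ?thesis unfolding Upsilon_def arg lb int .
    qed
    ultimately show ?thesis
      by (simp only: L'_def of_real_0 mult_zero_right add_0_right diff_zero)
  qed
  have limR: "uniform_limit K R (Upsilon \<beta>) sequentially"
  proof (rule uniform_limitI)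
    fix e :: real assume "0 < e"
    from uniform_limitD[OF lim this] show "\<forall>\<^sub>F n in sequentially. \<forall>z\<in>K. dist (R n z) (Upsilon \<beta> z) < e"
      by eventually_elim (metis ptw)
  qed
  have "uniform_limit K (\<lambda>n z. log_gamma_product g n z - z * of_real (log_gamma_center \<beta> n) - z\<^sup>2 / of_real \<beta> * of_real (ln (real n)))
      (Upsilon \<beta>) sequentially"
  proof (rule uniform_limitI)
    fix e :: real assume "0 < e"
    from uniform_limitD[OF limR this]
    show "\<forall>\<^sub>F n in sequentially. \<forall>z\<in>K. dist (log_gamma_product g n z - z * of_real (log_gamma_center \<beta> n) - z\<^sup>2 / of_real \<beta> * of_real (ln (real n))) (Upsilon \<beta> z) < e"
      by eventually_elim (metis eq)
  qed
  then show ?thesis unfolding g_def .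
qed

section \<open>Mod-Gaussian convergence of the three ensembles\<close>

text \<open>The exponential is uniformly continuous on bounded sets only, which is why the limit has to be bounded.\<close>
lemma uniform_limit_exp:
  fixes f :: "nat \<Rightarrow> 'b \<Rightarrow> complex"
  assumes f: "uniform_limit K f l sequentially" and l: "\<And>z. z \<in> K \<Longrightarrow> norm (l z) \<le> C"
  shows "uniform_limit K (\<lambda>n z. exp (f n z)) (\<lambda>z. exp (l z)) sequentially"
proof (rule uniform_limitI)
  fix e :: real assume e: "0 < e"
  \<comment> \<open>from \<open>norm (exp d - 1) \<le> norm d * exp (norm d)\<close>, with \<open>norm d \<le> 1\<close> in the exponent\<close>
  define \<delta> where "\<delta> = min 1 (e / (2 * exp C * exp 1))"
  have \<delta>: "0 < \<delta>" "\<delta> \<le> 1" "\<delta> \<le> e / (2 * exp C * exp 1)" using e by (auto simp: \<delta>_def)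
  from uniform_limitD[OF f \<delta>(1)]
  show "\<forall>\<^sub>F n in sequentially. \<forall>z\<in>K. dist (exp (f n z)) (exp (l z)) < e"
  proof eventually_elim
    case (elim n)
    show ?case
    proof
      fix z assume z: "z \<in> K"
      define d where "d = f n z - l z"
      have d: "norm d \<le> \<delta>" using elim z by (auto simp: d_def dist_norm less_imp_le)
      have "Re (l z) \<le> C" using l[OF z] complex_Re_le_cmod[of "l z"] by linarith
      then have el: "norm (exp (l z)) \<le> exp C" by simp
      have "exp (f n z) - exp (l z) = exp (l z) * (exp d - 1)"
        by (simp add: d_def exp_diff right_diff_distrib)
      then have "dist (exp (f n z)) (exp (l z)) = norm (exp (l z)) * norm (exp d - 1)"
        by (simp add: dist_norm norm_mult)
      also have "\<dots> \<le> exp C * (\<delta> * exp 1)"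
      proof (intro mult_mono el)
        have "norm (exp d - 1) \<le> norm d * exp (norm d)" by (rule exp_quotient_bound)
        also have "\<dots> \<le> \<delta> * exp 1" using d \<delta> by (intro mult_mono) auto
        finally show "norm (exp d - 1) \<le> \<delta> * exp 1" .
      qed auto
      also have "\<dots> = \<delta> * (exp C * exp 1)" by simp
      also have "\<dots> \<le> e / (2 * exp C * exp 1) * (exp C * exp 1)" using \<delta> by (intro mult_right_mono) auto
      also have "\<dots> = e / 2" by simp
      also have "\<dots> < e" using e by simp
      finally show "dist (exp (f n z)) (exp (l z)) < e" .
    qed
  qed
qed

text \<open>The sets on which the error estimates are uniform: bounded, and at a positive distance from the line
\<open>Re z = - g\<close>.\<close>
definition truncated_half_plane :: "real \<Rightarrow> complex set \<Rightarrow> bool" where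
  "truncated_half_plane g K \<longleftrightarrow> (\<exists>\<kappa> B. 0 < \<kappa> \<and> \<kappa> \<le> g \<and> (\<forall>z\<in>K. - g + \<kappa> \<le> Re z \<and> norm z \<le> B))"

lemma truncated_half_plane_cball:
  assumes g: "0 < g" and z: "- g < Re z"
  obtains r where "0 < r" "truncated_half_plane g (cball z r)" "cball z r \<subseteq> {w. - g < Re w}"
proof -
  define \<kappa> where "\<kappa> = min g ((Re z + g) / 2)"
  \<comment> \<open>half of the distance of \<open>z\<close> from the boundary line serves as the radius\<close>
  define r where "r = (Re z + g) / 2"
  have r: "0 < r" "0 < \<kappa>" "\<kappa> \<le> g" "\<kappa> \<le> r"
    using g z unfolding \<kappa>_def r_def by (simp_all only: min.cobounded1 min.cobounded2 min_less_iff_conj) auto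
  have "- g + \<kappa> \<le> Re w \<and> norm w \<le> norm z + r" if "w \<in> cball z r" for w
  proof -
    have d: "norm (z - w) \<le> r" using that by (simp add: dist_norm)
    have "\<bar>Re z - Re w\<bar> \<le> r" using abs_Re_le_cmod[of "z - w"] d by simp
    then have "Re z - Re w \<le> r" by linarith
    moreover have "2 * r = Re z + g" by (simp add: r_def)
    ultimately have "- g + \<kappa> \<le> Re w" using r(4) by linarith
    moreover have "norm w \<le> norm z + r" using norm_triangle_sub[of w z] d by (simp add: norm_minus_commute)
    ultimately show ?thesis by simp
  qed
  then have "truncated_half_plane g (cball z r)" "cball z r \<subseteq> {w. - g < Re w}"
    unfolding truncated_half_plane_def using r by (blast, force)
  with r(1) show ?thesis by (rule that)
qed

lemma log_gamma_product_limit_truncated_half_plane: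
  assumes "0 < \<beta>" "truncated_half_plane (\<beta>/2) K"
  shows "uniform_limit K (\<lambda>n z. log_gamma_product (\<beta>/2) n z - z * of_real (log_gamma_center \<beta> n) - z\<^sup>2 / of_real \<beta> * of_real (ln (real n)))
    (Upsilon \<beta>) sequentially"
  using assms log_gamma_product_limit[of \<beta> _ K] unfolding truncated_half_plane_def by blast

lemma log_gamma_product_continuous:
  assumes g: "0 < g" and K: "K \<subseteq> {w. - g < Re w}" shows "continuous_on K (log_gamma_product g n)"
  unfolding log_gamma_product_def[abs_def]
proof (rule continuous_at_imp_continuous_on, rule ballI)
  fix z assume z: "z \<in> K"
  have "complex_of_real (g * real k) + z \<notin> \<real>\<^sub>\<le>\<^sub>0 \<and> complex_of_real (g * real k) \<notin> \<real>\<^sub>\<le>\<^sub>0" if k: "k \<in> {1..n}" for k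
  proof -
    have "g * 1 \<le> g * real k" using k g by (intro mult_left_mono) auto
    moreover have "- g < Re z" using K z by auto
    ultimately have "0 < g * real k + Re z" "0 < g * real k" using g by linarith+
    then show ?thesis by (simp add: complex_nonpos_Reals_iff)
  qed
  then show "isCont (\<lambda>z. \<Sum>k=1..n. ln_Gamma (of_real (g * real k) + z) - ln_Gamma (of_real (g * real k))) z"
    by (intro continuous_sum continuous_diff isCont_ln_Gamma_complex continuous_add continuous_const continuous_ident) auto
qed

text \<open>\<open>Upsilon\<close> is continuous as a locally uniform limit of continuous functions.\<close>
lemma Upsilon_bounded:
  assumes \<beta>: "0 < \<beta>" and K: "compact K" "truncated_half_plane (\<beta>/2) K" "K \<subseteq> {w. - (\<beta>/2) < Re w}"
  obtains C where "\<And>z. z \<in> K \<Longrightarrow> norm (Upsilon \<beta> z) \<le> C"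
proof -
  have "continuous_on K (Upsilon \<beta>)"
  proof (rule uniform_limit_theorem[OF _ log_gamma_product_limit_truncated_half_plane[OF \<beta> K(2)]])
    show "\<forall>\<^sub>F n in sequentially. continuous_on K (\<lambda>z. log_gamma_product (\<beta>/2) n z - z * of_real (log_gamma_center \<beta> n) - z\<^sup>2 / of_real \<beta> * of_real (ln (real n)))"
      using \<beta> K(3) by (intro always_eventually allI continuous_intros log_gamma_product_continuous) auto
  qed simp
  then have "bounded (Upsilon \<beta> ` K)" using K(1) by (intro compact_imp_bounded compact_continuous_image)
  then show ?thesis using that unfolding bounded_iff by blast
qed

text \<open>Reduces mod-Gaussian convergence to an expansion of the logarithm of the moment generating function.
The number \<open>c\<close> accounts for the only difference between the three limiting functions.\<close>
lemma mod_gaussianI: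
  fixes M :: "nat \<Rightarrow> 'a measure" and D :: "nat \<Rightarrow> 'a \<Rightarrow> real" and \<Phi> :: "nat \<Rightarrow> complex \<Rightarrow> complex"
  assumes \<beta>: "0 < \<beta>"
    and P: "\<And>n. 1 \<le> n \<Longrightarrow> prob_space (M n)" and D: "\<And>n. 1 \<le> n \<Longrightarrow> D n \<in> borel_measurable (M n)"
    and int: "\<And>n z. 1 \<le> n \<Longrightarrow> - \<beta>/2 < Re z \<Longrightarrow> integrable (M n) (\<lambda>\<omega>. exp (z * complex_of_real (ln (D n \<omega>))))"
    and \<Phi>: "\<And>n z. 1 \<le> n \<Longrightarrow> - \<beta>/2 < Re z \<Longrightarrow> (LINT \<omega>|M n. exp (z * complex_of_real (ln (D n \<omega>)))) = exp (\<Phi> n z)"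
    and lim: "\<And>K. truncated_half_plane (\<beta>/2) K \<Longrightarrow> uniform_limit K (\<lambda>n z. \<Phi> n z - z * of_real (\<mu> n) - z\<^sup>2 / of_real \<beta> * of_real (ln (real n)))
        (\<lambda>z. Upsilon \<beta> z + z\<^sup>2 / of_real \<beta> * of_real c) sequentially"
  shows "mod_gaussian_convergent M (\<lambda>n \<omega>. ln (D n \<omega>) - \<mu> n) (ereal (- \<beta>/2)) \<infinity> (\<lambda>n. 2/\<beta> * ln (real n))
     (\<lambda>z. exp (Upsilon \<beta> z + z\<^sup>2 / of_real \<beta> * of_real c))"
  unfolding mod_gaussian_convergent_def
proof (intro conjI allI impI ballI)
  have st: "z \<in> strip (ereal (- \<beta>/2)) \<infinity> \<longleftrightarrow> - \<beta>/2 < Re z" for z by (simp add: strip_def)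
  have split: "exp (z * complex_of_real (ln (D n \<omega>) - \<mu> n)) = exp (- (z * of_real (\<mu> n))) * exp (z * complex_of_real (ln (D n \<omega>)))" for z n \<omega>
    by (simp add: exp_add[symmetric] algebra_simps)
  show "ereal (- \<beta> / 2) < 0" using \<beta> by simp
  show "(0::ereal) < \<infinity>" by simp
  show "prob_space (M n)" if "1 \<le> n" for n using P that .
  show "(\<lambda>\<omega>. ln (D n \<omega>) - \<mu> n) \<in> borel_measurable (M n)" if "1 \<le> n" for n using D[OF that] by measurable
  show "integrable (M n) (\<lambda>\<omega>. exp (z * complex_of_real (ln (D n \<omega>) - \<mu> n)))"
    if "1 \<le> n" "z \<in> strip (ereal (- \<beta>/2)) \<infinity>" for n z
    unfolding split by (intro integrable_mult_right int that(1) that(2)[unfolded st])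
  show "filterlim (\<lambda>n. 2/\<beta> * ln (real n)) at_top sequentially" using \<beta> by real_asymp
  fix z assume "z \<in> strip (ereal (- \<beta>/2)) \<infinity>"
  then have "- \<beta>/2 < Re z" by (simp only: st)
  then have z: "- (\<beta>/2) < Re z" by simp
  have g: "0 < \<beta>/2" using \<beta> by simp
  obtain r where r: "0 < r" "truncated_half_plane (\<beta>/2) (cball z r)" "cball z r \<subseteq> {w. - (\<beta>/2) < Re w}"
    using truncated_half_plane_cball[OF g z] .
  obtain C where C: "\<And>w. w \<in> cball z r \<Longrightarrow> norm (Upsilon \<beta> w) \<le> C"
    using Upsilon_bounded[OF \<beta> compact_cball r(2,3)] by blast
  obtain B where B: "\<And>w. w \<in> cball z r \<Longrightarrow> norm w \<le> B" using r(2) unfolding truncated_half_plane_def by blast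
  have "uniform_limit (cball z r) (\<lambda>n w. exp (\<Phi> n w - w * of_real (\<mu> n) - w\<^sup>2 / of_real \<beta> * of_real (ln (real n))))
      (\<lambda>w. exp (Upsilon \<beta> w + w\<^sup>2 / of_real \<beta> * of_real c)) sequentially"
  proof (rule uniform_limit_exp[OF lim[OF r(2)]])
    fix w assume w: "w \<in> cball z r"
    have "norm (Upsilon \<beta> w + w\<^sup>2 / of_real \<beta> * of_real c) \<le> norm (Upsilon \<beta> w) + norm w ^ 2 / \<beta> * \<bar>c\<bar>"
      using norm_triangle_ineq[of "Upsilon \<beta> w" "w\<^sup>2 / of_real \<beta> * of_real c"] \<beta> by (simp add: norm_mult norm_divide norm_power)
    also have "\<dots> \<le> C + B ^ 2 / \<beta> * \<bar>c\<bar>"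
      using C[OF w] B[OF w] \<beta> by (intro add_mono mult_right_mono divide_right_mono power_mono) auto
    finally show "norm (Upsilon \<beta> w + w\<^sup>2 / of_real \<beta> * of_real c) \<le> C + B ^ 2 / \<beta> * \<bar>c\<bar>" .
  qed
  moreover have "\<forall>\<^sub>F n in sequentially. \<forall>w\<in>cball z r. exp (\<Phi> n w - w * of_real (\<mu> n) - w\<^sup>2 / of_real \<beta> * of_real (ln (real n))) =
      (LINT \<omega>|M n. exp (w * complex_of_real (ln (D n \<omega>) - \<mu> n))) * exp (- (complex_of_real (2/\<beta> * ln (real n)) * w\<^sup>2 / 2))"
    using eventually_ge_at_top[of 1]
  proof eventually_elim
    case (elim n)
    show ?case
    proof
      fix w assume "w \<in> cball z r"
      then have w: "- \<beta>/2 < Re w" using r(3) by auto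
      have "(LINT \<omega>|M n. exp (w * complex_of_real (ln (D n \<omega>) - \<mu> n))) = exp (- (w * of_real (\<mu> n))) * exp (\<Phi> n w)"
        unfolding split using \<Phi>[OF elim w] by simp
      moreover have "complex_of_real (2/\<beta> * ln (real n)) * w\<^sup>2 / 2 = w\<^sup>2 / of_real \<beta> * of_real (ln (real n))" by simp
      ultimately show "exp (\<Phi> n w - w * of_real (\<mu> n) - w\<^sup>2 / of_real \<beta> * of_real (ln (real n))) =
      (LINT \<omega>|M n. exp (w * complex_of_real (ln (D n \<omega>) - \<mu> n))) * exp (- (complex_of_real (2/\<beta> * ln (real n)) * w\<^sup>2 / 2))"
        by (simp only: exp_add[symmetric]) (simp add: algebra_simps)
    qed
  qed
  ultimately have "uniform_limit (cball z r) (\<lambda>n w. (LINT \<omega>|M n. exp (w * complex_of_real (ln (D n \<omega>) - \<mu> n))) *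
      exp (- (complex_of_real (2/\<beta> * ln (real n)) * w\<^sup>2 / 2))) (\<lambda>w. exp (Upsilon \<beta> w + w\<^sup>2 / of_real \<beta> * of_real c)) sequentially"
    by (subst (asm) uniform_limit_cong[OF _ refl])
  then show "\<exists>r>0. cball z r \<subseteq> strip (ereal (- \<beta>/2)) \<infinity> \<and> uniform_limit (cball z r) (\<lambda>n w. (LINT \<omega>|M n. exp (w * complex_of_real (ln (D n \<omega>) - \<mu> n))) *
      exp (- (complex_of_real (2/\<beta> * ln (real n)) * w\<^sup>2 / 2))) (\<lambda>w. exp (Upsilon \<beta> w + w\<^sup>2 / of_real \<beta> * of_real c)) sequentially"
    using r(1,3) st by (intro exI[of _ r]) auto
qed

lemma distributed_prod_measurable:
  assumes "finite I" "distributed M (\<Pi>\<^sub>M k\<in>I. lborel) (\<lambda>\<omega>. \<lambda>k\<in>I. lam k \<omega>) f"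
  shows "(\<lambda>\<omega>. \<Prod>k\<in>I. lam k \<omega> :: real) \<in> borel_measurable M"
proof -
  have X: "(\<lambda>\<omega>. \<lambda>k\<in>I. lam k \<omega>) \<in> measurable M (\<Pi>\<^sub>M k\<in>I. (lborel :: real measure))" using assms(2) by (simp add: distributed_def)
  have "(\<lambda>x. \<Prod>k\<in>I. x k :: real) \<in> borel_measurable (\<Pi>\<^sub>M k\<in>I. lborel)" by measurable
  from measurable_compose[OF X this] show ?thesis by simp
qed

lemma laguerre_mod_gaussian:
  assumes \<beta>: "0 < \<beta>" and ens: "\<And>n. 1 \<le> n \<Longrightarrow> laguerre_ensemble \<beta> n (M n) (lam n)"
  shows "mod_gaussian_convergent M (\<lambda>n \<omega>. ln (\<Prod>k=1..n. lam n k \<omega>) - mu_L \<beta> n)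
     (ereal (- \<beta>/2)) \<infinity> (\<lambda>n. 2/\<beta> * ln (real n)) (\<lambda>z. exp (Upsilon \<beta> z))"
proof -
  define \<Phi> where "\<Phi> n z = z * of_real (real n * ln 2) + log_gamma_product (\<beta>/2) n z" for n z
  have g: "0 < \<beta>/2" using \<beta> by simp
  have cen: "mu_L \<beta> n = real n * ln 2 + log_gamma_center \<beta> n" for n
    unfolding mu_L_def log_gamma_center_def using \<beta> by (cases "n = 0") (simp_all add: ln_mult_pos ln_div algebra_simps)
  have "mod_gaussian_convergent M (\<lambda>n \<omega>. ln (\<Prod>k=1..n. lam n k \<omega>) - mu_L \<beta> n)
     (ereal (- \<beta>/2)) \<infinity> (\<lambda>n. 2/\<beta> * ln (real n)) (\<lambda>z. exp (Upsilon \<beta> z + z\<^sup>2 / of_real \<beta> * of_real 0))"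
  proof (rule mod_gaussianI[OF \<beta>, of _ _ \<Phi>])
    fix n :: nat assume n: "1 \<le> n"
    show "prob_space (M n)" using ens[OF n] by (simp add: laguerre_ensemble_def)
    show "(\<lambda>\<omega>. \<Prod>k=1..n. lam n k \<omega>) \<in> borel_measurable (M n)"
      using ens[OF n] distributed_prod_measurable[of "{1..n}"]
      unfolding laguerre_ensemble_def has_density_proportional_to_def by blast
    fix z assume z: "- \<beta>/2 < Re z"
    show "integrable (M n) (\<lambda>\<omega>. exp (z * complex_of_real (ln (\<Prod>k=1..n. lam n k \<omega>))))"
      by (rule laguerre_mellin(1)[OF \<beta> ens[OF n] z])
    show "(LINT \<omega>|M n. exp (z * complex_of_real (ln (\<Prod>k=1..n. lam n k \<omega>)))) = exp (\<Phi> n z)"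
      unfolding laguerre_mellin(2)[OF \<beta> ens[OF n] z] \<Phi>_def exp_add using z by (subst exp_log_gamma_product[OF g]) auto
  next
    fix K assume K: "truncated_half_plane (\<beta>/2) K"
    have "\<Phi> n z - z * of_real (mu_L \<beta> n) - z\<^sup>2 / of_real \<beta> * of_real (ln (real n)) =
        log_gamma_product (\<beta>/2) n z - z * of_real (log_gamma_center \<beta> n) - z\<^sup>2 / of_real \<beta> * of_real (ln (real n))" for n z
      unfolding \<Phi>_def cen by (simp add: algebra_simps)
    then show "uniform_limit K (\<lambda>n z. \<Phi> n z - z * of_real (mu_L \<beta> n) - z\<^sup>2 / of_real \<beta> * of_real (ln (real n)))
        (\<lambda>z. Upsilon \<beta> z + z\<^sup>2 / of_real \<beta> * of_real 0) sequentially"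
      using log_gamma_product_limit_truncated_half_plane[OF \<beta> K] by simp
  qed
  then show ?thesis by simp
qed

text \<open>The \<open>n\<close>-th power of the Gamma quotient is expanded to the order \<open>1 / n\<close>: it contributes
\<open>- n * z * ln (g * n) - (z\<^sup>2 - z) / \<beta>\<close>, whence the correction \<open>1 / \<beta>\<close> in the centering and the summand
\<open>- z\<^sup>2 / \<beta>\<close> in the limit.\<close>
lemma gram_mod_gaussian:
  assumes \<beta>: "0 < \<beta>" and ens: "\<And>n. 1 \<le> n \<Longrightarrow> gram_determinant \<beta> n (M n) (D n) (Q n) (\<rho> n)"
  shows "mod_gaussian_convergent M (\<lambda>n \<omega>. ln (D n \<omega>) - mu_G \<beta> n)
     (ereal (- \<beta>/2)) \<infinity> (\<lambda>n. 2/\<beta> * ln (real n)) (\<lambda>z. exp (Upsilon \<beta> z - z\<^sup>2 / of_real \<beta>))"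
proof -
  define g where "g = \<beta>/2"
  have g: "0 < g" using \<beta> by (simp add: g_def)
  define \<Delta> where "\<Delta> n z = ln_Gamma (of_real (g * real n) + z) - ln_Gamma (of_real (g * real n))" for n and z :: complex
  define \<Phi> where "\<Phi> n z = log_gamma_product (\<beta>/2) n z - of_nat n * \<Delta> n z" for n z
  have "mod_gaussian_convergent M (\<lambda>n \<omega>. ln (D n \<omega>) - mu_G \<beta> n)
     (ereal (- \<beta>/2)) \<infinity> (\<lambda>n. 2/\<beta> * ln (real n)) (\<lambda>z. exp (Upsilon \<beta> z + z\<^sup>2 / of_real \<beta> * of_real (-1)))"
  proof (rule mod_gaussianI[OF \<beta>, of _ _ \<Phi>])
    fix n :: nat assume n: "1 \<le> n"
    show "prob_space (M n)" "D n \<in> borel_measurable (M n)" using ens[OF n] by (simp_all add: gram_determinant_def)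
    fix z assume z: "- \<beta>/2 < Re z"
    show "integrable (M n) (\<lambda>\<omega>. exp (z * complex_of_real (ln (D n \<omega>))))"
      by (rule gram_mellin(1)[OF \<beta> ens[OF n] z n])
    have gn: "g * 1 \<le> g * real n" using n g by (intro mult_left_mono) auto
    have "0 < g * real n + Re z" "0 < g * real n" using gn g z g_def by linarith+
    then have "0 < Re (of_real (g * real n) + z)" "0 < Re (complex_of_real (g * real n))" by simp_all
    then have "exp (\<Delta> n z) = Gamma (of_real (g * real n) + z) / Gamma (of_real (g * real n))"
      unfolding \<Delta>_def by (simp only: exp_diff exp_ln_Gamma_complex)
    then have "exp (- (of_nat n * \<Delta> n z)) = (Gamma (of_real (g * real n)) / Gamma (of_real (g * real n) + z)) ^ n"
      unfolding exp_minus exp_of_nat_mult by (simp add: power_divide)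
    moreover have "exp (log_gamma_product (\<beta>/2) n z) = gamma_product (\<beta>/2) n z" using g z by (intro exp_log_gamma_product) (auto simp: g_def)
    ultimately show "(LINT \<omega>|M n. exp (z * complex_of_real (ln (D n \<omega>)))) = exp (\<Phi> n z)"
      unfolding gram_mellin(2)[OF \<beta> ens[OF n] z n] \<Phi>_def diff_conv_add_uminus exp_add g_def by simp
  next
    fix K assume K: "truncated_half_plane (\<beta>/2) K"
    obtain B where B: "\<And>w. w \<in> K \<Longrightarrow> norm w \<le> B" using K unfolding truncated_half_plane_def by blast
    have xlim: "filterlim (\<lambda>n. g * real n) at_top sequentially" using g by real_asymp
    have lim: "uniform_limit K (\<lambda>n z. of_real (g * real n) * (ln_Gamma (of_real (g * real n) + z) - ln_Gamma (of_real (g * real n)) - z * of_real (ln (g * real n))))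
     (\<lambda>z. (z\<^sup>2 - z) / 2) sequentially"
      by (rule ln_Gamma_ratio_limit[OF xlim B])
    have lim': "uniform_limit K (\<lambda>n z. (1 / of_real g) * (of_real (g * real n) * (ln_Gamma (of_real (g * real n) + z) - ln_Gamma (of_real (g * real n)) - z * of_real (ln (g * real n)))))
     (\<lambda>z. (1 / of_real g) * ((z\<^sup>2 - z) / 2)) sequentially"
      by (rule uniform_limit_mult_bounded[OF lim order_refl])
    have "uniform_limit K (\<lambda>n z. (log_gamma_product (\<beta>/2) n z - z * of_real (log_gamma_center \<beta> n) - z\<^sup>2 / of_real \<beta> * of_real (ln (real n)))
       - (1 / of_real g) * (of_real (g * real n) * (ln_Gamma (of_real (g * real n) + z) - ln_Gamma (of_real (g * real n)) - z * of_real (ln (g * real n)))) - z / of_real \<beta>)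
      (\<lambda>z. Upsilon \<beta> z - (1 / of_real g) * ((z\<^sup>2 - z) / 2) - z / of_real \<beta>) sequentially"
      by (intro uniform_limit_minus log_gamma_product_limit_truncated_half_plane[OF \<beta> K] lim' uniform_limit_const)
    moreover have "(log_gamma_product (\<beta>/2) n z - z * of_real (log_gamma_center \<beta> n) - z\<^sup>2 / of_real \<beta> * of_real (ln (real n)))
       - (1 / of_real g) * (of_real (g * real n) * (ln_Gamma (of_real (g * real n) + z) - ln_Gamma (of_real (g * real n)) - z * of_real (ln (g * real n)))) - z / of_real \<beta> =
       \<Phi> n z - z * of_real (mu_G \<beta> n) - z\<^sup>2 / of_real \<beta> * of_real (ln (real n))" for n z
    proof -
      have c: "mu_G \<beta> n = log_gamma_center \<beta> n - real n * ln (g * real n) + 1 / \<beta>" unfolding mu_G_def log_gamma_center_def g_def by simp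
      have d: "(1 / complex_of_real g) * (of_real (g * real n) * y) = of_nat n * y" for y using g by simp
      show ?thesis unfolding d \<Phi>_def \<Delta>_def c by (simp add: algebra_simps)
    qed
    moreover have "Upsilon \<beta> z - (1 / of_real g) * ((z\<^sup>2 - z) / 2) - z / of_real \<beta> = Upsilon \<beta> z + z\<^sup>2 / of_real \<beta> * of_real (-1)" for z
      unfolding g_def by (simp add: diff_divide_distrib)
    ultimately show "uniform_limit K (\<lambda>n z. \<Phi> n z - z * of_real (mu_G \<beta> n) - z\<^sup>2 / of_real \<beta> * of_real (ln (real n)))
        (\<lambda>z. Upsilon \<beta> z + z\<^sup>2 / of_real \<beta> * of_real (-1)) sequentially" by (simp only:)
  qed
  then show ?thesis by simp
qed

lemma dim_J_over_n:
  assumes \<tau>: "0 < \<tau>" shows "(\<lambda>n. real (dim_J \<tau> n) / real n) \<longlonglongrightarrow> \<tau>"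
proof (rule tendsto_sandwich)
  show "\<forall>\<^sub>F n in sequentially. \<tau> - 1 / real n \<le> real (dim_J \<tau> n) / real n"
    using eventually_gt_at_top[of 0]
  proof eventually_elim
    case (elim n)
    have "real n * \<tau> - 1 \<le> real (dim_J \<tau> n)" unfolding dim_J_def using \<tau> by linarith
    then have "(real n * \<tau> - 1) / real n \<le> real (dim_J \<tau> n) / real n" by (intro divide_right_mono) auto
    then show ?case using elim by (simp add: diff_divide_distrib)
  qed
  show "\<forall>\<^sub>F n in sequentially. real (dim_J \<tau> n) / real n \<le> \<tau>"
    using eventually_gt_at_top[of 0]
  proof eventually_elim
    case (elim n)
    have "0 \<le> real n * \<tau>" using \<tau> by simp
    then have "real (dim_J \<tau> n) \<le> real n * \<tau>" unfolding dim_J_def by linarith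
    then show ?case using elim by (simp add: divide_le_eq mult.commute)
  qed
  show "(\<lambda>n. \<tau> - 1 / real n) \<longlonglongrightarrow> \<tau>" by real_asymp
qed simp

lemma dim_J_at_top:
  assumes \<tau>: "0 < \<tau>" shows "filterlim (dim_J \<tau>) at_top sequentially"
proof -
  have "filterlim (\<lambda>n. \<lfloor>real n * \<tau>\<rfloor>) at_top sequentially" using \<tau> by real_asymp
  then show ?thesis unfolding dim_J_def[abs_def] by (rule filterlim_compose[OF filterlim_nat_sequentially])
qed

text \<open>The expansions at the indices \<open>a n\<close>, \<open>b n\<close> and \<open>a n + b n\<close> combine. The terms linear in the indices give
the two values of \<open>eps\<close>; the logarithms combine to \<open>L n + ln n\<close>, where \<open>L n\<close> tends to
\<open>ln (\<tau>1 * \<tau>2 / (\<tau>1 + \<tau>2))\<close>.\<close>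
lemma jacobi_mod_gaussian:
  assumes \<beta>: "0 < \<beta>" and \<tau>: "0 < \<tau>1" "0 < \<tau>2"
    and ens: "\<And>n. 1 \<le> n \<Longrightarrow> jacobi_ensemble \<beta> (dim_J \<tau>1 n) (dim_J \<tau>2 n) (M n) (lam n)"
  shows "mod_gaussian_convergent M (\<lambda>n \<omega>. ln (\<Prod>k=1..min (dim_J \<tau>1 n) (dim_J \<tau>2 n). lam n k \<omega>) - mu_J \<beta> \<tau>1 \<tau>2 n)
     (ereal (- \<beta>/2)) \<infinity> (\<lambda>n. 2/\<beta> * ln (real n))
     (\<lambda>z. exp (Upsilon \<beta> z + z\<^sup>2 / of_real \<beta> * of_real (ln (\<tau>1 * \<tau>2 / (\<tau>1 + \<tau>2)))))"
proof -
  define g where "g = \<beta>/2"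
  have g: "0 < g" using \<beta> by (simp add: g_def)
  define T where "T = ln (\<tau>1 * \<tau>2 / (\<tau>1 + \<tau>2))"
  define a where "a = dim_J \<tau>1"
  define b where "b = dim_J \<tau>2"
  define L where "L n = ln (real (a n)) + ln (real (b n)) - ln (real (a n + b n)) - ln (real n)" for n
  have pos: "\<forall>\<^sub>F n in sequentially. 1 \<le> n \<and> 1 \<le> a n \<and> 1 \<le> b n"
    using eventually_ge_at_top[of 1] filterlim_at_top[THEN iffD1, OF dim_J_at_top[OF \<tau>(1)], rule_format, of 1]
      filterlim_at_top[THEN iffD1, OF dim_J_at_top[OF \<tau>(2)], rule_format, of 1]
    by eventually_elim (auto simp: a_def b_def)
  have L: "L \<longlonglongrightarrow> T"
  proof -
    have "(\<lambda>n. ln ((real (a n) / real n) * (real (b n) / real n) / (real (a n) / real n + real (b n) / real n))) \<longlonglongrightarrow> T"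
      unfolding T_def a_def b_def using \<tau> by (intro tendsto_intros dim_J_over_n) (auto simp: add_pos_pos)
    moreover have "\<forall>\<^sub>F n in sequentially. ln ((real (a n) / real n) * (real (b n) / real n) / (real (a n) / real n + real (b n) / real n)) = L n"
      using pos
    proof eventually_elim
      case (elim n)
      have p: "0 < real (a n)" "0 < real (b n)" "0 < real n" "0 < real (a n) + real (b n)" using elim by auto
      have "(real (a n) / real n) * (real (b n) / real n) / (real (a n) / real n + real (b n) / real n) =
          (real (a n) * real (b n)) / ((real (a n) + real (b n)) * real n)"
        using p by (simp add: add_divide_distrib[symmetric])
      moreover have "ln ((real (a n) * real (b n)) / ((real (a n) + real (b n)) * real n)) = L n"
        using p unfolding L_def of_nat_add by (simp add: ln_divide_pos ln_mult_pos)
      ultimately show ?case by (simp only:)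
    qed
    ultimately show ?thesis by (rule Lim_transform_eventually)
  qed
  define \<Phi> where "\<Phi> n z = log_gamma_product g (a n) z + log_gamma_product g (b n) z - log_gamma_product g (a n + b n) z" for n z
  show ?thesis
    unfolding T_def[symmetric]
  proof (rule mod_gaussianI[OF \<beta>, of _ _ \<Phi>])
    fix n :: nat assume n: "1 \<le> n"
    show "prob_space (M n)" using ens[OF n] by (simp add: jacobi_ensemble_def)
    show "(\<lambda>\<omega>. \<Prod>k=1..min (dim_J \<tau>1 n) (dim_J \<tau>2 n). lam n k \<omega>) \<in> borel_measurable (M n)"
      using ens[OF n] distributed_prod_measurable[of "{1..min (dim_J \<tau>1 n) (dim_J \<tau>2 n)}"]
      unfolding jacobi_ensemble_def has_density_proportional_to_def by blast
    fix z assume z: "- \<beta>/2 < Re z"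
    show "integrable (M n) (\<lambda>\<omega>. exp (z * complex_of_real (ln (\<Prod>k=1..min (dim_J \<tau>1 n) (dim_J \<tau>2 n). lam n k \<omega>))))"
      by (rule jacobi_mellin(1)[OF \<beta> ens[OF n] z])
    have z': "- g < Re z" using z by (simp add: g_def)
    show "(LINT \<omega>|M n. exp (z * complex_of_real (ln (\<Prod>k=1..min (dim_J \<tau>1 n) (dim_J \<tau>2 n). lam n k \<omega>)))) = exp (\<Phi> n z)"
      unfolding jacobi_mellin(2)[OF \<beta> ens[OF n] z] \<Phi>_def exp_add exp_diff exp_log_gamma_product[OF g z']
      unfolding a_def b_def g_def ..
  next
    fix K assume K: "truncated_half_plane (\<beta>/2) K"
    obtain B where B: "\<And>w. w \<in> K \<Longrightarrow> norm w \<le> B" using K unfolding truncated_half_plane_def by blast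
    define U where "U n z = log_gamma_product (\<beta>/2) n z - z * of_real (log_gamma_center \<beta> n) - z\<^sup>2 / of_real \<beta> * of_real (ln (real n))" for n z
    have U: "uniform_limit K U (Upsilon \<beta>) sequentially"
      unfolding U_def[abs_def] by (rule log_gamma_product_limit_truncated_half_plane[OF \<beta> K])
    have Ua: "uniform_limit K (\<lambda>n. U (a n)) (Upsilon \<beta>) sequentially" and Ub: "uniform_limit K (\<lambda>n. U (b n)) (Upsilon \<beta>) sequentially"
      using filterlim_compose[OF U dim_J_at_top[OF \<tau>(1)]] filterlim_compose[OF U dim_J_at_top[OF \<tau>(2)]]
      by (simp_all add: a_def b_def)
    have "filterlim (\<lambda>n. a n + b n) at_top sequentially"
      by (rule filterlim_at_top_mono[OF dim_J_at_top[OF \<tau>(1)]]) (simp add: a_def)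
    from filterlim_compose[OF U this] have Uab: "uniform_limit K (\<lambda>n. U (a n + b n)) (Upsilon \<beta>) sequentially" .
    \<comment> \<open>the deviation of the combined centerings from \<open>mu_J\<close>, caused by rounding the dimensions\<close>
    define E where "E n = (1/2 - 1/\<beta>) * (L n - T)" for n
    have E: "E \<longlonglongrightarrow> 0" unfolding E_def[abs_def] using tendsto_mult_right_zero[OF LIM_zero[OF L]] by simp
    have e1: "uniform_limit K (\<lambda>n z. z * of_real (E n)) (\<lambda>z. z * of_real 0) sequentially"
      by (rule uniform_limit_mult_bounded[OF uniform_limit_tendsto_const[OF E] B])
    have b2: "norm (z\<^sup>2 / of_real \<beta>) \<le> B\<^sup>2 / \<beta>" if "z \<in> K" for z
      unfolding norm_divide norm_power using B[OF that] \<beta> by (simp add: divide_right_mono power_mono)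
    have e2: "uniform_limit K (\<lambda>n z. z\<^sup>2 / of_real \<beta> * of_real (L n)) (\<lambda>z. z\<^sup>2 / of_real \<beta> * of_real T) sequentially"
      by (rule uniform_limit_mult_bounded[OF uniform_limit_tendsto_const[OF L] b2])
    have "uniform_limit K (\<lambda>n z. U (a n) z + U (b n) z - U (a n + b n) z + z * of_real (E n) + z\<^sup>2 / of_real \<beta> * of_real (L n))
       (\<lambda>z. Upsilon \<beta> z + Upsilon \<beta> z - Upsilon \<beta> z + z * of_real 0 + z\<^sup>2 / of_real \<beta> * of_real T) sequentially"
      by (intro uniform_limit_add uniform_limit_minus Ua Ub Uab e1 e2)
    moreover have "\<forall>\<^sub>F n in sequentially. \<forall>z\<in>K. U (a n) z + U (b n) z - U (a n + b n) z + z * of_real (E n) + z\<^sup>2 / of_real \<beta> * of_real (L n) =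
        \<Phi> n z - z * of_real (mu_J \<beta> \<tau>1 \<tau>2 n) - z\<^sup>2 / of_real \<beta> * of_real (ln (real n))"
      using pos
    proof eventually_elim
      case (elim n)
      have an: "0 < real (a n)" "0 < real (b n)" using elim by auto
      have eps1: "eps x y = x * (ln (x + y) - ln x)" if "0 < x" "0 < y" for x y :: real
      proof -
        have "1 + y / x = (x + y) / x" using that by (simp add: field_simps)
        then show ?thesis using that by (simp add: eps_def ln_div)
      qed
      have lnm: "ln (\<beta>/2 * x) = ln (\<beta>/2) + ln x" if "0 < x" for x
        using \<beta> that ln_mult_pos[of "\<beta>/2" x] by simp
      have ab: "0 < real (a n) + real (b n)" using an by simp
      have c: "log_gamma_center \<beta> (a n) + log_gamma_center \<beta> (b n) - log_gamma_center \<beta> (a n + b n) = mu_J \<beta> \<tau>1 \<tau>2 n + E n"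
        unfolding log_gamma_center_def mu_J_def T_def[symmetric] E_def L_def a_def[symmetric] b_def[symmetric] of_nat_add
          eps1[OF an] eps1[OF an(2) an(1)] lnm[OF an(1)] lnm[OF an(2)] lnm[OF ab]
        by (simp add: algebra_simps)
      have mu: "mu_J \<beta> \<tau>1 \<tau>2 n = log_gamma_center \<beta> (a n) + log_gamma_center \<beta> (b n) - log_gamma_center \<beta> (a n + b n) - E n" using c by simp
      show ?case unfolding U_def \<Phi>_def g_def L_def mu by (simp add: algebra_simps)
    qed
    ultimately show "uniform_limit K (\<lambda>n z. \<Phi> n z - z * of_real (mu_J \<beta> \<tau>1 \<tau>2 n) - z\<^sup>2 / of_real \<beta> * of_real (ln (real n)))
        (\<lambda>z. Upsilon \<beta> z + z\<^sup>2 / of_real \<beta> * of_real T) sequentially"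
      by (subst (asm) uniform_limit_cong) auto
  qed
qed

theorem theorem4p5:
  fixes \<beta> \<tau>1 \<tau>2 :: real
    and PL :: "nat \<Rightarrow> 'l measure" and lamL :: "nat \<Rightarrow> nat \<Rightarrow> 'l \<Rightarrow> real"
    and PG :: "nat \<Rightarrow> 'g measure" and detG :: "nat \<Rightarrow> 'g \<Rightarrow> real"
    and Q :: "nat \<Rightarrow> 'q measure" and \<rho> :: "nat \<Rightarrow> nat \<Rightarrow> 'q \<Rightarrow> real"
    and PJ :: "nat \<Rightarrow> 'j measure" and lamJ :: "nat \<Rightarrow> nat \<Rightarrow> 'j \<Rightarrow> real"
  assumes "\<beta> > 0" and "\<tau>1 > 0" and "\<tau>2 > 0"
  shows
    "((\<forall>n\<ge>1. laguerre_ensemble \<beta> n (PL n) (lamL n)) \<longrightarrow>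
        mod_gaussian_convergent PL
          (\<lambda>n \<omega>. ln (\<Prod>k=1..n. lamL n k \<omega>) - mu_L \<beta> n)
          (ereal (- \<beta>/2)) \<infinity> (\<lambda>n. 2/\<beta> * ln (real n))
          (\<lambda>z. exp (Upsilon \<beta> z)))
     \<and> ((\<forall>n\<ge>1. gram_determinant \<beta> n (PG n) (detG n) (Q n) (\<rho> n)) \<longrightarrow>
        mod_gaussian_convergent PG
          (\<lambda>n \<omega>. ln (detG n \<omega>) - mu_G \<beta> n)
          (ereal (- \<beta>/2)) \<infinity> (\<lambda>n. 2/\<beta> * ln (real n))
          (\<lambda>z. exp (Upsilon \<beta> z - z\<^sup>2 / of_real \<beta>)))
     \<and> ((\<forall>n\<ge>1. jacobi_ensemble \<beta> (dim_J \<tau>1 n) (dim_J \<tau>2 n) (PJ n) (lamJ n)) \<longrightarrow>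
        mod_gaussian_convergent PJ
          (\<lambda>n \<omega>. ln (\<Prod>k=1..min (dim_J \<tau>1 n) (dim_J \<tau>2 n). lamJ n k \<omega>) - mu_J \<beta> \<tau>1 \<tau>2 n)
          (ereal (- \<beta>/2)) \<infinity> (\<lambda>n. 2/\<beta> * ln (real n))
          (\<lambda>z. exp (Upsilon \<beta> z
                    + z\<^sup>2 / of_real \<beta> * of_real (ln (\<tau>1 * \<tau>2 / (\<tau>1 + \<tau>2))))))"
  using laguerre_mod_gaussian[OF assms(1), of PL lamL]
    gram_mod_gaussian[OF assms(1), of PG detG Q \<rho>]
    jacobi_mod_gaussian[OF assms, of PJ lamJ]
  by blast

end
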